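(* Let $\Omega\subset\mathbb{R}^2$ be an open and bounded Lipschitz domain. Let $K:\overline{\Omega}\to\mathbb{R}^{2\times 2}$ be a real symmetric tensor (matrix-valued function) which is continuous throughout the closure $\overline{\Omega}$, with spectral decomposition $K(x,y)=Q(x,y)\Lambda(x,y)Q^T(x,y)$, $QQ^T=Q^TQ=I$, $\Lambda(x,y)=\mathrm{diag}(\kappa_1(x,y),\kappa_2(x,y))$. Let $V=\{v\in H^1(\Omega):\int_\Omega v=0\}$ and let $\mathcal{L}^{-1}\mathcal{A}:V\to V$ be the preconditioned operator associated with $K$ on $V$ (homogeneous Neumann boundary conditions). Then $$\mathrm{sp}(\mathcal{L}^{-1}\mathcal{A})=\mathrm{Conv}\big(\kappa_1(\overline{\Omega})\cup\kappa_2(\overline{\Omega})\big),$$ where $$\mathrm{Conv}\big(\kappa_1(\overline{\Omega})\cup\kappa_2(\overline{\Omega})\big)=\Big[\inf_{(x,y)\in\overline{\Omega}}\min_{i=1,2}\kappa_i(x,y),\ \sup_{(x,y)\in\overline{\Omega}}\max_{i=1,2}\kappa_i(x,y)\Big].$$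
   Context: "Domain" means a nonempty connected open set. With $V'$ the dual space of $V$, the operators $\mathcal{L},\mathcal{A}:V\to V'$ are defined by $$\langle\mathcal{L}\phi,\psi\rangle=\int_\Omega\nabla\phi\cdot\nabla\psi,\qquad \langle\mathcal{A}\phi,\psi\rangle=\int_\Omega K\nabla\phi\cdot\nabla\psi,\qquad \phi,\psi\in V.$$ $V$ is equipped with the inner product $(u,v)_{\mathcal{L}}=\langle\mathcal{L}u,v\rangle=\int_\Omega\nabla u\cdot\nabla v$; $\mathcal{L}$ has a bounded inverse. The spectrum is $$\mathrm{sp}(\mathcal{L}^{-1}\mathcal{A})=\{\lambda\in\mathbb{C}:\ \lambda\mathcal{I}-\mathcal{L}^{-1}\mathcal{A}\ \text{does not have a bounded inverse}\},$$ where for complex $\lambda$ the operator is understood on the complexification of $V$. No definiteness of $K$ is assumed. The numbers $\kappa_1(x,y),\kappa_2(x,y)$ are the two eigenvalues of $K(x,y)$, and $\kappa_i(\overline{\Omega})=\{\kappa_i(x,y):(x,y)\in\overline{\Omega}\}$. *)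

theory Defs
  imports "HOL-Analysis.Analysis"
begin

text \<open>
  Functions on \<open>\<Omega>\<close> are represented by total functions whose values outside \<open>\<Omega>\<close> are never
  looked at. Elements of the Sobolev space and of its subspaces are represented by functions
  rather than by equivalence classes; accordingly, identities between them are stated
  almost everywhere on \<open>\<Omega>\<close>.
\<close>

definition domain_set :: "'a::topological_space set \<Rightarrow> bool" where
  "domain_set \<Omega> \<longleftrightarrow> \<Omega> \<noteq> {} \<and> open \<Omega> \<and> connected \<Omega>"

text \<open>Near each boundary point, in suitable orthogonal coordinates, \<open>\<Omega>\<close> is the set of points
  above the graph of a Lipschitz function.\<close>

definition lipschitz_boundary :: "(real^2) set \<Rightarrow> bool" where
  "lipschitz_boundary \<Omega> \<longleftrightarrow>
     (\<forall>p\<in>frontier \<Omega>. \<exists>r>0. \<exists>(R :: real^2 \<Rightarrow> real^2) (\<gamma> :: real \<Rightarrow> real) C.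
        orthogonal_transformation R \<and> C-lipschitz_on UNIV \<gamma> \<and>
        \<Omega> \<inter> ball p r = {x \<in> ball p r. R x $ 2 > \<gamma> (R x $ 1)})"

definition partial_deriv :: "(real^'n \<Rightarrow> real) \<Rightarrow> 'n::finite \<Rightarrow> real^'n \<Rightarrow> real" where
  "partial_deriv f i x = frechet_derivative f (at x) (axis i 1)"

primrec C_k :: "nat \<Rightarrow> (real^'n::finite \<Rightarrow> real) \<Rightarrow> bool" where
  "C_k 0 f \<longleftrightarrow> continuous_on UNIV f"
| "C_k (Suc k) f \<longleftrightarrow> (\<forall>x. f differentiable (at x)) \<and> (\<forall>i. C_k k (partial_deriv f i))"

definition test_functions :: "(real^'n::finite) set \<Rightarrow> (real^'n \<Rightarrow> real) set" where
  "test_functions \<Omega> =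
     {\<phi>. (\<forall>k. C_k k \<phi>) \<and> compact (closure {x. \<phi> x \<noteq> 0}) \<and> closure {x. \<phi> x \<noteq> 0} \<subseteq> \<Omega>}"

definition L2 :: "(real^'n::finite) set \<Rightarrow> (real^'n \<Rightarrow> 'b::euclidean_space) set" where
  "L2 \<Omega> = {f. f \<in> borel_measurable (lebesgue_on \<Omega>) \<and>
              integrable (lebesgue_on \<Omega>) (\<lambda>x. (norm (f x))\<^sup>2)}"

definition weak_gradient ::
    "(real^'n::finite) set \<Rightarrow> (real^'n \<Rightarrow> real) \<Rightarrow> (real^'n \<Rightarrow> real^'n) \<Rightarrow> bool" where
  "weak_gradient \<Omega> u g \<longleftrightarrow> u \<in> L2 \<Omega> \<and> g \<in> L2 \<Omega> \<and>
     (\<forall>\<phi>\<in>test_functions \<Omega>. \<forall>i.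
        (LINT x|lebesgue_on \<Omega>. u x * partial_deriv \<phi> i x) =
        - (LINT x|lebesgue_on \<Omega>. g x $ i * \<phi> x))"

definition H1 :: "(real^'n::finite) set \<Rightarrow> (real^'n \<Rightarrow> real) set" where
  "H1 \<Omega> = {u. \<exists>g. weak_gradient \<Omega> u g}"

text \<open>The weak gradient is determined only up to a null set; every use of \<open>grad\<close> below is
  inside an integral over \<open>\<Omega>\<close>.\<close>

definition grad :: "(real^'n::finite) set \<Rightarrow> (real^'n \<Rightarrow> real) \<Rightarrow> real^'n \<Rightarrow> real^'n" where
  "grad \<Omega> u = (SOME g. weak_gradient \<Omega> u g)"

definition V :: "(real^'n::finite) set \<Rightarrow> (real^'n \<Rightarrow> real) set" where
  "V \<Omega> = {v \<in> H1 \<Omega>. (LINT x|lebesgue_on \<Omega>. v x) = 0}"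

text \<open>Functionals on \<open>V \<Omega>\<close> are extensional functions (\<open>undefined\<close> outside \<open>V \<Omega>\<close>), so that
  equality of functionals is HOL equality.\<close>

definition op_L ::
    "(real^'n::finite) set \<Rightarrow> (real^'n \<Rightarrow> real) \<Rightarrow> (real^'n \<Rightarrow> real) \<Rightarrow> real" where
  "op_L \<Omega> \<phi> = (\<lambda>\<psi>\<in>V \<Omega>. LINT x|lebesgue_on \<Omega>. grad \<Omega> \<phi> x \<bullet> grad \<Omega> \<psi> x)"

definition op_A ::
    "(real^'n::finite) set \<Rightarrow> (real^'n \<Rightarrow> real^'n^'n) \<Rightarrow>
     (real^'n \<Rightarrow> real) \<Rightarrow> (real^'n \<Rightarrow> real) \<Rightarrow> real" where
  "op_A \<Omega> K \<phi> = (\<lambda>\<psi>\<in>V \<Omega>. LINT x|lebesgue_on \<Omega>. (K x *v grad \<Omega> \<phi> x) \<bullet> grad \<Omega> \<psi> x)"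

definition precond_op ::
    "(real^'n::finite) set \<Rightarrow> (real^'n \<Rightarrow> real^'n^'n) \<Rightarrow> (real^'n \<Rightarrow> real) \<Rightarrow> real^'n \<Rightarrow> real" where
  "precond_op \<Omega> K \<phi> = inv_into (V \<Omega>) (op_L \<Omega>) (op_A \<Omega> K \<phi>)"

text \<open>Complexification of \<open>V \<Omega>\<close>, realised as complex-valued functions.\<close>

definition V_complex :: "(real^'n::finite) set \<Rightarrow> (real^'n \<Rightarrow> complex) set" where
  "V_complex \<Omega> = {f. (\<lambda>x. Re (f x)) \<in> V \<Omega> \<and> (\<lambda>x. Im (f x)) \<in> V \<Omega>}"

definition norm_V_complex :: "(real^'n::finite) set \<Rightarrow> (real^'n \<Rightarrow> complex) \<Rightarrow> real" where
  "norm_V_complex \<Omega> f =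
     sqrt (op_L \<Omega> (\<lambda>x. Re (f x)) (\<lambda>x. Re (f x)) + op_L \<Omega> (\<lambda>x. Im (f x)) (\<lambda>x. Im (f x)))"

definition complexify_op ::
    "((real^'n::finite \<Rightarrow> real) \<Rightarrow> real^'n \<Rightarrow> real) \<Rightarrow> (real^'n \<Rightarrow> complex) \<Rightarrow> real^'n \<Rightarrow> complex" where
  "complexify_op T f = (\<lambda>x. Complex (T (\<lambda>y. Re (f y)) x) (T (\<lambda>y. Im (f y)) x))"

definition ae_eq :: "(real^'n::finite) set \<Rightarrow> (real^'n \<Rightarrow> 'b) \<Rightarrow> (real^'n \<Rightarrow> 'b) \<Rightarrow> bool" where
  "ae_eq \<Omega> f g \<longleftrightarrow> (AE x in lebesgue_on \<Omega>. f x = g x)"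

text \<open>On \<open>V_complex \<Omega>\<close>, being a.e. zero amounts to having norm zero, so the bound below also
  makes \<open>S\<close> compatible with \<open>ae_eq\<close>.\<close>

definition bounded_op_V_complex ::
    "(real^'n::finite) set \<Rightarrow> ((real^'n \<Rightarrow> complex) \<Rightarrow> real^'n \<Rightarrow> complex) \<Rightarrow> bool" where
  "bounded_op_V_complex \<Omega> S \<longleftrightarrow>
     S \<in> V_complex \<Omega> \<rightarrow> V_complex \<Omega> \<and>
     (\<forall>f\<in>V_complex \<Omega>. \<forall>g\<in>V_complex \<Omega>. ae_eq \<Omega> (S (\<lambda>x. f x + g x)) (\<lambda>x. S f x + S g x)) \<and>
     (\<forall>c. \<forall>f\<in>V_complex \<Omega>. ae_eq \<Omega> (S (\<lambda>x. c * f x)) (\<lambda>x. c * S f x)) \<and>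
     (\<exists>M. \<forall>f\<in>V_complex \<Omega>. norm_V_complex \<Omega> (S f) \<le> M * norm_V_complex \<Omega> f)"

definition has_bounded_inverse ::
    "(real^'n::finite) set \<Rightarrow> ((real^'n \<Rightarrow> complex) \<Rightarrow> real^'n \<Rightarrow> complex) \<Rightarrow> bool" where
  "has_bounded_inverse \<Omega> B \<longleftrightarrow>
     (\<exists>S. bounded_op_V_complex \<Omega> S \<and>
          (\<forall>f\<in>V_complex \<Omega>. ae_eq \<Omega> (S (B f)) f \<and> ae_eq \<Omega> (B (S f)) f))"

definition spectrum_V ::
    "(real^'n::finite) set \<Rightarrow> ((real^'n \<Rightarrow> real) \<Rightarrow> real^'n \<Rightarrow> real) \<Rightarrow> complex set" where
  "spectrum_V \<Omega> T =
     {z. \<not> has_bounded_inverse \<Omega> (\<lambda>f x. z * f x - complexify_op T f x)}"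

definition diag2 :: "real \<Rightarrow> real \<Rightarrow> real^2^2" where
  "diag2 a b = (\<chi> i j. if i = j then (if i = 1 then a else b) else 0)"

end

theory Submission
  imports Defs
begin

text \<open>
  A function of \<open>V\<close> is determined by its gradient, and the energy inner product is the \<open>L\<^sup>2\<close> inner product of
  gradients. On the space \<open>G\<close> of gradients the preconditioned operator becomes \<open>T\<close>, multiplication by \<open>K\<close> followed by
  the orthogonal projection to \<open>G\<close>. It is symmetric, and its quadratic form \<open>\<integral> K \<nabla>u \<bullet> \<nabla>u\<close> lies between \<open>m \<parallel>\<nabla>u\<parallel>\<^sup>2\<close> and
  \<open>M \<parallel>\<nabla>u\<parallel>\<^sup>2\<close> if \<open>{m..M}\<close> is the range of \<open>(K x *v \<xi>) \<bullet> \<xi>\<close> over unit vectors \<open>\<xi>\<close>. This range is an interval, being a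
  continuous image of a compact connected set, and it is the convex hull of the eigenvalue ranges
  (\<open>numerical_range_eq_hull\<close>).

  For the spectrum to be contained in the interval, \<open>z - T\<close> has to be inverted for all other \<open>z\<close>
  (\<open>cres_bijective_off_numerical_range\<close>). This requires \<open>G\<close> to be a closed subspace of \<open>L\<^sup>2\<close>, which is the Poincare
  inequality (\<open>poincare_inequality\<close>) in disguise. The Poincare inequality is obtained from a single estimate: moving a
  function by \<open>h\<close> changes it in \<open>L\<^sup>2\<close> by at most \<open>\<bar>h\<bar>\<close> times the norm of its weak gradient, by duality with test functions
  (\<open>translation_estimate\<close>). Averaging over \<open>h\<close> gives the inequality on a ball; translating small balls along the
  domain carries it to all compact subsets; and translating a neighbourhood of a boundary point upwards, away from the
  graph that bounds the domain, carries it up to the boundary.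

  Conversely, let \<open>l = (K x *v \<xi>) \<bullet> \<xi>\<close> with \<open>x\<close> in the domain and \<open>\<xi>\<close> a unit vector
  (\<open>approximate_eigenfunction\<close>). Take \<open>u = \<phi>(y) sin(n \<xi> \<bullet> y) / n\<close>, or the same with the cosine, with a cut-off \<open>\<phi>\<close>
  supported so close to \<open>x\<close> that \<open>K\<close> is almost constant there. The gradient of \<open>u\<close> is almost parallel to \<open>\<xi>\<close>, and \<open>l \<xi> - K(x) \<xi>\<close>
  is orthogonal to \<open>\<xi>\<close>, hence a multiple of \<open>\<xi>\<close> rotated by a right angle. As a rotated gradient is divergence free, it
  is orthogonal to all gradients, so \<open>u\<close> is an approximate eigenfunction for \<open>l\<close>. Since \<open>\<xi>\<close> is any direction, this reaches
  the values between the two eigenvalues as well, even if their ranges are disjoint.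
\<close>

section \<open>Closed subspaces of a Hilbert space\<close>

lemma parallelogram:
  fixes a b :: "'a::real_inner"
  shows "(norm (a + b))\<^sup>2 + (norm (a - b))\<^sup>2 = 2 * (norm a)\<^sup>2 + 2 * (norm b)\<^sup>2"
  by (simp add: power2_norm_eq_inner inner_add_left inner_add_right inner_diff_left inner_diff_right inner_commute)

lemma norm_diff_scaleR_squared:
  fixes a b :: "'a::real_inner"
  shows "(norm (a - t *\<^sub>R b))\<^sup>2 = (norm a)\<^sup>2 - 2 * t * inner a b + t\<^sup>2 * (norm b)\<^sup>2"
  by (simp only: power2_norm_eq_inner inner_diff_left inner_diff_right inner_scaleR_left
      inner_scaleR_right inner_commute[of b a]) (simp add: power2_eq_square algebra_simps)

definition proj :: "'a::real_inner set \<Rightarrow> 'a \<Rightarrow> 'a" where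
  "proj S x = (SOME y. y \<in> S \<and> (\<forall>s\<in>S. inner (x - y) s = 0))"

text \<open>By the parallelogram law every minimising sequence is a Cauchy sequence.\<close>

lemma nearest_point_exists:
  fixes S :: "'a::{real_inner, complete_space} set"
  assumes "subspace S" "closed S"
  shows "\<exists>y\<in>S. \<forall>z\<in>S. norm (x - y) \<le> norm (x - z)"
proof -
  define d where "d = (INF y\<in>S. (norm (x - y))\<^sup>2)"
  have S0: "0 \<in> S" using assms subspace_0 by blast
  have bdd: "bdd_below ((\<lambda>y. (norm (x - y))\<^sup>2) ` S)" by (rule bdd_belowI[of _ 0]) auto
  have dle: "d \<le> (norm (x - y))\<^sup>2" if "y \<in> S" for y
    unfolding d_def by (rule cINF_lower[OF bdd that])
  have "\<exists>y\<in>S. (norm (x - y))\<^sup>2 < d + 1 / real (Suc n)" for n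
    using cINF_less_iff[OF _ bdd, of "d + 1 / real (Suc n)"] S0 unfolding d_def by fastforce
  then obtain y where y: "\<And>n. y n \<in> S" "\<And>n. (norm (x - y n))\<^sup>2 < d + 1 / real (Suc n)" by metis
  have key: "(norm (y m - y n))\<^sup>2 \<le> 2 / real (Suc m) + 2 / real (Suc n)" for m n
  proof -
    have "(1/2) *\<^sub>R (y m + y n) \<in> S" using y assms(1) by (simp add: subspace_add subspace_scale)
    then have "d \<le> (norm (x - (1/2) *\<^sub>R (y m + y n)))\<^sup>2" by (rule dle)
    moreover have "(x - y m) + (x - y n) = 2 *\<^sub>R (x - (1/2) *\<^sub>R (y m + y n))"
      by (simp add: algebra_simps scaleR_2)
    then have "(norm ((x - y m) + (x - y n)))\<^sup>2 = 4 * (norm (x - (1/2) *\<^sub>R (y m + y n)))\<^sup>2"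
      by (simp only: norm_scaleR power_mult_distrib) simp
    moreover have "(norm ((x - y m) - (x - y n)))\<^sup>2 = (norm (y m - y n))\<^sup>2"
      by (simp add: norm_minus_commute)
    ultimately show ?thesis
      using parallelogram[of "x - y m" "x - y n"] y(2)[of m] y(2)[of n] by linarith
  qed
  have "Cauchy y"
  proof (rule metric_CauchyI)
    fix e :: real assume e: "0 < e"
    obtain N where N: "4 / e\<^sup>2 < real N" using reals_Archimedean2 by blast
    have "dist (y m) (y n) < e" if "m \<ge> N" "n \<ge> N" for m n
    proof -
      have pos: "0 < 4 / e\<^sup>2" using e by simp
      have *: "2 / real (Suc k) < e\<^sup>2 / 2" if "k \<ge> N" for k
      proof -
        have "4 / e\<^sup>2 < real (Suc k)" using N that by linarith
        then have "4 < real (Suc k) * e\<^sup>2" using e by (simp add: field_simps)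
        then show ?thesis by (simp add: field_simps)
      qed
      have "(norm (y m - y n))\<^sup>2 < e\<^sup>2" using key[of m n] *[OF that(1)] *[OF that(2)] by linarith
      then show ?thesis using e by (simp add: dist_norm power_less_imp_less_base)
    qed
    then show "\<exists>M. \<forall>m\<ge>M. \<forall>n\<ge>M. dist (y m) (y n) < e" by blast
  qed
  then obtain l where l: "y \<longlonglongrightarrow> l" using Cauchy_convergent convergent_def by blast
  have lS: "l \<in> S" using l y(1) assms(2) closed_sequentially by blast
  have lim1: "(\<lambda>n. (norm (x - y n))\<^sup>2) \<longlonglongrightarrow> (norm (x - l))\<^sup>2" by (intro tendsto_intros l)
  have lim2: "(\<lambda>n. d + 1 / real (Suc n)) \<longlonglongrightarrow> d + 0"
    by (intro tendsto_intros) (use LIMSEQ_inverse_real_of_nat in \<open>simp add: inverse_eq_divide\<close>)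
  have "(norm (x - l))\<^sup>2 \<le> d + 0"
    by (rule LIMSEQ_le[OF lim1 lim2]) (use y(2) less_imp_le in blast)
  then have "norm (x - l) \<le> norm (x - z)" if "z \<in> S" for z
    using dle[OF that] by (intro power2_le_imp_le[OF _ norm_ge_zero]) linarith
  then show ?thesis using lS by blast
qed

lemma orthogonal_if_nearest:
  fixes y :: "'a::real_inner"
  assumes "subspace S" "y \<in> S" "\<And>z. z \<in> S \<Longrightarrow> norm (x - y) \<le> norm (x - z)" "s \<in> S"
  shows "inner (x - y) s = 0"
proof (cases "s = 0")
  case False
  define t where "t = inner (x - y) s / inner s s"
  have "y + t *\<^sub>R s \<in> S" using assms by (simp add: subspace_add subspace_scale)
  then have "(norm (x - y))\<^sup>2 \<le> (norm ((x - y) - t *\<^sub>R s))\<^sup>2"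
    using assms(3)[of "y + t *\<^sub>R s"] by (simp add: diff_diff_eq power_mono)
  also have "\<dots> = (norm (x - y))\<^sup>2 - 2 * t * inner (x - y) s + t\<^sup>2 * inner s s"
    by (simp only: norm_diff_scaleR_squared power2_norm_eq_inner[of s])
  also have "\<dots> = (norm (x - y))\<^sup>2 - (inner (x - y) s)\<^sup>2 / inner s s"
    using False by (simp add: t_def power2_eq_square field_simps)
  finally have "(inner (x - y) s)\<^sup>2 / inner s s \<le> 0" by simp
  moreover have "inner s s > 0" using False inner_gt_zero_iff by blast
  ultimately have "(inner (x - y) s)\<^sup>2 \<le> 0" by (simp only: divide_le_0_iff) linarith
  then show ?thesis by simp
qed simp

lemma proj:
  fixes S :: "'a::{real_inner, complete_space} set"
  assumes "subspace S" "closed S"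
  shows "proj S x \<in> S" and "\<And>s. s \<in> S \<Longrightarrow> inner (proj S x) s = inner x s"
proof -
  have "\<exists>y. y \<in> S \<and> (\<forall>s\<in>S. inner (x - y) s = 0)"
    using nearest_point_exists[OF assms, of x] orthogonal_if_nearest[OF assms(1)] by metis
  from someI_ex[OF this] show "proj S x \<in> S" "\<And>s. s \<in> S \<Longrightarrow> inner (proj S x) s = inner x s"
    unfolding proj_def[symmetric] by (auto simp: inner_diff_left)
qed

lemma subspace_eqI:
  fixes S :: "'a::real_inner set"
  assumes "subspace S" "a \<in> S" "b \<in> S" "\<And>s. s \<in> S \<Longrightarrow> inner a s = inner b s"
  shows "a = b"
proof -
  have "a - b \<in> S" using assms subspace_diff by blast
  then have "inner (a - b) (a - b) = 0" using assms(4)[of "a - b"] by (simp add: inner_diff_left)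
  then show ?thesis by simp
qed

lemma bounded_linear_proj:
  fixes S :: "'a::{real_inner, complete_space} set"
  assumes "subspace S" "closed S"
  shows "bounded_linear (proj S)"
proof (rule bounded_linear_intro[where K = 1])
  note P = proj[OF assms]
  show "proj S (x + y) = proj S x + proj S y" for x y
    by (rule subspace_eqI[OF assms(1)]) (simp_all add: P inner_add_left assms subspace_add)
  show "proj S (r *\<^sub>R x) = r *\<^sub>R proj S x" for r x
    by (rule subspace_eqI[OF assms(1)]) (simp_all add: P assms subspace_scale)
  show "norm (proj S x) \<le> norm x * 1" for x
  proof -
    have "norm (proj S x) * norm (proj S x) = inner (proj S x) (proj S x)"
      by (simp only: power2_norm_eq_inner[symmetric] power2_eq_square)
    also have "\<dots> = inner x (proj S x)" by (rule P(2)[OF P(1)])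
    also have "\<dots> \<le> norm x * norm (proj S x)" by (rule norm_cauchy_schwarz)
    finally show ?thesis by (cases "proj S x = 0") (auto dest: mult_right_le_imp_le)
  qed
qed

text \<open>Banach's fixed point theorem for \<open>x \<mapsto> x - t (P x - f)\<close>, where \<open>t = c / B\<^sup>2\<close> for a bound \<open>B\<close> of \<open>P\<close>.\<close>

lemma coercive_surj:
  fixes S :: "'a::{real_inner, complete_space} set"
  assumes S: "subspace S" "closed S" and P: "bounded_linear P" "\<And>x. x \<in> S \<Longrightarrow> P x \<in> S"
    and c: "c > 0" "\<And>x. x \<in> S \<Longrightarrow> c * (norm x)\<^sup>2 \<le> inner (P x) x" and f: "f \<in> S"
  shows "\<exists>x\<in>S. P x = f"
proof -
  interpret P: bounded_linear P by fact
  obtain B where B: "B > 0" "\<And>x. norm (P x) \<le> norm x * B" using P.pos_bounded by blast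
  \<comment> \<open>Enlarging the bound to at least \<open>c\<close> makes the contraction factor \<open>q\<close> nonnegative.\<close>
  define B' where "B' = max B c"
  have B': "B' > 0" "\<And>x. norm (P x) \<le> B' * norm x" "B' \<ge> c"
  proof -
    show "norm (P x) \<le> B' * norm x" for x
      using order.trans[OF B(2) mult_left_mono[of B B' "norm x"]] by (simp add: B'_def mult.commute)
  qed (use B c(1) in \<open>auto simp: B'_def\<close>)
  define t where "t = c / B'\<^sup>2"
  define q where "q = 1 - c\<^sup>2 / B'\<^sup>2"
  have t: "t > 0" using c B' by (simp add: t_def)
  have q: "0 \<le> q" "q < 1" using B' c by (auto simp: q_def divide_le_eq power_mono)
  define F where "F x = x - t *\<^sub>R (P x - f)" for x
  have contr: "dist (F x) (F y) \<le> sqrt q * dist x y" if "x \<in> S" "y \<in> S" for x y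
  proof -
    define w where "w = x - y"
    have w: "w \<in> S" using that S subspace_diff w_def by blast
    have "F x - F y = w - t *\<^sub>R P w" by (simp add: F_def w_def P.diff algebra_simps)
    then have "(dist (F x) (F y))\<^sup>2 = (norm w)\<^sup>2 - 2 * t * inner (P w) w + t\<^sup>2 * (norm (P w))\<^sup>2"
      unfolding dist_norm by (simp only: norm_diff_scaleR_squared inner_commute[of w])
    also have "\<dots> \<le> (norm w)\<^sup>2 - 2 * t * (c * (norm w)\<^sup>2) + t\<^sup>2 * (B' * norm w)\<^sup>2"
      by (intro add_mono diff_mono mult_left_mono c(2)[OF w] power_mono B'(2)) (use t in auto)
    also have "\<dots> = q * (norm w)\<^sup>2"
      using B'(1) by (simp add: t_def q_def field_simps power2_eq_square)
    finally have "(dist (F x) (F y))\<^sup>2 \<le> (sqrt q * dist x y)\<^sup>2"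
      using q by (simp add: power_mult_distrib w_def dist_norm)
    then show ?thesis by (rule power2_le_imp_le) (use q in auto)
  qed
  have "\<exists>!x. x \<in> S \<and> F x = x"
  proof (rule Banach_fix[of S "sqrt q" F])
    show "complete S" using S(2) by (simp add: complete_eq_closed)
    show "S \<noteq> {}" using f by blast
    show "F ` S \<subseteq> S" using S P(2) f by (auto simp: F_def intro!: subspace_diff subspace_scale)
  qed (use q contr in auto)
  then obtain x where "x \<in> S" "F x = x" by blast
  then show ?thesis using t by (auto simp: F_def)
qed

text \<open>The adjoint turns injectivity with closed range into surjectivity: \<open>A A'\<close> is coercive when \<open>A'\<close> is
  bounded below.\<close>

lemma surj_if_adjoint_bounded_below:
  fixes S :: "'a::{real_inner, complete_space} set"
  assumes S: "subspace S" "closed S" and A: "bounded_linear A" "\<And>x. x \<in> S \<Longrightarrow> A x \<in> S"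
    and A': "bounded_linear A'" "\<And>x. x \<in> S \<Longrightarrow> A' x \<in> S"
    and adj: "\<And>x y. x \<in> S \<Longrightarrow> y \<in> S \<Longrightarrow> inner (A x) y = inner x (A' y)"
    and c: "c > 0" "\<And>x. x \<in> S \<Longrightarrow> c * (norm x)\<^sup>2 \<le> (norm (A' x))\<^sup>2" and f: "f \<in> S"
  shows "\<exists>x\<in>S. A x = f"
proof -
  have "\<exists>x\<in>S. (\<lambda>x. A (A' x)) x = f"
    by (rule coercive_surj[OF S bounded_linear_compose[OF A(1) A'(1)] _ c(1) _ f])
       (use A(2) A'(2) adj c(2) in \<open>auto simp: power2_norm_eq_inner\<close>)
  then show ?thesis using A'(2) by blast
qed

section \<open>The Hilbert space of square-integrable functions\<close>

definition sq_int :: "('a::euclidean_space \<Rightarrow> 'b::euclidean_space) set" where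
  "sq_int = {f \<in> borel_measurable lebesgue. integrable lebesgue (\<lambda>x. (norm (f x))\<^sup>2)}"

lemma sq_intD [measurable_dest]: "f \<in> sq_int \<Longrightarrow> f \<in> borel_measurable lebesgue"
  by (simp add: sq_int_def)

lemma sq_int_norm2: "f \<in> sq_int \<Longrightarrow> integrable lebesgue (\<lambda>x. (norm (f x))\<^sup>2)"
  by (simp add: sq_int_def)

lemma sq_int_dominated:
  assumes "f \<in> borel_measurable lebesgue" "g \<in> sq_int" "\<And>x. norm (f x) \<le> C * norm (g x)"
  shows "f \<in> sq_int"
proof -
  have "integrable lebesgue (\<lambda>x. (norm (f x))\<^sup>2)"
  proof (rule Bochner_Integration.integrable_bound[of _ "\<lambda>x. C\<^sup>2 * (norm (g x))\<^sup>2"])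
    show "integrable lebesgue (\<lambda>x. C\<^sup>2 * (norm (g x))\<^sup>2)" by (intro Bochner_Integration.integrable_add integrable_mult_right sq_int_norm2 assms)
    show "AE x in lebesgue. norm ((norm (f x))\<^sup>2) \<le> norm (C\<^sup>2 * (norm (g x))\<^sup>2)"
      using power_mono[OF assms(3)] by (auto simp: power_mult_distrib abs_mult)
  qed (use assms(1) in measurable)
  then show ?thesis using assms by (simp add: sq_int_def)
qed

lemma sq_int_scaleR [intro]: "f \<in> sq_int \<Longrightarrow> (\<lambda>x. c *\<^sub>R f x) \<in> sq_int"
  by (rule sq_int_dominated[where C = "\<bar>c\<bar>" and g = f]) (auto dest: sq_intD)

lemma sq_int_zero [intro, simp]: "(\<lambda>x. 0) \<in> sq_int" by (simp add: sq_int_def)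

lemma sq_int_add [intro]:
  assumes "f \<in> sq_int" "g \<in> sq_int" shows "(\<lambda>x. f x + g x) \<in> sq_int"
proof -
  note [measurable] = assms[THEN sq_intD]
  have "integrable lebesgue (\<lambda>x. (norm (f x + g x))\<^sup>2)"
  proof (rule Bochner_Integration.integrable_bound[of _ "\<lambda>x. 2 * (norm (f x))\<^sup>2 + 2 * (norm (g x))\<^sup>2"])
    show "integrable lebesgue (\<lambda>x. 2 * (norm (f x))\<^sup>2 + 2 * (norm (g x))\<^sup>2)"
      by (intro Bochner_Integration.integrable_add integrable_mult_right sq_int_norm2 assms)
    have "(norm (f x + g x))\<^sup>2 \<le> 2 * (norm (f x))\<^sup>2 + 2 * (norm (g x))\<^sup>2" for x
      using parallelogram[of "f x" "g x"] zero_le_power2[of "norm (f x - g x)"] by linarith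
    then show "AE x in lebesgue. norm ((norm (f x + g x))\<^sup>2) \<le> norm (2 * (norm (f x))\<^sup>2 + 2 * (norm (g x))\<^sup>2)"
      by auto
  qed measurable
  then show ?thesis using assms by (simp add: sq_int_def)
qed

lemma sq_int_uminus [intro]: "f \<in> sq_int \<Longrightarrow> (\<lambda>x. - f x) \<in> sq_int"
  using sq_int_scaleR[of f "-1"] by simp

lemma sq_int_diff [intro]: "f \<in> sq_int \<Longrightarrow> g \<in> sq_int \<Longrightarrow> (\<lambda>x. f x - g x) \<in> sq_int"
  using sq_int_add[of f "\<lambda>x. - g x"] by auto

lemma sq_int_inner_integrable:
  assumes "f \<in> sq_int" "g \<in> sq_int" shows "integrable lebesgue (\<lambda>x. inner (f x) (g x))"
proof (rule Bochner_Integration.integrable_bound[of _ "\<lambda>x. (norm (f x))\<^sup>2 + (norm (g x))\<^sup>2"])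
  show "integrable lebesgue (\<lambda>x. (norm (f x))\<^sup>2 + (norm (g x))\<^sup>2)" by (intro Bochner_Integration.integrable_add integrable_mult_right sq_int_norm2 assms)
  have "\<bar>inner (f x) (g x)\<bar> \<le> (norm (f x))\<^sup>2 + (norm (g x))\<^sup>2" for x
    using Cauchy_Schwarz_ineq2[of "f x" "g x"] sum_squares_bound[of "norm (f x)" "norm (g x)"]
      mult_nonneg_nonneg[OF norm_ge_zero[of "f x"] norm_ge_zero[of "g x"]] by linarith
  then show "AE x in lebesgue. norm (inner (f x) (g x)) \<le> norm ((norm (f x))\<^sup>2 + (norm (g x))\<^sup>2)" by auto
qed (use assms[THEN sq_intD] in measurable)

text \<open>Square-integrable functions up to null sets form a type, so that they can be an instance of the classes of inner
  product spaces and of complete metric spaces. All domains share this one type through extension by zero.\<close>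

quotient_type (overloaded) ('a, 'b) l2 = "'a::euclidean_space \<Rightarrow> 'b::euclidean_space" /
  partial: "\<lambda>f g. f \<in> sq_int \<and> g \<in> sq_int \<and> (AE x in lebesgue. f x = g x)"
proof (rule part_equivpI)
  show "\<exists>x::'a \<Rightarrow> 'b. x \<in> sq_int \<and> x \<in> sq_int \<and> (AE xa in lebesgue. x xa = x xa)"
    by (intro exI[of _ "\<lambda>x. 0"]) auto
  show "symp (\<lambda>(f::'a \<Rightarrow> 'b) g. f \<in> sq_int \<and> g \<in> sq_int \<and> (AE x in lebesgue. f x = g x))"
    by (rule sympI) (auto simp: eq_commute)
  show "transp (\<lambda>(f::'a \<Rightarrow> 'b) g. f \<in> sq_int \<and> g \<in> sq_int \<and> (AE x in lebesgue. f x = g x))"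
    by (rule transpI) auto
qed

instantiation l2 :: (euclidean_space, euclidean_space) real_inner
begin

lift_definition zero_l2 :: "('a, 'b) l2" is "\<lambda>x. 0" by auto
lift_definition plus_l2 :: "('a, 'b) l2 \<Rightarrow> ('a, 'b) l2 \<Rightarrow> ('a, 'b) l2" is "\<lambda>f g x. f x + g x" by auto
lift_definition minus_l2 :: "('a, 'b) l2 \<Rightarrow> ('a, 'b) l2 \<Rightarrow> ('a, 'b) l2" is "\<lambda>f g x. f x - g x" by auto
lift_definition uminus_l2 :: "('a, 'b) l2 \<Rightarrow> ('a, 'b) l2" is "\<lambda>f x. - f x" by auto
lift_definition scaleR_l2 :: "real \<Rightarrow> ('a, 'b) l2 \<Rightarrow> ('a, 'b) l2" is "\<lambda>c f x. c *\<^sub>R f x" by auto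
lift_definition inner_l2 :: "('a, 'b) l2 \<Rightarrow> ('a, 'b) l2 \<Rightarrow> real" is "\<lambda>f g. LINT x|lebesgue. inner (f x) (g x)"
proof -
  fix f f' g g' :: "'a \<Rightarrow> 'b"
  assume *: "f \<in> sq_int \<and> f' \<in> sq_int \<and> (AE x in lebesgue. f x = f' x)"
    "g \<in> sq_int \<and> g' \<in> sq_int \<and> (AE x in lebesgue. g x = g' x)"
  then have [measurable]: "f \<in> borel_measurable lebesgue" "g \<in> borel_measurable lebesgue"
    "f' \<in> borel_measurable lebesgue" "g' \<in> borel_measurable lebesgue" by (auto dest: sq_intD)
  show "(LINT x|lebesgue. inner (f x) (g x)) = (LINT x|lebesgue. inner (f' x) (g' x))"
    by (rule integral_cong_AE) (use * in \<open>auto elim: AE_mp\<close>)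
qed

definition norm_l2 :: "('a, 'b) l2 \<Rightarrow> real" where "norm_l2 x = sqrt (inner x x)"
definition sgn_l2 :: "('a, 'b) l2 \<Rightarrow> ('a, 'b) l2" where "sgn_l2 x = scaleR (inverse (norm x)) x"
definition dist_l2 :: "('a, 'b) l2 \<Rightarrow> ('a, 'b) l2 \<Rightarrow> real" where "dist_l2 x y = norm (x - y)"
definition uniformity_l2 :: "(('a, 'b) l2 \<times> ('a, 'b) l2) filter" where
  "uniformity_l2 = (INF e\<in>{0<..}. principal {(x, y). dist x y < e})"
definition open_l2 :: "('a, 'b) l2 set \<Rightarrow> bool" where
  "open_l2 U \<longleftrightarrow> (\<forall>x\<in>U. eventually (\<lambda>(x', y). x' = x \<longrightarrow> y \<in> U) uniformity)"

instance
proof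
  fix x y z :: "('a, 'b) l2" and a b :: real
  show "x + y + z = x + (y + z)" by transfer (auto simp: algebra_simps)
  show "x + y = y + x" by transfer (auto simp: algebra_simps)
  show "0 + x = x" by transfer auto
  show "- x + x = 0" by transfer auto
  show "x - y = x + - y" by transfer auto
  show "a *\<^sub>R (x + y) = a *\<^sub>R x + a *\<^sub>R y" by transfer (auto simp: algebra_simps)
  show "(a + b) *\<^sub>R x = a *\<^sub>R x + b *\<^sub>R x" by transfer (auto simp: algebra_simps)
  show "a *\<^sub>R b *\<^sub>R x = (a * b) *\<^sub>R x" by transfer auto
  show "1 *\<^sub>R x = x" by transfer auto
  show "inner x y = inner y x" by transfer (simp add: inner_commute)
  show "inner (x + y) z = inner x z + inner y z"
    by transfer (simp add: inner_add_left sq_int_inner_integrable)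
  show "inner (a *\<^sub>R x) y = a * inner x y" by transfer simp
  show "0 \<le> inner x x" by transfer simp
  show "inner x x = 0 \<longleftrightarrow> x = 0"
  proof transfer
    fix f :: "'a \<Rightarrow> 'b" assume "f \<in> sq_int \<and> f \<in> sq_int \<and> (AE x in lebesgue. f x = f x)"
    then show "((LINT x|lebesgue. inner (f x) (f x)) = 0) =
        (f \<in> sq_int \<and> (\<lambda>x. 0::'b) \<in> sq_int \<and> (AE x in lebesgue. f x = 0))"
      by (subst integral_nonneg_eq_0_iff_AE) (auto simp: sq_int_inner_integrable)
  qed
qed (simp_all add: norm_l2_def sgn_l2_def dist_l2_def uniformity_l2_def open_l2_def)

end

lemma abs_l2_rep: "\<exists>f\<in>sq_int. w = abs_l2 f"
proof -
  have "rep_l2 w \<in> sq_int" using Quotient_rep_reflp[OF Quotient_l2, of w] by blast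
  then show ?thesis using Quotient_abs_rep[OF Quotient_l2, of w, symmetric] by blast
qed

lemma abs_l2_eq: "f \<in> sq_int \<Longrightarrow> g \<in> sq_int \<Longrightarrow> abs_l2 f = abs_l2 g \<longleftrightarrow> (AE x in lebesgue. f x = g x)"
  using Quotient_rel[OF Quotient_l2, of f g] by auto

lemma inner_abs_l2: "f \<in> sq_int \<Longrightarrow> g \<in> sq_int \<Longrightarrow> inner (abs_l2 f) (abs_l2 g) = (LINT x|lebesgue. inner (f x) (g x))"
  by (rule inner_l2.abs_eq) (auto simp: eq_onp_def)

lemma norm_abs_l2: "f \<in> sq_int \<Longrightarrow> (norm (abs_l2 f))\<^sup>2 = (LINT x|lebesgue. (norm (f x))\<^sup>2)"
  by (simp add: power2_norm_eq_inner inner_abs_l2)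

lemma abs_l2_add: "f \<in> sq_int \<Longrightarrow> g \<in> sq_int \<Longrightarrow> abs_l2 f + abs_l2 g = abs_l2 (\<lambda>x. f x + g x)"
  by (rule plus_l2.abs_eq) auto
lemma abs_l2_diff: "f \<in> sq_int \<Longrightarrow> g \<in> sq_int \<Longrightarrow> abs_l2 f - abs_l2 g = abs_l2 (\<lambda>x. f x - g x)"
  by (rule minus_l2.abs_eq) auto
lemma abs_l2_scaleR: "f \<in> sq_int \<Longrightarrow> c *\<^sub>R abs_l2 f = abs_l2 (\<lambda>x. c *\<^sub>R f x)"
  by (rule scaleR_l2.abs_eq) auto
lemma abs_l2_zero: "0 = abs_l2 (\<lambda>x. 0)"
  by (rule zero_l2.abs_eq)

text \<open>Multiplying by such a weight turns \<open>L\<^sup>2\<close>-Cauchy sequences into \<open>L\<^sup>1\<close>-Cauchy sequences, although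
  Lebesgue measure is infinite.\<close>

lemma positive_square_integrable_function:
  "\<exists>w :: 'a::euclidean_space \<Rightarrow> real. w \<in> sq_int \<and> (\<forall>x. w x > 0)"
proof -
  have "\<exists>f :: 'a \<Rightarrow> real. f \<in> borel_measurable lborel \<and> (\<forall>x. 0 < f x) \<and> integrable lborel f"
    by (rule sigma_finite_measure.obtain_positive_integrable_function[OF lborel.sigma_finite_measure_axioms]) blast
  then obtain f :: "'a \<Rightarrow> real" where f: "f \<in> borel_measurable lborel" "\<And>x. 0 < f x" "integrable lborel f"
    by blast
  have "(\<lambda>x. sqrt (f x)) \<in> sq_int"
    using f(1,3) less_imp_le[OF f(2)] unfolding sq_int_def
    by (auto intro!: measurable_completion simp: integrable_completion)
  then show ?thesis using f(2) by (intro exI[of _ "\<lambda>x. sqrt (f x)"]) simp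
qed

lemma sq_int_AE_Cauchy_subseq:
  fixes f :: "nat \<Rightarrow> 'a::euclidean_space \<Rightarrow> 'b::euclidean_space"
  assumes f: "\<And>n. f n \<in> sq_int" and C: "Cauchy (\<lambda>n. abs_l2 (f n))"
  obtains r where "strict_mono r" "AE x in lebesgue. Cauchy (\<lambda>i. f (r i) x)"
proof -
  obtain w :: "'a \<Rightarrow> real" where w: "w \<in> sq_int" "\<And>x. w x > 0" using positive_square_integrable_function by blast
  note [measurable] = sq_intD[OF f] sq_intD[OF w(1)]
  have nw: "(\<lambda>x. norm (g x)) \<in> sq_int" if "g \<in> sq_int" for g :: "'a \<Rightarrow> 'b"
    by (rule sq_int_dominated[OF _ that, of _ 1]) (use sq_intD[OF that] in \<open>auto\<close>)
  have wf: "integrable lebesgue (\<lambda>x. w x *\<^sub>R g x)" if "g \<in> sq_int" for g :: "'a \<Rightarrow> 'b"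
  proof (rule Bochner_Integration.integrable_bound[OF sq_int_inner_integrable[OF w(1) nw[OF that]]])
    show "(\<lambda>x. w x *\<^sub>R g x) \<in> borel_measurable lebesgue" using sq_intD[OF that] by measurable
  qed auto
  have est: "(LINT x|lebesgue. norm (w x *\<^sub>R g x)) \<le> norm (abs_l2 w) * norm (abs_l2 g)" if "g \<in> sq_int" for g :: "'a \<Rightarrow> 'b"
  proof -
    have "(LINT x|lebesgue. norm (w x *\<^sub>R g x)) = inner (abs_l2 w) (abs_l2 (\<lambda>x. norm (g x)))"
      using w(2) by (simp add: inner_abs_l2 w(1) nw[OF that] abs_of_pos)
    also have "\<dots> \<le> norm (abs_l2 w) * norm (abs_l2 (\<lambda>x. norm (g x)))" by (rule norm_cauchy_schwarz)
    also have "norm (abs_l2 (\<lambda>x. norm (g x))) = norm (abs_l2 g)"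
      by (rule power2_eq_imp_eq) (simp_all add: norm_abs_l2 nw[OF that] that)
    finally show ?thesis .
  qed
  have small: "\<exists>N. \<forall>i\<ge>N. \<forall>j\<ge>N. LINT x|lebesgue. norm (w x *\<^sub>R f i x - w x *\<^sub>R f j x) < e" if e: "e > 0" for e
  proof -
    define W where "W = norm (abs_l2 w) + 1"
    have W: "W > 0" by (simp add: W_def add_nonneg_pos)
    obtain N where N: "\<And>i j. i \<ge> N \<Longrightarrow> j \<ge> N \<Longrightarrow> norm (abs_l2 (f i) - abs_l2 (f j)) < e / W"
      using CauchyD[OF C divide_pos_pos[OF e W]] by blast
    have "LINT x|lebesgue. norm (w x *\<^sub>R f i x - w x *\<^sub>R f j x) < e" if "i \<ge> N" "j \<ge> N" for i j
    proof -
      have "(LINT x|lebesgue. norm (w x *\<^sub>R (f i x - f j x))) \<le> norm (abs_l2 w) * norm (abs_l2 (\<lambda>x. f i x - f j x))"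
        by (rule est) (use f in auto)
      also have "\<dots> \<le> W * norm (abs_l2 (f i) - abs_l2 (f j))"
        by (simp add: abs_l2_diff f W_def mult_right_mono)
      also have "\<dots> < e" using N[OF that] W by (simp add: field_simps)
      finally show ?thesis by (simp add: scaleR_diff_right)
    qed
    then show ?thesis by blast
  qed
  obtain r where r: "strict_mono r" "AE x in lebesgue. Cauchy (\<lambda>i. w x *\<^sub>R f (r i) x)"
    using cauchy_L1_AE_cauchy_subseq[of lebesgue "\<lambda>n x. w x *\<^sub>R f n x", OF wf[OF f] small] by blast
  have "Cauchy (\<lambda>i. f (r i) x)" if C': "Cauchy (\<lambda>i. w x *\<^sub>R f (r i) x)" for x
  proof -
    have "Cauchy (\<lambda>i. inverse (w x) *\<^sub>R (w x *\<^sub>R f (r i) x))"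
      by (rule bounded_linear.Cauchy[OF bounded_linear_scaleR_right C'])
    then show ?thesis using w(2)[of x] by simp
  qed
  then have "AE x in lebesgue. Cauchy (\<lambda>i. w x *\<^sub>R f (r i) x) \<longrightarrow> Cauchy (\<lambda>i. f (r i) x)" by blast
  with r(2) have "AE x in lebesgue. Cauchy (\<lambda>i. f (r i) x)" by (rule AE_mp)
  then show ?thesis by (rule that[OF r(1)])
qed

text \<open>The Riesz-Fischer theorem: a subsequence converges almost everywhere, and Fatou's lemma shows that its
  pointwise limit is the limit in the norm.\<close>

instance l2 :: (euclidean_space, euclidean_space) complete_space
proof
  fix X :: "nat \<Rightarrow> ('a, 'b) l2" assume C: "Cauchy X"
  obtain f where f: "\<And>n. f n \<in> sq_int" "\<And>n. X n = abs_l2 (f n)"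
  proof -
    have "\<forall>n. \<exists>f. f \<in> sq_int \<and> X n = abs_l2 f" using abs_l2_rep by blast
    from choice[OF this] show ?thesis using that by blast
  qed
  note [measurable] = sq_intD[OF f(1)]
  have XF: "X = (\<lambda>n. abs_l2 (f n))" using f by auto
  obtain r where r: "strict_mono r" "AE x in lebesgue. Cauchy (\<lambda>i. f (r i) x)"
    by (rule sq_int_AE_Cauchy_subseq[OF f(1) C[unfolded XF]]) blast
  define g where "g x = lim (\<lambda>i. f (r i) x)" for x
  have gm [measurable]: "g \<in> borel_measurable lebesgue"
    unfolding g_def by (rule borel_measurable_lim_metric) measurable
  have conv: "AE x in lebesgue. (\<lambda>i. f (r i) x) \<longlonglongrightarrow> g x"
    using r(2) unfolding g_def by (auto simp: Cauchy_convergent_iff convergent_LIMSEQ_iff)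
  have bnd: "(\<integral>\<^sup>+x. ennreal ((norm (f m x - g x))\<^sup>2) \<partial>lebesgue) \<le> ennreal (e\<^sup>2)"
    if e: "e > 0" and N: "\<forall>i\<ge>N. \<forall>j\<ge>N. norm (X i - X j) < e" and m: "m \<ge> N" for m e N
  proof -
    have "(\<integral>\<^sup>+x. ennreal ((norm (f m x - g x))\<^sup>2) \<partial>lebesgue)
        = (\<integral>\<^sup>+x. liminf (\<lambda>i. ennreal ((norm (f m x - f (r i) x))\<^sup>2)) \<partial>lebesgue)"
    proof (rule nn_integral_cong_AE)
      show "AE x in lebesgue. ennreal ((norm (f m x - g x))\<^sup>2) = liminf (\<lambda>i. ennreal ((norm (f m x - f (r i) x))\<^sup>2))"
        using conv
      proof eventually_elim
        case (elim x)
        have "(\<lambda>i. ennreal ((norm (f m x - f (r i) x))\<^sup>2)) \<longlonglongrightarrow> ennreal ((norm (f m x - g x))\<^sup>2)"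
          by (intro tendsto_intros elim)
        from lim_imp_Liminf[OF _ this] show ?case by simp
      qed
    qed
    also have "\<dots> \<le> liminf (\<lambda>i. \<integral>\<^sup>+x. ennreal ((norm (f m x - f (r i) x))\<^sup>2) \<partial>lebesgue)"
      by (rule nn_integral_liminf) measurable
    also have "\<dots> \<le> ennreal (e\<^sup>2)"
    proof -
      have "\<forall>\<^sub>F i in sequentially. (\<integral>\<^sup>+x. ennreal ((norm (f m x - f (r i) x))\<^sup>2) \<partial>lebesgue) \<le> ennreal (e\<^sup>2)"
      proof (rule eventually_sequentiallyI[of N])
        fix i assume "i \<ge> N"
        then have ri: "r i \<ge> N" using seq_suble[OF r(1), of i] by linarith
        have d: "(\<lambda>x. f m x - f (r i) x) \<in> sq_int" using f(1) by blast
        have "(\<integral>\<^sup>+x. ennreal ((norm (f m x - f (r i) x))\<^sup>2) \<partial>lebesgue) = ennreal ((norm (X m - X (r i)))\<^sup>2)"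
          unfolding f(2) abs_l2_diff[OF f(1) f(1)] norm_abs_l2[OF d]
          by (rule nn_integral_eq_integral[OF sq_int_norm2[OF d]]) auto
        also have "\<dots> \<le> ennreal (e\<^sup>2)"
          using N m ri by (intro ennreal_leI power_mono norm_ge_zero less_imp_le) blast
        finally show "(\<integral>\<^sup>+x. ennreal ((norm (f m x - f (r i) x))\<^sup>2) \<partial>lebesgue) \<le> ennreal (e\<^sup>2)" .
      qed
      then show ?thesis by (intro Liminf_le) auto
    qed
    finally show ?thesis .
  qed
  have sq: "(\<lambda>x. f m x - g x) \<in> sq_int \<and> norm (abs_l2 (\<lambda>x. f m x - g x)) \<le> e"
    if e: "e > 0" and N: "\<forall>i\<ge>N. \<forall>j\<ge>N. norm (X i - X j) < e" and m: "m \<ge> N" for m e N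
  proof -
    have i: "integrable lebesgue (\<lambda>x. (norm (f m x - g x))\<^sup>2)"
    proof (rule integrableI_bounded)
      show "(\<lambda>x. (norm (f m x - g x))\<^sup>2) \<in> borel_measurable lebesgue" by measurable
      have "(\<integral>\<^sup>+x. ennreal (norm ((norm (f m x - g x))\<^sup>2)) \<partial>lebesgue) \<le> ennreal (e\<^sup>2)"
        using bnd[OF that] by simp
      also have "\<dots> < \<infinity>" by simp
      finally show "(\<integral>\<^sup>+x. ennreal (norm ((norm (f m x - g x))\<^sup>2)) \<partial>lebesgue) < \<infinity>" .
    qed
    then have s: "(\<lambda>x. f m x - g x) \<in> sq_int" by (simp add: sq_int_def)
    have "ennreal (LINT x|lebesgue. (norm (f m x - g x))\<^sup>2) \<le> ennreal (e\<^sup>2)"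
      using bnd[OF that] nn_integral_eq_integral[OF i] by simp
    then have "(norm (abs_l2 (\<lambda>x. f m x - g x)))\<^sup>2 \<le> e\<^sup>2" using norm_abs_l2[OF s] by (simp add: ennreal_le_iff)
    then show ?thesis using s e by (simp add: power_mono_iff)
  qed
  have gs: "g \<in> sq_int"
  proof -
    obtain N where "\<forall>i\<ge>N. \<forall>j\<ge>N. norm (X i - X j) < 1" using CauchyD[OF C zero_less_one] by blast
    then have "(\<lambda>x. f N x - g x) \<in> sq_int" using sq[of 1 N N] by simp
    from sq_int_diff[OF f(1)[of N] this] show ?thesis by simp
  qed
  have "X \<longlonglongrightarrow> abs_l2 g"
  proof (rule LIMSEQ_I)
    fix e :: real assume e: "e > 0"
    obtain N where N: "\<forall>i\<ge>N. \<forall>j\<ge>N. norm (X i - X j) < e/2" using CauchyD[OF C half_gt_zero[OF e]] by blast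
    have "norm (X m - abs_l2 g) < e" if "m \<ge> N" for m
      using sq[of "e/2" N m] N e that unfolding f(2) abs_l2_diff[OF f(1) gs] by simp
    then show "\<exists>N. \<forall>m\<ge>N. norm (X m - abs_l2 g) < e" by blast
  qed
  then show "convergent X" by (rule convergentI)
qed

section \<open>Smooth functions and test functions\<close>

lemma partial_deriv_eq:
  "(f has_derivative f') (at x) \<Longrightarrow> partial_deriv f i x = f' (axis i 1)"
  by (simp add: partial_deriv_def frechet_derivative_at[symmetric])

lemma C_k_SucD:
  assumes "C_k (Suc k) f"
  shows "f differentiable (at x)" "C_k k (partial_deriv f i)"
  using assms by auto

lemma C_k_Suc_imp: "C_k (Suc k) f \<Longrightarrow> C_k k f"
proof (induction k arbitrary: f)
  case 0
  then show ?case by (auto simp: continuous_on_eq_continuous_within differentiable_imp_continuous_within)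
qed auto

lemma partial_deriv_add:
  assumes "f differentiable (at x)" "g differentiable (at x)"
  shows "partial_deriv (\<lambda>x. f x + g x) i x = partial_deriv f i x + partial_deriv g i x"
proof -
  have d: "(f has_derivative frechet_derivative f (at x)) (at x)"
    "(g has_derivative frechet_derivative g (at x)) (at x)"
    using assms by (auto simp: frechet_derivative_works[symmetric])
  show ?thesis unfolding partial_deriv_eq[OF has_derivative_add[OF d]] unfolding partial_deriv_def ..
qed

lemma C_k_add: "C_k k f \<Longrightarrow> C_k k g \<Longrightarrow> C_k k (\<lambda>x. f x + g x)"
proof (induction k arbitrary: f g)
  case (Suc k)
  have "partial_deriv (\<lambda>x. f x + g x) i = (\<lambda>x. partial_deriv f i x + partial_deriv g i x)" for i
    by (rule ext, rule partial_deriv_add) (use Suc.prems in auto)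
  then show ?case using Suc by auto
qed (auto intro: continuous_on_add)

lemma partial_deriv_mult:
  assumes "f differentiable (at x)" "g differentiable (at x)"
  shows "partial_deriv (\<lambda>x. f x * g x) i x = f x * partial_deriv g i x + partial_deriv f i x * g x"
proof -
  have d: "(f has_derivative frechet_derivative f (at x)) (at x)"
    "(g has_derivative frechet_derivative g (at x)) (at x)"
    using assms by (auto simp: frechet_derivative_works[symmetric])
  show ?thesis unfolding partial_deriv_eq[OF has_derivative_mult[OF d]] unfolding partial_deriv_def ..
qed

lemma C_k_mult: "C_k k f \<Longrightarrow> C_k k g \<Longrightarrow> C_k k (\<lambda>x. f x * g x)"
proof (induction k arbitrary: f g)
  case (Suc k)
  have "partial_deriv (\<lambda>x. f x * g x) i = (\<lambda>x. f x * partial_deriv g i x + partial_deriv f i x * g x)" for i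
    by (rule ext, rule partial_deriv_mult) (use Suc.prems in auto)
  moreover have "C_k k (\<lambda>x. f x * partial_deriv g i x + partial_deriv f i x * g x)" for i
    by (intro C_k_add Suc.IH) (use Suc.prems C_k_Suc_imp in auto)
  ultimately show ?case using Suc.prems by auto
qed (auto intro: continuous_on_mult)

lemma partial_deriv_const [simp]: "partial_deriv (\<lambda>x. c) i x = 0"
  by (rule partial_deriv_eq) (rule has_derivative_const)

lemma C_k_const: "C_k k (\<lambda>x. c)"
proof (induction k arbitrary: c)
  case (Suc k)
  have "partial_deriv (\<lambda>x::real^'a. c) i = (\<lambda>x. 0)" for i by (rule ext) simp
  then show ?case using Suc by simp
qed simp

lemma C_k_prod: "finite I \<Longrightarrow> (\<And>j. j \<in> I \<Longrightarrow> C_k k (f j)) \<Longrightarrow> C_k k (\<lambda>x. \<Prod>j\<in>I. f j x)"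
  by (induction I rule: finite_induct) (auto intro: C_k_const C_k_mult)

lemma partial_deriv_shift:
  assumes "f differentiable (at (x + a))"
  shows "partial_deriv (\<lambda>x. f (x + a)) i x = partial_deriv f i (x + a)"
proof -
  have "((\<lambda>x. f (x + a)) has_derivative (\<lambda>v. frechet_derivative f (at (x + a)) v)) (at x)"
    by (rule has_derivative_compose[where f = "\<lambda>x. x + a" and g = f and f' = "\<lambda>v. v"])
       (use assms in \<open>auto intro!: derivative_eq_intros simp: frechet_derivative_works[symmetric]\<close>)
  from partial_deriv_eq[OF this] show ?thesis by (simp add: partial_deriv_def)
qed

lemma C_k_shift: "C_k k f \<Longrightarrow> C_k k (\<lambda>x. f (x + a))"
proof (induction k arbitrary: f)
  case 0
  then have "continuous_on UNIV f" by simp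
  then have "continuous_on UNIV (\<lambda>x. f (x + a))"
    by (rule continuous_on_compose2) (auto intro: continuous_intros)
  then show ?case by simp
next
  case (Suc k)
  have "partial_deriv (\<lambda>x. f (x + a)) i = (\<lambda>x. partial_deriv f i (x + a))" for i
    by (rule ext, rule partial_deriv_shift) (use Suc.prems in auto)
  moreover have "(\<lambda>x. f (x + a)) differentiable (at x)" for x
    using differentiable_compose[of f "\<lambda>x. x + a" x] Suc.prems by auto
  ultimately show ?case using Suc by auto
qed

text \<open>All smooth functions below are built from ridge functions \<open>F (v \<bullet> x + c)\<close>, whose partial derivatives are
  multiples of ridge functions of \<open>F'\<close>.\<close>

lemma has_derivative_ridge:
  fixes v :: "real^'n::finite"
  assumes "(F has_real_derivative D) (at (v \<bullet> x + c))"
  shows "((\<lambda>x. F (v \<bullet> x + c)) has_derivative (\<lambda>h. D * (v \<bullet> h))) (at x)"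
  by (rule has_derivative_compose[where f = "\<lambda>x. v \<bullet> x + c" and g = F and f' = "\<lambda>h. v \<bullet> h"])
     (use assms in \<open>auto intro!: derivative_eq_intros simp: has_field_derivative_def\<close>)

lemma partial_deriv_ridge:
  fixes v :: "real^'n::finite"
  assumes "(F has_real_derivative D) (at (v \<bullet> x + c))"
  shows "partial_deriv (\<lambda>x. F (v \<bullet> x + c)) i x = v $ i * D"
  by (simp add: partial_deriv_eq[OF has_derivative_ridge[OF assms]] inner_axis)

text \<open>The function of one variable is \<open>F 0\<close>; the sequence \<open>F\<close> lists its derivatives.\<close>

lemma C_k_ridge:
  fixes v :: "real^'n::finite"
  assumes F: "\<And>n t. (F n has_real_derivative F (Suc n) t) (at t)"
  shows "C_k k (\<lambda>x. F n (v \<bullet> x + c))"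
proof (induction k arbitrary: n)
  case 0
  have "isCont (F n) t" for t using F DERIV_isCont by blast
  then have "continuous_on UNIV (F n)" by (simp add: continuous_at_imp_continuous_on)
  then show ?case by (auto intro!: continuous_on_compose2[of UNIV "F n"] continuous_intros)
next
  case (Suc k)
  have "partial_deriv (\<lambda>x. F n (v \<bullet> x + c)) i = (\<lambda>x. v $ i * F (Suc n) (v \<bullet> x + c))" for i
    by (rule ext, rule partial_deriv_ridge[OF F])
  moreover have "C_k k (\<lambda>x. v $ i * F (Suc n) (v \<bullet> x + c))" for i
    by (rule C_k_mult[OF C_k_const Suc])
  moreover have "(\<lambda>x. F n (v \<bullet> x + c)) differentiable (at x)" for x
    unfolding differentiable_def by (rule exI, rule has_derivative_ridge[OF F])
  ultimately show ?case by simp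
qed

text \<open>The linear span of these functions contains the derivatives of \<open>flat 0\<close>, because
  \<open>(flat n)' = flat (n + 2) - n flat (n + 1)\<close>.\<close>

definition flat :: "nat \<Rightarrow> real \<Rightarrow> real" where
  "flat n t = (if t > 0 then exp (- (1 / t)) / t ^ n else 0)"

lemma flat_limit: "(flat n \<longlongrightarrow> 0) (at 0)"
proof -
  have "(flat n \<longlongrightarrow> 0) (at_left 0)"
    by (rule tendsto_eventually) (auto simp: flat_def eventually_at_filter)
  moreover have "(flat n \<longlongrightarrow> 0) (at_right 0)"
  proof -
    have "((\<lambda>t. t ^ n / exp t) \<longlongrightarrow> (0::real)) at_top" by (rule tendsto_power_div_exp_0)
    then have "((\<lambda>t. (inverse t) ^ n / exp (inverse t)) \<longlongrightarrow> (0::real)) (at_right 0)"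
      by (rule filterlim_compose) (rule filterlim_inverse_at_top_right)
    then show ?thesis
      by (rule Lim_transform_eventually)
         (auto simp: flat_def eventually_at_filter exp_minus field_simps power_inverse)
  qed
  ultimately show ?thesis by (simp add: filterlim_at_split)
qed

lemma flat_has_derivative:
  "(flat n has_real_derivative flat (n + 2) t - real n * flat (Suc n) t) (at t)"
proof -
  consider "t > 0" | "t < 0" | "t = 0" by linarith
  then show ?thesis
  proof cases
    case 1
    have key: "real n * t ^ (n - Suc 0) = real n * t ^ n / t" using 1 by (cases n) auto
    have "((\<lambda>t. exp (- (1 / t)) / t ^ n) has_real_derivative
        (exp (- (1 / t)) * (1 / t\<^sup>2) * t ^ n - exp (- (1 / t)) * (real n * t ^ (n - Suc 0))) / (t ^ n * t ^ n)) (at t)"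
      by (rule derivative_eq_intros refl | use 1 in \<open>simp add: power2_eq_square\<close>)+
    also have "(exp (- (1 / t)) * (1 / t\<^sup>2) * t ^ n - exp (- (1 / t)) * (real n * t ^ (n - Suc 0))) / (t ^ n * t ^ n)
        = flat (n + 2) t - real n * flat (Suc n) t"
      unfolding key using 1 by (simp add: flat_def field_simps power2_eq_square)
    finally have "((\<lambda>t. exp (- (1 / t)) / t ^ n) has_real_derivative flat (n + 2) t - real n * flat (Suc n) t) (at t)" .
    then show ?thesis
      by (rule has_field_derivative_transform_within_open[of _ _ _ "{0<..}"]) (use 1 in \<open>auto simp: flat_def\<close>)
  next
    case 2
    have "((\<lambda>t. 0) has_real_derivative 0) (at t)" by simp
    then have "(flat n has_real_derivative 0) (at t)"
      by (rule has_field_derivative_transform_within_open[of _ _ _ "{..<0}"]) (use 2 in \<open>auto simp: flat_def\<close>)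
    then show ?thesis using 2 by (simp add: flat_def)
  next
    case 3
    have "((\<lambda>h. (flat n (0 + h) - flat n 0) / h) \<longlongrightarrow> 0) (at 0)"
      using flat_limit[of "Suc n"]
      by (rule Lim_transform_eventually) (auto simp: flat_def eventually_at_filter)
    then show ?thesis using 3 by (simp add: DERIV_def flat_def)
  qed
qed

lemma C_k_flat_ridge:
  fixes v :: "real^'n::finite"
  shows "C_k k (\<lambda>x. flat n (v \<bullet> x + c))"
proof (induction k arbitrary: n)
  case 0
  have "isCont (flat n) t" for t using flat_has_derivative DERIV_isCont by blast
  then have "continuous_on UNIV (flat n)" by (simp add: continuous_at_imp_continuous_on)
  then show ?case by (auto intro!: continuous_on_compose2[of UNIV "flat n"] continuous_intros)
next
  case (Suc k)
  have "partial_deriv (\<lambda>x. flat n (v \<bullet> x + c)) i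
      = (\<lambda>x. v $ i * (flat (n + 2) (v \<bullet> x + c) + (- real n) * flat (Suc n) (v \<bullet> x + c)))" for i
    by (rule ext) (simp add: partial_deriv_ridge[OF flat_has_derivative])
  moreover have "C_k k (\<lambda>x. v $ i * (flat (n + 2) (v \<bullet> x + c) + (- real n) * flat (Suc n) (v \<bullet> x + c)))" for i
    by (intro C_k_mult C_k_const C_k_add Suc)
  moreover have "(\<lambda>x. flat n (v \<bullet> x + c)) differentiable (at x)" for x
    unfolding differentiable_def by (rule exI, rule has_derivative_ridge[OF flat_has_derivative])
  ultimately show ?case by simp
qed

subsection \<open>Test functions\<close>

lemma test_functionI:
  assumes "\<And>k. C_k k \<phi>" "compact K" "K \<subseteq> \<Omega>" "\<And>x. \<phi> x \<noteq> 0 \<Longrightarrow> x \<in> K"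
  shows "\<phi> \<in> test_functions \<Omega>"
proof -
  have "closure {x. \<phi> x \<noteq> 0} \<subseteq> K"
    by (rule closure_minimal) (use assms compact_imp_closed in auto)
  then show ?thesis
    unfolding test_functions_def
    using assms compact_Int_closed[OF assms(2) closed_closure, of "{x. \<phi> x \<noteq> 0}"] by (auto simp: Int_absorb1)
qed

lemma test_functionE:
  assumes "\<phi> \<in> test_functions \<Omega>"
  obtains K where "compact K" "K \<subseteq> \<Omega>" "\<And>x. x \<notin> K \<Longrightarrow> \<phi> x = 0" "\<And>i x. x \<notin> K \<Longrightarrow> partial_deriv \<phi> i x = 0"
    "\<And>k. C_k k \<phi>"
proof
  show "partial_deriv \<phi> i x = 0" if x: "x \<notin> closure {x. \<phi> x \<noteq> 0}" for i x
  proof -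
    have "((\<lambda>x. 0) has_derivative (\<lambda>x. 0)) (at x)" by simp
    then have "(\<phi> has_derivative (\<lambda>x. 0)) (at x)"
      by (rule has_derivative_transform_within_open[where s = "- closure {x. \<phi> x \<noteq> 0}"])
         (use x closure_subset[of "{x. \<phi> x \<noteq> 0}"] in auto)
    then show ?thesis by (simp add: partial_deriv_eq)
  qed
qed (use assms closure_subset[of "{x. \<phi> x \<noteq> 0}"] in \<open>auto simp: test_functions_def simp del: C_k.simps\<close>)

lemma test_zero: "(\<lambda>x. 0) \<in> test_functions \<Omega>"
  by (rule test_functionI[where K = "{}"]) (auto intro: C_k_const)

lemma test_mono: "\<Omega> \<subseteq> \<Omega>' \<Longrightarrow> test_functions \<Omega> \<subseteq> test_functions \<Omega>'"
  by (auto simp: test_functions_def)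

lemma test_mult:
  assumes "\<phi> \<in> test_functions \<Omega>" "\<And>k. C_k k \<eta>"
  shows "(\<lambda>x. \<eta> x * \<phi> x) \<in> test_functions \<Omega>"
proof -
  obtain K where K: "compact K" "K \<subseteq> \<Omega>" "\<And>x. x \<notin> K \<Longrightarrow> \<phi> x = 0"
    "\<And>i x. x \<notin> K \<Longrightarrow> partial_deriv \<phi> i x = 0" "\<And>k. C_k k \<phi>"
    by (rule test_functionE[OF assms(1)]) (rule that)
  show ?thesis by (rule test_functionI[OF C_k_mult[OF assms(2) K(5)] K(1,2)]) (use K(3) in auto)
qed

lemma test_scale: "\<phi> \<in> test_functions \<Omega> \<Longrightarrow> (\<lambda>x. c * \<phi> x) \<in> test_functions \<Omega>"
  by (rule test_mult) (auto intro: C_k_const)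

lemma test_add:
  assumes "\<phi> \<in> test_functions \<Omega>" "\<eta> \<in> test_functions \<Omega>"
  shows "(\<lambda>x. \<phi> x + \<eta> x) \<in> test_functions \<Omega>"
proof -
  obtain K where K: "compact K" "K \<subseteq> \<Omega>" "\<And>x. x \<notin> K \<Longrightarrow> \<phi> x = 0"
    "\<And>i x. x \<notin> K \<Longrightarrow> partial_deriv \<phi> i x = 0" "\<And>k. C_k k \<phi>"
    by (rule test_functionE[OF assms(1)]) (rule that)
  obtain L where L: "compact L" "L \<subseteq> \<Omega>" "\<And>x. x \<notin> L \<Longrightarrow> \<eta> x = 0"
    "\<And>i x. x \<notin> L \<Longrightarrow> partial_deriv \<eta> i x = 0" "\<And>k. C_k k \<eta>"
    by (rule test_functionE[OF assms(2)]) (rule that)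
  show ?thesis
  proof (rule test_functionI[OF C_k_add[OF K(5) L(5)] compact_Un[OF K(1) L(1)]])
    show "x \<in> K \<union> L" if "\<phi> x + \<eta> x \<noteq> 0" for x using K(3)[of x] L(3)[of x] that
      by (cases "x \<in> K"; cases "x \<in> L") auto
  qed (use K(2) L(2) in blast)
qed

lemma test_partial:
  assumes "\<phi> \<in> test_functions \<Omega>"
  shows "partial_deriv \<phi> i \<in> test_functions \<Omega>"
proof -
  obtain K where K: "compact K" "K \<subseteq> \<Omega>" "\<And>x. x \<notin> K \<Longrightarrow> \<phi> x = 0"
    "\<And>i x. x \<notin> K \<Longrightarrow> partial_deriv \<phi> i x = 0" "\<And>k. C_k k \<phi>"
    by (rule test_functionE[OF assms(1)]) (rule that)
  show ?thesis by (rule test_functionI[OF C_k_SucD(2)[OF K(5)] K(1,2)]) (use K(4) in auto)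
qed

lemma test_shift:
  assumes "\<phi> \<in> test_functions U" "\<And>x. x \<in> U \<Longrightarrow> x + h \<in> \<Omega>"
  shows "(\<lambda>x. \<phi> (x - h)) \<in> test_functions \<Omega>"
proof -
  obtain K where K: "compact K" "K \<subseteq> U" "\<And>x. x \<notin> K \<Longrightarrow> \<phi> x = 0"
    "\<And>i x. x \<notin> K \<Longrightarrow> partial_deriv \<phi> i x = 0" "\<And>k. C_k k \<phi>"
    by (rule test_functionE[OF assms(1)]) (rule that)
  have "C_k k (\<lambda>x. \<phi> (x + - h))" for k by (rule C_k_shift[OF K(5)])
  moreover have "compact ((\<lambda>x. x + h) ` K)"
    by (rule compact_continuous_image[OF _ K(1)]) (intro continuous_intros)
  moreover have "x \<in> (\<lambda>x. x + h) ` K" if "\<phi> (x - h) \<noteq> 0" for x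
    using K(3)[of "x - h"] that by (intro image_eqI[of _ _ "x - h"]) auto
  ultimately show ?thesis using K(2) assms(2)
    by (intro test_functionI[of _ "(\<lambda>x. x + h) ` K"]) auto
qed

lemma test_continuous: "\<phi> \<in> test_functions \<Omega> \<Longrightarrow> continuous_on UNIV \<phi>"
proof -
  assume "\<phi> \<in> test_functions \<Omega>"
  then have "C_k 0 \<phi>" unfolding test_functions_def by blast
  then show ?thesis by simp
qed

lemma test_bounded:
  assumes "\<phi> \<in> test_functions \<Omega>"
  shows "\<exists>B\<ge>0. \<forall>x. \<bar>\<phi> x\<bar> \<le> B"
proof -
  obtain K where K: "compact K" "K \<subseteq> \<Omega>" "\<And>x. x \<notin> K \<Longrightarrow> \<phi> x = 0"
    "\<And>i x. x \<notin> K \<Longrightarrow> partial_deriv \<phi> i x = 0" "\<And>k. C_k k \<phi>"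
    by (rule test_functionE[OF assms(1)]) (rule that)
  have "compact (\<phi> ` K)"
    by (rule compact_continuous_image[OF continuous_on_subset[OF test_continuous[OF assms]] K(1)]) auto
  then obtain B where B: "\<forall>y\<in>\<phi> ` K. norm y \<le> B" using compact_imp_bounded[of "\<phi> ` K"] unfolding bounded_iff by blast
  have "\<bar>\<phi> x\<bar> \<le> max B 0" for x using K(3)[of x] B by (cases "x \<in> K") (auto simp: le_max_iff_disj)
  then show ?thesis by (intro exI[of _ "max B 0"]) auto
qed

lemma test_measurable [measurable_dest]:
  "\<phi> \<in> test_functions \<Omega> \<Longrightarrow> \<phi> \<in> borel_measurable lebesgue"
  by (rule measurable_completion) (simp add: borel_measurable_continuous_onI test_continuous)

lemma sq_int_bounded_support:
  fixes f :: "'a::euclidean_space \<Rightarrow> 'b::euclidean_space"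
  assumes "f \<in> borel_measurable lebesgue" "\<And>x. norm (f x) \<le> B" "bounded K" "\<And>x. x \<notin> K \<Longrightarrow> f x = 0"
  shows "f \<in> sq_int"
proof -
  obtain R where R: "K \<subseteq> cball 0 R"
    using bounded_subset_ballD[OF assms(3), of 0] ball_subset_cball by blast
  have [simp]: "integrable lebesgue (indicator (cball (0::'a) R) :: 'a \<Rightarrow> real)"
    by (rule integrable_real_indicator) (use emeasure_bounded_finite[OF bounded_cball] in simp_all)
  have B: "B \<ge> 0" using order.trans[OF norm_ge_zero assms(2)] .
  have "(\<lambda>x. B * indicator (cball 0 R) x) \<in> (sq_int :: ('a \<Rightarrow> real) set)"
  proof -
    have "(\<lambda>x. (norm (B * indicator (cball 0 R) x))\<^sup>2) = (\<lambda>x::'a. B\<^sup>2 * indicator (cball 0 R) x)"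
      by (rule ext) (simp split: split_indicator)
    moreover have "(\<lambda>x::'a. B * indicat_real (cball 0 R) x) \<in> borel_measurable lebesgue"
      by (intro borel_measurable_times borel_measurable_const borel_measurable_indicator) simp
    ultimately show ?thesis unfolding sq_int_def by simp
  qed
  then show ?thesis
  proof (rule sq_int_dominated[OF assms(1), where C = 1])
    show "norm (f x) \<le> 1 * norm (B * indicat_real (cball 0 R) x)" for x
    proof (cases "x \<in> K")
      case True
      then have "indicat_real (cball 0 R) x = 1" using R by (simp add: subset_iff indicator_def)
      then show ?thesis using assms(2)[of x] B by simp
    next
      case False
      then show ?thesis by (simp add: assms(4))
    qed
  qed
qed

lemma sq_int_indicator:
  assumes "bounded K" "K \<in> sets lebesgue" shows "(\<lambda>x. indicator K x) \<in> (sq_int :: ('a::euclidean_space \<Rightarrow> real) set)"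
proof (rule sq_int_bounded_support[of _ 1 K])
  show "(\<lambda>x. indicator K x :: real) \<in> borel_measurable lebesgue"
    by (rule borel_measurable_indicator[OF assms(2)])
qed (use assms(1) in \<open>auto simp: indicator_def\<close>)

lemma test_sq_int:
  assumes "\<phi> \<in> test_functions \<Omega>" shows "\<phi> \<in> sq_int"
proof -
  obtain K where K: "compact K" "K \<subseteq> \<Omega>" "\<And>x. x \<notin> K \<Longrightarrow> \<phi> x = 0"
    "\<And>i x. x \<notin> K \<Longrightarrow> partial_deriv \<phi> i x = 0" "\<And>k. C_k k \<phi>"
    by (rule test_functionE[OF assms(1)]) (rule that)
  obtain B where "\<And>x. \<bar>\<phi> x\<bar> \<le> B" using test_bounded[OF assms] by blast
  then show ?thesis
    by (intro sq_int_bounded_support[of _ B K]) (use K test_measurable[OF assms] compact_imp_bounded in auto)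
qed

subsection \<open>Smooth approximations of boxes\<close>

text \<open>Since \<open>exp (- 1 / t)\<close> tends to \<open>1\<close> as \<open>t\<close> grows, these smooth functions tend to the indicator of the open box
  as \<open>m\<close> grows, without any plateau.\<close>

definition box_bump :: "real^'n::finite \<Rightarrow> real^'n \<Rightarrow> real \<Rightarrow> real^'n \<Rightarrow> real" where
  "box_bump a b m x = (\<Prod>i\<in>UNIV. flat 0 (m * (x $ i - a $ i)) * flat 0 (m * (b $ i - x $ i)))"

lemma flat_0_bounds: "0 \<le> flat 0 t" "flat 0 t \<le> 1"
  by (auto simp: flat_def)

lemma box_bump_bounds: "0 \<le> box_bump a b m x" "box_bump a b m x \<le> 1"
  by (auto simp: box_bump_def intro!: prod_nonneg prod_le_1 mult_nonneg_nonneg mult_le_one flat_0_bounds)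

lemma box_bump_nonzero:
  assumes "m > 0" shows "box_bump a b m x \<noteq> 0 \<longleftrightarrow> x \<in> box a b"
  using assms by (auto simp: box_bump_def mem_box_cart flat_def zero_less_mult_iff)

lemma box_bump_ridges:
  "box_bump a b m = (\<lambda>x. \<Prod>i\<in>UNIV. flat 0 (axis i m \<bullet> x + (- m * a $ i)) * flat 0 (axis i (- m) \<bullet> x + m * b $ i))"
  by (rule ext) (simp add: box_bump_def inner_axis' algebra_simps)

lemma C_k_box_bump: "C_k k (box_bump a b m)"
  unfolding box_bump_ridges by (intro C_k_prod C_k_mult C_k_flat_ridge) simp

lemma test_box_bump:
  assumes "m > 0" "cbox a b \<subseteq> \<Omega>"
  shows "box_bump a b m \<in> test_functions \<Omega>"
  by (rule test_functionI[OF C_k_box_bump compact_cbox assms(2)])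
     (use box_bump_nonzero[OF assms(1)] box_subset_cbox in blast)

lemma box_bump_limit: "(\<lambda>n. box_bump a b (real (Suc n)) x) \<longlonglongrightarrow> indicator (box a b) x"
proof (cases "x \<in> box a b")
  case True
  have flat: "(\<lambda>n. flat 0 (real (Suc n) * t)) \<longlonglongrightarrow> 1" if "t > 0" for t
  proof -
    have "(\<lambda>n. exp (- (inverse t * inverse (real (Suc n))))) \<longlonglongrightarrow> exp (- (inverse t * 0))"
      by (intro tendsto_intros LIMSEQ_inverse_real_of_nat)
    moreover have "flat 0 (real (Suc n) * t) = exp (- (inverse t * inverse (real (Suc n))))" for n
      using mult_pos_pos[of "real (Suc n)" t] that
      by (simp add: flat_def divide_inverse mult.commute del: of_nat_Suc)
    ultimately show ?thesis by simp
  qed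
  have "(\<lambda>n. box_bump a b (real (Suc n)) x) \<longlonglongrightarrow> (\<Prod>i\<in>(UNIV::'a set). 1 * 1)"
    unfolding box_bump_def by (intro tendsto_prod tendsto_mult flat) (use True in \<open>auto simp: mem_box_cart\<close>)
  then show ?thesis using True by simp
next
  case False
  then have "box_bump a b (real (Suc n)) x = 0" for n using box_bump_nonzero[of "real (Suc n)" a b x] by auto
  then show ?thesis using False by simp
qed

subsection \<open>The fundamental lemma of the calculus of variations\<close>

text \<open>Open boxes form a generator of the Borel sets that is stable under intersections.\<close>

lemma AE_zero_if_box_integrals_zero:
  fixes f :: "'a::euclidean_space \<Rightarrow> real"
  assumes f: "integrable lebesgue f" and z: "(LINT x|lebesgue. f x) = 0"
    and box: "\<And>a b. (LINT x|lebesgue. indicator (box a b) x * f x) = 0"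
  shows "AE x in lebesgue. f x = 0"
proof -
  have int: "integrable lebesgue (\<lambda>x. indicator A x * f x)" if "A \<in> sets lebesgue" for A
    using integrable_mult_indicator[OF that f] by simp
  have sb: "A \<in> sets lebesgue" if "A \<in> sigma_sets UNIV (range (\<lambda>(a, b). box a b :: 'a set))" for A
  proof -
    have "A \<in> sets borel" using that by (simp add: borel_eq_box)
    then show ?thesis by auto
  qed
  have borel: "(LINT x|lebesgue. indicator A x * f x) = 0" if A: "A \<in> sets borel" for A
  proof -
    have "Int_stable (range (\<lambda>(a, b). box a b :: 'a set))"
      by (auto simp: Int_stable_def box_Int_box)
    moreover have "range (\<lambda>(a, b). box a b :: 'a set) \<subseteq> Pow UNIV" by simp
    moreover have "A \<in> sigma_sets UNIV (range (\<lambda>(a, b). box a b :: 'a set))" using A by (simp add: borel_eq_box)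
    ultimately show ?thesis
    proof (induction rule: sigma_sets_induct_disjoint)
      case (basic A)
      then show ?case using box by auto
    next
      case (compl A)
      have "(LINT x|lebesgue. indicator (UNIV - A) x * f x) = (LINT x|lebesgue. f x - indicator A x * f x)"
        by (rule Bochner_Integration.integral_cong) (auto simp: indicator_def)
      then show ?case using compl z f int[OF sb[OF compl(1)]] by simp
    next
      case (union A)
      have "set_integrable lebesgue (\<Union>i. A i) f" unfolding set_integrable_def
        by (rule integrable_mult_indicator[OF _ f]) (use union(2) sb in blast)
      then have "(LINT x:(\<Union>i. A i)|lebesgue. f x) = (\<Sum>i. LINT x:A i|lebesgue. f x)"
      proof (intro lebesgue_integral_countable_add)
        show "A i \<in> sets lebesgue" for i using union(2) sb by blast
      qed (use union(1) in \<open>auto simp: disjoint_family_on_def\<close>)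
      then show ?case using union(3) by (simp add: set_lebesgue_integral_def)
    qed auto
  qed
  have sf: "sigma_finite_measure (lebesgue :: 'a measure)"
  proof
    obtain C :: "'a set set" where C: "countable C" "C \<subseteq> sets lborel" "\<Union>C = space lborel"
        "\<forall>a\<in>C. emeasure lborel a \<noteq> \<infinity>"
      using lborel.sigma_finite_countable by blast
    then show "\<exists>A::'a set set. countable A \<and> A \<subseteq> sets lebesgue \<and> \<Union>A = space lebesgue
        \<and> (\<forall>a\<in>A. emeasure lebesgue a \<noteq> \<infinity>)"
      by (intro exI[of _ C]) auto
  qed
  show ?thesis
  proof (rule sigma_finite_measure.density_zero[OF sf f])
    fix A :: "'a set" assume "A \<in> sets lebesgue"
    then obtain B N N' where B: "A = B \<union> N" "N \<subseteq> N'" "N' \<in> null_sets lborel" "B \<in> sets lborel"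
      by (rule sets_completionE)
    have "N' \<in> null_sets lebesgue" using B(3) by (simp add: null_sets_completionI)
    then have ae: "AE x in lebesgue. x \<notin> N'" by (rule AE_not_in)
    have [measurable]: "A \<in> sets lebesgue" "B \<in> sets lebesgue" "f \<in> borel_measurable lebesgue"
      using \<open>A \<in> sets lebesgue\<close> B(4) f by auto
    have "(LINT x|lebesgue. indicator A x * f x) = (LINT x|lebesgue. indicator B x * f x)"
    proof (rule integral_cong_AE)
      show "AE x in lebesgue. indicat_real A x * f x = indicator B x * f x"
        using ae by eventually_elim (use B in \<open>auto simp: indicator_def\<close>)
    qed measurable
    then show "(LINT x:A|lebesgue. f x) = 0" using borel[of B] B(4) by (simp add: set_lebesgue_integral_def)
  qed
qed

text \<open>Dominated convergence along \<open>box_bump\<close> gives vanishing integrals over all boxes whose closure lies in \<open>U\<close>, and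
  countably many closed boxes exhaust \<open>U\<close>.\<close>

lemma fundamental_lemma:
  fixes f :: "real^'n::finite \<Rightarrow> real"
  assumes f: "f \<in> sq_int" and U: "open U"
    and t: "\<And>\<phi>. \<phi> \<in> test_functions U \<Longrightarrow> (LINT x|lebesgue. f x * \<phi> x) = 0"
  shows "AE x in lebesgue. x \<in> U \<longrightarrow> f x = 0"
proof -
  note [measurable] = sq_intD[OF f]
  have ind: "(\<lambda>x. indicator (cbox a b) x) \<in> (sq_int :: (real^'n \<Rightarrow> real) set)" for a b
    by (rule sq_int_indicator[OF bounded_cbox]) simp
  have int: "integrable lebesgue (\<lambda>x. f x * indicator (cbox a b) x)" for a b
    using sq_int_inner_integrable[OF f ind] by simp
  have box0: "(LINT x|lebesgue. f x * indicator (box a b) x) = 0" if ab: "cbox a b \<subseteq> U" for a b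
  proof -
    have "(\<lambda>n. LINT x|lebesgue. f x * box_bump a b (real (Suc n)) x) \<longlonglongrightarrow> (LINT x|lebesgue. f x * indicator (box a b) x)"
    proof (rule integral_dominated_convergence[where w = "\<lambda>x. \<bar>f x * indicator (cbox a b) x\<bar>"])
      show "integrable lebesgue (\<lambda>x. \<bar>f x * indicator (cbox a b) x\<bar>)" using int by simp
      show "AE x in lebesgue. (\<lambda>n. f x * box_bump a b (real (Suc n)) x) \<longlonglongrightarrow> f x * indicator (box a b) x"
        by (intro AE_I2 tendsto_intros box_bump_limit)
      show "(\<lambda>x. f x * box_bump a b (real (Suc n)) x) \<in> borel_measurable lebesgue" for n
        using test_measurable[OF test_box_bump[OF _ ab, of "real (Suc n)"]] by simp
      show "AE x in lebesgue. norm (f x * box_bump a b (real (Suc n)) x) \<le> \<bar>f x * indicator (cbox a b) x\<bar>" for n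
      proof (rule AE_I2)
        fix x
        show "norm (f x * box_bump a b (real (Suc n)) x) \<le> \<bar>f x * indicator (cbox a b) x\<bar>"
          using box_bump_bounds[of a b "real (Suc n)" x] box_bump_nonzero[of "real (Suc n)" a b x] box_subset_cbox[of a b]
          by (cases "x \<in> cbox a b") (auto simp: abs_mult indicator_def intro: mult_left_le)
      qed
      show "(\<lambda>x. f x * indicator (box a b) x) \<in> borel_measurable lebesgue"
        by (intro borel_measurable_times borel_measurable_indicator) (use sq_intD[OF f] in simp_all)
    qed
    moreover have "(LINT x|lebesgue. f x * box_bump a b (real (Suc n)) x) = 0" for n
      by (rule t[OF test_box_bump[OF _ ab]]) simp
    ultimately show ?thesis by (simp add: LIMSEQ_const_iff)
  qed
  have cb: "AE x in lebesgue. x \<in> cbox a b \<longrightarrow> f x = 0" if ab: "cbox a b \<subseteq> U" for a b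
  proof -
    define f' where "f' x = f x * indicator (box a b) x" for x
    have "AE x in lebesgue. f' x = 0"
    proof (rule AE_zero_if_box_integrals_zero)
      have "integrable lebesgue (\<lambda>x. indicator (box a b) x *\<^sub>R (f x * indicator (cbox a b) x))"
        by (rule integrable_mult_indicator[OF _ int]) auto
      moreover have "(\<lambda>x. indicator (box a b) x *\<^sub>R (f x * indicator (cbox a b) x)) = f'"
        using box_subset_cbox[of a b] by (auto simp: f'_def indicator_def fun_eq_iff)
      ultimately show "integrable lebesgue f'" by simp
      show "(LINT x|lebesgue. f' x) = 0" unfolding f'_def by (rule box0[OF ab])
      fix c d :: "real^'n"
      obtain p q where pq: "box a b \<inter> box c d = box p q" "cbox p q \<subseteq> U"
      proof (cases "box a b \<inter> box c d = {}")
        case True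
        have "box 1 (0 :: real^'n) = {}" "cbox 1 (0 :: real^'n) = {}" by (auto simp: interval_eq_empty_cart)
        then show ?thesis using that[of 1 0] True by simp
      next
        case False
        obtain p q where pq: "box a b \<inter> box c d = box p q" by (simp only: box_Int_box)
        have "cbox p q = closure (box p q)" by (rule closure_box[symmetric]) (use False pq in simp)
        also have "\<dots> \<subseteq> closure (box a b)" unfolding pq[symmetric] by (rule closure_mono) blast
        also have "\<dots> \<subseteq> cbox a b" by (simp add: box_subset_cbox closure_minimal closed_cbox)
        finally show ?thesis using that[OF pq] ab by blast
      qed
      have "(LINT x|lebesgue. indicator (box c d) x * f' x) = (LINT x|lebesgue. f x * indicator (box p q) x)"
        unfolding f'_def pq(1)[symmetric] by (rule Bochner_Integration.integral_cong) (auto simp: indicator_def)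
      then show "(LINT x|lebesgue. indicator (box c d) x * f' x) = 0" using box0[OF pq(2)] by simp
    qed
    moreover have "cbox a b - box a b \<in> null_sets lebesgue"
      using negligible_frontier_interval[of a b] by (simp add: negligible_iff_null_sets)
    then have "AE x in lebesgue. x \<notin> cbox a b - box a b" by (rule AE_not_in)
    ultimately show ?thesis
      by eventually_elim (auto simp: f'_def indicator_def split: if_splits)
  qed
  obtain D where D: "countable D" "D \<subseteq> Pow U" "\<And>X. X \<in> D \<Longrightarrow> \<exists>a b. X = cbox a b" "\<Union>D = U"
    using open_countable_Union_open_cbox[OF U] by blast
  have "AE x in lebesgue. \<forall>X\<in>D. x \<in> X \<longrightarrow> f x = 0"
  proof (rule AE_ball_countable'[OF _ D(1)])
    fix X assume X: "X \<in> D"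
    then obtain a b where "X = cbox a b" using D(3) by blast
    then show "AE x in lebesgue. x \<in> X \<longrightarrow> f x = 0" using cb[of a b] X D(2) by blast
  qed
  then show ?thesis by eventually_elim (use D(4) in blast)
qed

lemma subspace_closure:
  fixes S :: "'a::real_normed_vector set"
  assumes "subspace S" shows "subspace (closure S)"
proof (rule subspaceI)
  show "0 \<in> closure S" using subspace_0[OF assms] closure_subset by blast
next
  fix x y assume "x \<in> closure S" "y \<in> closure S"
  then obtain X Y where "\<And>n. X n \<in> S" "X \<longlonglongrightarrow> x" "\<And>n. Y n \<in> S" "Y \<longlonglongrightarrow> y"
    unfolding closure_sequential by blast
  then show "x + y \<in> closure S" unfolding closure_sequential
    by (intro exI[of _ "\<lambda>n. X n + Y n"]) (auto intro: tendsto_add subspace_add[OF assms])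
next
  fix c x assume "x \<in> closure S"
  then obtain X where "\<And>n. X n \<in> S" "X \<longlonglongrightarrow> x" unfolding closure_sequential by blast
  then show "c *\<^sub>R x \<in> closure S" unfolding closure_sequential
    by (intro exI[of _ "\<lambda>n. c *\<^sub>R X n"]) (auto intro: tendsto_scaleR subspace_scale[OF assms])
qed

text \<open>A square-integrable function vanishing off \<open>U\<close> is a limit of test functions: what is orthogonal to all
  test functions vanishes on \<open>U\<close> by the fundamental lemma.\<close>

lemma abs_l2_in_closure_test:
  fixes w :: "real^'n::finite \<Rightarrow> real"
  assumes U: "open U" and w: "w \<in> sq_int" "\<And>x. x \<notin> U \<Longrightarrow> w x = 0"
  shows "abs_l2 w \<in> closure (abs_l2 ` test_functions U)"
proof -
  define S where "S = closure (abs_l2 ` (test_functions U :: (real^'n \<Rightarrow> real) set))"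
  have "subspace (abs_l2 ` (test_functions U :: (real^'n \<Rightarrow> real) set))"
  proof (rule subspaceI)
    show "0 \<in> abs_l2 ` (test_functions U :: (real^'n \<Rightarrow> real) set)"
      unfolding abs_l2_zero by (rule imageI[OF test_zero])
  next
    fix x y assume "x \<in> abs_l2 ` (test_functions U :: (real^'n \<Rightarrow> real) set)" "y \<in> abs_l2 ` (test_functions U :: (real^'n \<Rightarrow> real) set)"
    then obtain p q where pq: "p \<in> test_functions U" "q \<in> test_functions U" "x = abs_l2 p" "y = abs_l2 q" by blast
    have "x + y = abs_l2 (\<lambda>x. p x + q x)" unfolding pq by (rule abs_l2_add[OF test_sq_int test_sq_int]) (rule pq)+
    then show "x + y \<in> abs_l2 ` (test_functions U :: (real^'n \<Rightarrow> real) set)"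
      using test_add[OF pq(1,2)] by blast
  next
    fix c x assume "x \<in> abs_l2 ` (test_functions U :: (real^'n \<Rightarrow> real) set)"
    then obtain p where p: "p \<in> test_functions U" "x = abs_l2 p" by blast
    have "c *\<^sub>R x = abs_l2 (\<lambda>x. c *\<^sub>R p x)" unfolding p by (rule abs_l2_scaleR[OF test_sq_int]) (rule p)
    then show "c *\<^sub>R x \<in> abs_l2 ` (test_functions U :: (real^'n \<Rightarrow> real) set)"
      using test_scale[OF p(1), of c] by simp
  qed
  then have S: "subspace S" "closed S"
    unfolding S_def by (rule subspace_closure) (rule closed_closure)
  define y where "y = proj S (abs_l2 w)"
  have y: "y \<in> S" "\<And>s. s \<in> S \<Longrightarrow> inner (abs_l2 w - y) s = 0"
    using proj[OF S] by (auto simp: y_def inner_diff_left)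
  obtain f where f: "f \<in> sq_int" "abs_l2 w - y = abs_l2 f" using abs_l2_rep by blast
  have tS: "abs_l2 \<phi> \<in> S" if "\<phi> \<in> test_functions U" for \<phi>
    unfolding S_def by (rule subsetD[OF closure_subset imageI[OF that]])
  have onU: "AE x in lebesgue. x \<in> U \<longrightarrow> f x = 0"
  proof (rule fundamental_lemma[OF f(1) U])
    fix \<phi> :: "real^'n \<Rightarrow> real" assume p: "\<phi> \<in> test_functions U"
    have "inner (abs_l2 f) (abs_l2 \<phi>) = 0" using y(2)[OF tS[OF p]] f(2) by simp
    then show "(LINT x|lebesgue. f x * \<phi> x) = 0" by (simp add: inner_abs_l2 f(1) test_sq_int[OF p])
  qed
  define v where "v x = (if x \<in> U then 0 else f x)" for x
  have v: "v \<in> sq_int"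
  proof (rule sq_int_dominated[OF _ f(1), where C = 1])
    have [measurable]: "U \<in> sets lebesgue" "f \<in> borel_measurable lebesgue" using U f(1) by (auto dest: sq_intD)
    show "v \<in> borel_measurable lebesgue" unfolding v_def by measurable
  qed (simp add: v_def)
  have "inner (abs_l2 v) s = 0" if "s \<in> S" for s
  proof -
    have "closed {s. inner (abs_l2 v) s = 0}" by (intro closed_Collect_eq continuous_intros)
    moreover have "abs_l2 ` test_functions U \<subseteq> {s. inner (abs_l2 v) s = 0}"
    proof clarify
      fix \<phi> :: "real^'n \<Rightarrow> real" assume p: "\<phi> \<in> test_functions U"
      obtain K where K: "K \<subseteq> U" "\<And>x. x \<notin> K \<Longrightarrow> \<phi> x = 0" by (rule test_functionE[OF p]) blast
      have "v x * \<phi> x = 0" for x using K unfolding v_def by (cases "x \<in> K") auto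
      then have "(\<lambda>x. v x * \<phi> x) = (\<lambda>x. 0)" by (rule ext)
      then show "inner (abs_l2 v) (abs_l2 \<phi>) = 0" by (simp add: inner_abs_l2 v test_sq_int[OF p])
    qed
    ultimately have "S \<subseteq> {s. inner (abs_l2 v) s = 0}" unfolding S_def by (intro closure_minimal)
    then show ?thesis using that by blast
  qed
  then have "inner (abs_l2 v) y = 0" using y(1) by blast
  moreover have "inner (abs_l2 v) (abs_l2 w) = 0"
  proof -
    have "(\<lambda>x. v x * w x) = (\<lambda>x. 0)" using w(2) by (auto simp: v_def fun_eq_iff)
    then show ?thesis by (simp add: inner_abs_l2 v w(1))
  qed
  ultimately have "inner (abs_l2 v) (abs_l2 f) = 0" by (simp add: f(2)[symmetric] inner_diff_right)
  moreover have "v x * f x = v x * v x" for x by (simp add: v_def)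
  ultimately have "inner (abs_l2 v) (abs_l2 v) = 0" by (simp add: inner_abs_l2 v f(1))
  then have "abs_l2 v = abs_l2 (\<lambda>x. 0)" by (simp add: abs_l2_zero)
  then have "AE x in lebesgue. v x = 0" by (simp add: abs_l2_eq v)
  with onU have "AE x in lebesgue. f x = 0" by eventually_elim (auto simp: v_def split: if_splits)
  then have "abs_l2 f = 0" by (simp add: abs_l2_zero abs_l2_eq f(1))
  then have "abs_l2 w = y" using f(2) by simp
  then show ?thesis using y(1) by (simp add: S_def)
qed

text \<open>The form in which density is used: an \<open>L\<^sup>2\<close> bound follows from testing against smooth functions.\<close>

corollary norm_le_by_testing:
  fixes w :: "real^'n::finite \<Rightarrow> real"
  assumes U: "open U" and w: "w \<in> sq_int" "\<And>x. x \<notin> U \<Longrightarrow> w x = 0"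
    and c: "0 \<le> c" and le: "\<And>\<phi>. \<phi> \<in> test_functions U \<Longrightarrow> (LINT x|lebesgue. w x * \<phi> x) \<le> c * norm (abs_l2 \<phi>)"
  shows "norm (abs_l2 w) \<le> c"
proof (cases "abs_l2 w = 0")
  case True
  then show ?thesis using c by simp
next
  case False
  have "closed {s. inner (abs_l2 w) s \<le> c * norm s}" by (intro closed_Collect_le continuous_intros)
  moreover have "abs_l2 ` test_functions U \<subseteq> {s. inner (abs_l2 w) s \<le> c * norm s}"
    using le by (auto simp: inner_abs_l2 w(1) test_sq_int)
  ultimately have "inner (abs_l2 w) (abs_l2 w) \<le> c * norm (abs_l2 w)"
    using subsetD[OF closure_minimal abs_l2_in_closure_test[OF U w]] by blast
  then have "norm (abs_l2 w) * norm (abs_l2 w) \<le> c * norm (abs_l2 w)"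
    by (simp only: power2_norm_eq_inner[symmetric] power2_eq_square)
  then show ?thesis using False by (auto dest: mult_right_le_imp_le)
qed

section \<open>Weak gradients as a relation between Hilbert spaces\<close>

subsection \<open>Extension by zero\<close>

definition ext :: "'a set \<Rightarrow> ('a \<Rightarrow> 'b::zero) \<Rightarrow> 'a \<Rightarrow> 'b" where
  "ext \<Omega> f x = (if x \<in> \<Omega> then f x else 0)"

definition emb :: "'a set \<Rightarrow> ('a \<Rightarrow> 'b) \<Rightarrow> ('a::euclidean_space, 'b::euclidean_space) l2" where
  "emb \<Omega> f = abs_l2 (ext \<Omega> f)"

lemma open_not_AE_avoided:
  fixes B :: "'a::euclidean_space set"
  assumes B: "open B" "B \<noteq> {}" and ae: "AE x in lebesgue. x \<notin> B" shows False
proof -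
  have "B \<in> null_sets lebesgue" using B(1) ae by (simp add: AE_iff_null_sets)
  then have "negligible B" by (simp add: negligible_iff_null_sets)
  then show False using open_not_negligible[OF B] by blast
qed

lemma open_sets_lebesgue: "open \<Omega> \<Longrightarrow> \<Omega> \<in> sets lebesgue"
  by auto

lemma L2_iff:
  assumes "open \<Omega>" shows "f \<in> L2 \<Omega> \<longleftrightarrow> ext \<Omega> f \<in> sq_int"
proof -
  have "(\<lambda>x. (norm (ext \<Omega> f x))\<^sup>2) = (\<lambda>x. if x \<in> \<Omega> then (norm (f x))\<^sup>2 else 0)"
    by (auto simp: ext_def)
  moreover have "ext \<Omega> f = (\<lambda>x. if x \<in> \<Omega> then f x else 0)" by (auto simp: ext_def)
  ultimately show ?thesis
    using borel_measurable_if[OF open_sets_lebesgue[OF assms], of f]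
      Lebesgue_Measure.integrable_restrict_UNIV[OF open_sets_lebesgue[OF assms], of "\<lambda>x. (norm (f x))\<^sup>2"]
    unfolding L2_def sq_int_def by simp
qed

lemma integral_ext:
  fixes f :: "'a::euclidean_space \<Rightarrow> 'b::euclidean_space"
  assumes "open \<Omega>" shows "(LINT x|lebesgue. ext \<Omega> f x) = (LINT x|lebesgue_on \<Omega>. f x)"
  using Lebesgue_Measure.integral_restrict_UNIV[OF open_sets_lebesgue[OF assms], of f] by (simp add: ext_def)

lemma inner_emb:
  assumes "open \<Omega>" "f \<in> L2 \<Omega>" "g \<in> L2 \<Omega>"
  shows "inner (emb \<Omega> f) (emb \<Omega> g) = (LINT x|lebesgue_on \<Omega>. f x \<bullet> g x)"
proof -
  have "(\<lambda>x. inner (ext \<Omega> f x) (ext \<Omega> g x)) = ext \<Omega> (\<lambda>x. f x \<bullet> g x)" by (auto simp: ext_def)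
  then show ?thesis using assms by (simp add: emb_def inner_abs_l2 L2_iff integral_ext)
qed

lemma emb_eq_iff:
  assumes "open \<Omega>" "f \<in> L2 \<Omega>" "g \<in> L2 \<Omega>"
  shows "emb \<Omega> f = emb \<Omega> g \<longleftrightarrow> ae_eq \<Omega> f g"
proof -
  have "emb \<Omega> f = emb \<Omega> g \<longleftrightarrow> (AE x in lebesgue. ext \<Omega> f x = ext \<Omega> g x)"
    using assms by (simp add: emb_def abs_l2_eq L2_iff)
  also have "\<dots> \<longleftrightarrow> (AE x in lebesgue. x \<in> \<Omega> \<longrightarrow> f x = g x)"
    by (rule arg_cong[where f = "almost_everywhere lebesgue"]) (auto simp: ext_def)
  also have "\<dots> \<longleftrightarrow> ae_eq \<Omega> f g"
    using open_sets_lebesgue[OF assms(1)] by (simp add: ae_eq_def AE_restrict_space_iff)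
  finally show ?thesis .
qed

lemma ext_add: "ext \<Omega> (\<lambda>x. f x + g x) = (\<lambda>x. ext \<Omega> f x + (ext \<Omega> g x :: 'b::monoid_add))"
  and ext_scaleR: "ext \<Omega> (\<lambda>x. c *\<^sub>R h x) = (\<lambda>x. c *\<^sub>R (ext \<Omega> h x :: 'c::real_vector))"
  by (auto simp: ext_def)

lemma L2_add: "open \<Omega> \<Longrightarrow> f \<in> L2 \<Omega> \<Longrightarrow> g \<in> L2 \<Omega> \<Longrightarrow> (\<lambda>x. f x + g x) \<in> L2 \<Omega>"
  by (simp add: L2_iff ext_add sq_int_add)

lemma L2_scaleR: "open \<Omega> \<Longrightarrow> f \<in> L2 \<Omega> \<Longrightarrow> (\<lambda>x. c *\<^sub>R f x) \<in> L2 \<Omega>"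
  by (simp add: L2_iff ext_scaleR sq_int_scaleR)

lemma emb_add: "open \<Omega> \<Longrightarrow> f \<in> L2 \<Omega> \<Longrightarrow> g \<in> L2 \<Omega> \<Longrightarrow> emb \<Omega> (\<lambda>x. f x + g x) = emb \<Omega> f + emb \<Omega> g"
  by (simp add: emb_def L2_iff ext_add abs_l2_add)

lemma emb_scaleR: "open \<Omega> \<Longrightarrow> f \<in> L2 \<Omega> \<Longrightarrow> emb \<Omega> (\<lambda>x. c *\<^sub>R f x) = c *\<^sub>R emb \<Omega> f"
  by (simp add: emb_def L2_iff ext_scaleR abs_l2_scaleR)

lemma ext_sq_int:
  assumes "open \<Omega>" "f \<in> sq_int" shows "ext \<Omega> f \<in> sq_int"
proof (rule sq_int_dominated[OF _ assms(2), where C = 1])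
  have "(\<lambda>x. indicator \<Omega> x *\<^sub>R f x) \<in> borel_measurable lebesgue"
    by (intro borel_measurable_scaleR borel_measurable_indicator open_sets_lebesgue assms sq_intD)
  moreover have "(\<lambda>x. indicator \<Omega> x *\<^sub>R f x) = ext \<Omega> f" by (auto simp: ext_def indicator_def)
  ultimately show "ext \<Omega> f \<in> borel_measurable lebesgue" by simp
qed (simp add: ext_def)

lemma sq_int_imp_L2: "open \<Omega> \<Longrightarrow> f \<in> sq_int \<Longrightarrow> f \<in> L2 \<Omega>"
  by (simp add: L2_iff ext_sq_int)

lemma norm_emb_le:
  assumes "open \<Omega>" "f \<in> sq_int" shows "norm (emb \<Omega> f) \<le> norm (abs_l2 f)"
proof -
  have "(norm (emb \<Omega> f))\<^sup>2 \<le> (norm (abs_l2 f))\<^sup>2"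
    unfolding emb_def norm_abs_l2[OF ext_sq_int[OF assms]] norm_abs_l2[OF assms(2)]
    by (intro integral_mono sq_int_norm2 ext_sq_int assms) (simp add: ext_def)
  then show ?thesis by (rule power2_le_imp_le) simp
qed

text \<open>A limit \<open>w\<close> of functions extended by zero is itself of this kind: cutting \<open>w\<close> off outside \<open>\<Omega>\<close> only decreases its
  distance to them.\<close>

lemma emb_limit:
  fixes u :: "nat \<Rightarrow> real^'n::finite \<Rightarrow> 'b::euclidean_space"
  assumes "open \<Omega>" "\<And>n. u n \<in> L2 \<Omega>" "(\<lambda>n. emb \<Omega> (u n)) \<longlonglongrightarrow> w"
  shows "\<exists>f\<in>L2 \<Omega>. w = emb \<Omega> f"
proof -
  obtain f where f: "f \<in> sq_int" "w = abs_l2 f" using abs_l2_rep by blast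
  have fL: "f \<in> L2 \<Omega>" by (rule sq_int_imp_L2[OF assms(1) f(1)])
  have "norm (emb \<Omega> (u n) - emb \<Omega> f) \<le> norm (emb \<Omega> (u n) - w)" for n
  proof -
    have s: "ext \<Omega> (u n) \<in> sq_int" using assms(2)[of n] L2_iff[OF assms(1)] by blast
    have d: "(\<lambda>x. ext \<Omega> (u n) x - f x) \<in> sq_int" by (rule sq_int_diff[OF s f(1)])
    have "emb \<Omega> (u n) - emb \<Omega> f = abs_l2 (\<lambda>x. ext \<Omega> (u n) x - ext \<Omega> f x)"
      unfolding emb_def by (rule abs_l2_diff[OF s ext_sq_int[OF assms(1) f(1)]])
    also have "(\<lambda>x. ext \<Omega> (u n) x - ext \<Omega> f x) = ext \<Omega> (\<lambda>x. ext \<Omega> (u n) x - f x)"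
      by (auto simp: ext_def)
    finally have "emb \<Omega> (u n) - emb \<Omega> f = emb \<Omega> (\<lambda>x. ext \<Omega> (u n) x - f x)" by (simp add: emb_def)
    moreover have "emb \<Omega> (u n) - w = abs_l2 (\<lambda>x. ext \<Omega> (u n) x - f x)"
      unfolding emb_def f(2) by (rule abs_l2_diff[OF s f(1)])
    ultimately show ?thesis using norm_emb_le[OF assms(1) d] by simp
  qed
  note le = this
  have "(\<lambda>n. norm (emb \<Omega> (u n) - w)) \<longlonglongrightarrow> 0"
    by (rule tendsto_norm_zero[OF LIM_zero[OF assms(3)]])
  then have "(\<lambda>n. emb \<Omega> (u n) - emb \<Omega> f) \<longlonglongrightarrow> 0"
    by (rule Lim_null_comparison[OF always_eventually, rotated]) (use le in blast)
  then have "(\<lambda>n. emb \<Omega> (u n)) \<longlonglongrightarrow> emb \<Omega> f" by (rule LIM_zero_cancel)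
  then have "w = emb \<Omega> f" by (rule LIMSEQ_unique[OF assms(3)])
  then show ?thesis using fL by blast
qed

lemma sq_int_imp_integrable:
  fixes f :: "'a::euclidean_space \<Rightarrow> real"
  assumes "f \<in> sq_int" "bounded K" "\<And>x. x \<notin> K \<Longrightarrow> f x = 0"
  shows "integrable lebesgue f"
proof -
  obtain R where R: "K \<subseteq> ball 0 R" using bounded_subset_ballD[OF assms(2), of 0] by blast
  have "(\<lambda>x. indicator (ball 0 R) x) \<in> (sq_int :: ('a \<Rightarrow> real) set)"
    by (rule sq_int_indicator[OF bounded_ball]) simp
  from sq_int_inner_integrable[OF assms(1) this]
  have "integrable lebesgue (\<lambda>x. f x * indicator (ball 0 R) x)" by simp
  moreover have "f x * indicator (ball 0 R) x = f x" for x
    using assms(3)[of x] R by (cases "x \<in> K") (auto simp: indicator_def)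
  ultimately show ?thesis by simp
qed

subsection \<open>Classical gradients of test functions\<close>

definition gradv :: "(real^'n::finite \<Rightarrow> real) \<Rightarrow> real^'n \<Rightarrow> real^'n" where
  "gradv f x = (\<chi> i. partial_deriv f i x)"

lemma has_derivative_gradv:
  fixes f :: "real^'n::finite \<Rightarrow> real"
  assumes "f differentiable (at x)"
  shows "(f has_derivative (\<lambda>v. gradv f x \<bullet> v)) (at x)"
proof -
  let ?D = "frechet_derivative f (at x)"
  have d: "(f has_derivative ?D) (at x)" using assms by (simp add: frechet_derivative_works)
  then have lin: "linear ?D" by (simp add: has_derivative_linear)
  have "?D v = gradv f x \<bullet> v" for v
  proof -
    have "?D v = ?D (\<Sum>i\<in>UNIV. v $ i *\<^sub>R axis i 1)"
      using basis_expansion[of v] by (simp add: scalar_mult_eq_scaleR)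
    also have "\<dots> = (\<Sum>i\<in>UNIV. v $ i * ?D (axis i 1))"
      using lin by (simp add: linear_sum linear_scale o_def)
    also have "\<dots> = gradv f x \<bullet> v"
      by (simp add: inner_vec_def gradv_def partial_deriv_def mult.commute)
    finally show ?thesis .
  qed
  then have "?D = (\<lambda>v. gradv f x \<bullet> v)" by (rule ext)
  then show ?thesis using d by simp
qed

lemma gradv_bounded:
  assumes "\<phi> \<in> test_functions \<Omega>"
  shows "\<exists>B\<ge>0. \<forall>x. norm (gradv \<phi> x) \<le> B"
proof -
  have "\<forall>i. \<exists>B\<ge>0. \<forall>x. \<bar>partial_deriv \<phi> i x\<bar> \<le> B" using test_bounded[OF test_partial[OF assms]] by blast
  from choice[OF this] obtain B where B: "\<forall>i. B i \<ge> 0 \<and> (\<forall>x. \<bar>partial_deriv \<phi> i x\<bar> \<le> B i)" by blast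
  have "norm (gradv \<phi> x) \<le> (\<Sum>i\<in>UNIV. B i)" for x
    by (rule order.trans[OF norm_le_l1_cart sum_mono]) (use B in \<open>simp add: gradv_def\<close>)
  moreover have "0 \<le> (\<Sum>i\<in>UNIV. B i)" using B by (simp add: sum_nonneg)
  ultimately show ?thesis by blast
qed

lemma gradv_sq_int:
  assumes "\<phi> \<in> test_functions \<Omega>" shows "gradv \<phi> \<in> sq_int"
proof -
  obtain K where K: "compact K" "K \<subseteq> \<Omega>" "\<And>x. x \<notin> K \<Longrightarrow> \<phi> x = 0"
    "\<And>i x. x \<notin> K \<Longrightarrow> partial_deriv \<phi> i x = 0" "\<And>k. C_k k \<phi>"
    by (rule test_functionE[OF assms]) (rule that)
  obtain B where B: "\<And>x. norm (gradv \<phi> x) \<le> B" using gradv_bounded[OF assms] by blast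
  show ?thesis
  proof (rule sq_int_bounded_support[OF _ B])
    show "bounded K" using K(1) by (rule compact_imp_bounded)
    show "gradv \<phi> x = 0" if "x \<notin> K" for x using K(4)[OF that] by (simp add: gradv_def vec_eq_iff)
    have "continuous_on UNIV (\<lambda>x. \<chi> i. partial_deriv \<phi> i x)"
      by (intro continuous_on_vec_lambda test_continuous[OF test_partial[OF assms]])
    then have "continuous_on UNIV (gradv \<phi>)" by (simp add: gradv_def[abs_def])
    then show "gradv \<phi> \<in> borel_measurable lebesgue"
      by (intro measurable_completion) (simp add: borel_measurable_continuous_onI)
  qed
qed

lemma test_differentiable: "\<phi> \<in> test_functions \<Omega> \<Longrightarrow> \<phi> differentiable (at x)"
proof -
  assume "\<phi> \<in> test_functions \<Omega>"
  then have "C_k (Suc 0) \<phi>" unfolding test_functions_def by blast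
  then show ?thesis by (rule C_k_SucD)
qed

lemma test_line_derivative:
  fixes \<phi> :: "real^'n::finite \<Rightarrow> real"
  assumes "\<phi> \<in> test_functions \<Omega>"
  shows "((\<lambda>t. \<phi> (x - t *\<^sub>R h)) has_real_derivative - (gradv \<phi> (x - t *\<^sub>R h) \<bullet> h)) (at t)"
proof -
  have "((\<lambda>t. \<phi> (x - t *\<^sub>R h)) has_derivative (\<lambda>s. gradv \<phi> (x - t *\<^sub>R h) \<bullet> (- (s *\<^sub>R h)))) (at t)"
    by (rule has_derivative_compose[where g = \<phi> and f = "\<lambda>t. x - t *\<^sub>R h"])
       (auto intro!: derivative_eq_intros has_derivative_gradv test_differentiable[OF assms])
  moreover have "(\<lambda>s. gradv \<phi> (x - t *\<^sub>R h) \<bullet> (- (s *\<^sub>R h))) = (*) (- (gradv \<phi> (x - t *\<^sub>R h) \<bullet> h))"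
    by (auto simp: fun_eq_iff)
  ultimately show ?thesis by (simp add: has_field_derivative_def)
qed

text \<open>Differentiation under the integral sign, by dominated convergence of the difference quotients of \<open>\<phi>\<close>: the
  translation acts on the smooth factor.\<close>

lemma deriv_shifted_integral:
  fixes \<phi> u :: "real^'n::finite \<Rightarrow> real"
  assumes u: "integrable lebesgue u" and \<phi>: "\<phi> \<in> test_functions \<Omega>"
  shows "((\<lambda>t. LINT x|lebesgue. u x * \<phi> (x - t *\<^sub>R h)) has_real_derivative
          - (LINT x|lebesgue. u x * (gradv \<phi> (x - t *\<^sub>R h) \<bullet> h))) (at t)"
proof -
  obtain B where B: "B \<ge> 0" "\<And>x. norm (gradv \<phi> x) \<le> B" using gradv_bounded[OF \<phi>] by blast
  obtain C where C: "\<And>x. \<bar>\<phi> x\<bar> \<le> C" using test_bounded[OF \<phi>] by blast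
  have [measurable]: "u \<in> borel_measurable lebesgue" using u by auto
  have cont: "continuous_on UNIV (\<lambda>x. \<phi> (x - s *\<^sub>R h))" for s
    by (rule continuous_on_compose2[OF test_continuous[OF \<phi>]]) (auto intro: continuous_intros)
  have m [measurable]: "(\<lambda>x. \<phi> (x - s *\<^sub>R h)) \<in> borel_measurable lebesgue" for s
    by (intro measurable_completion) (simp add: borel_measurable_continuous_onI cont)
  have int: "integrable lebesgue (\<lambda>x. u x * \<phi> (x - s *\<^sub>R h))" for s
  proof (rule Bochner_Integration.integrable_bound[of _ "\<lambda>x. C * u x"])
    show "AE x in lebesgue. norm (u x * \<phi> (x - s *\<^sub>R h)) \<le> norm (C * u x)"
    proof (rule AE_I2)
      fix x
      have "\<bar>u x\<bar> * \<bar>\<phi> (x - s *\<^sub>R h)\<bar> \<le> \<bar>u x\<bar> * \<bar>C\<bar>"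
        by (rule mult_left_mono) (use C[of "x - s *\<^sub>R h"] in auto)
      then show "norm (u x * \<phi> (x - s *\<^sub>R h)) \<le> norm (C * u x)" by (simp add: abs_mult mult.commute)
    qed
  qed (use u in auto)
  have lip: "\<bar>\<phi> (x - s *\<^sub>R h) - \<phi> (x - t *\<^sub>R h)\<bar> \<le> (B * norm h) * \<bar>s - t\<bar>" for x s
  proof -
    have "norm (\<phi> (x - s *\<^sub>R h) - \<phi> (x - t *\<^sub>R h)) \<le> (B * norm h) * norm (s - t)"
    proof (rule field_differentiable_bound[where S = UNIV])
      show "((\<lambda>t. \<phi> (x - t *\<^sub>R h)) has_real_derivative - (gradv \<phi> (x - z *\<^sub>R h) \<bullet> h)) (at z within UNIV)" for z
        using test_line_derivative[OF \<phi>] by simp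
      show "norm (- (gradv \<phi> (x - z *\<^sub>R h) \<bullet> h)) \<le> B * norm h" for z
        using order.trans[OF Cauchy_Schwarz_ineq2[of "gradv \<phi> (x - z *\<^sub>R h)" h] mult_right_mono[OF B(2) norm_ge_zero]]
        by simp
    qed auto
    then show ?thesis by simp
  qed
  have "((\<lambda>k. ((LINT x|lebesgue. u x * \<phi> (x - (t + k) *\<^sub>R h)) - (LINT x|lebesgue. u x * \<phi> (x - t *\<^sub>R h))) / k)
     \<longlongrightarrow> - (LINT x|lebesgue. u x * (gradv \<phi> (x - t *\<^sub>R h) \<bullet> h))) (at 0)"
    unfolding tendsto_at_iff_sequentially comp_def
  proof (intro allI impI)
    fix k :: "nat \<Rightarrow> real" assume k: "\<forall>i. k i \<in> UNIV - {0}" "k \<longlonglongrightarrow> 0"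
    define s where "s n x = u x * ((\<phi> (x - (t + k n) *\<^sub>R h) - \<phi> (x - t *\<^sub>R h)) / k n)" for n x
    have eq: "((LINT x|lebesgue. u x * \<phi> (x - (t + k n) *\<^sub>R h)) - (LINT x|lebesgue. u x * \<phi> (x - t *\<^sub>R h))) / k n
        = (LINT x|lebesgue. s n x)" for n
      unfolding Bochner_Integration.integral_diff[OF int int, symmetric] integral_divide_zero[symmetric] s_def
      by (rule Bochner_Integration.integral_cong) (simp_all add: field_simps)
    have "(\<lambda>n. LINT x|lebesgue. s n x) \<longlonglongrightarrow> (LINT x|lebesgue. u x * - (gradv \<phi> (x - t *\<^sub>R h) \<bullet> h))"
    proof (rule integral_dominated_convergence[where w = "\<lambda>x. (B * norm h) * \<bar>u x\<bar>"])
      have lim: "(\<lambda>n. s n x) \<longlonglongrightarrow> u x * - (gradv \<phi> (x - t *\<^sub>R h) \<bullet> h)" for x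
      proof -
        have "((\<lambda>j. (\<phi> (x - (t + j) *\<^sub>R h) - \<phi> (x - t *\<^sub>R h)) / j) \<longlongrightarrow> - (gradv \<phi> (x - t *\<^sub>R h) \<bullet> h)) (at 0)"
          using test_line_derivative[OF \<phi>, of x h t] by (simp add: DERIV_def)
        then have "(\<lambda>n. (\<phi> (x - (t + k n) *\<^sub>R h) - \<phi> (x - t *\<^sub>R h)) / k n) \<longlonglongrightarrow> - (gradv \<phi> (x - t *\<^sub>R h) \<bullet> h)"
          unfolding tendsto_at_iff_sequentially comp_def using k by blast
        then show ?thesis unfolding s_def by (intro tendsto_mult tendsto_const)
      qed
      then show "AE x in lebesgue. (\<lambda>n. s n x) \<longlonglongrightarrow> u x * - (gradv \<phi> (x - t *\<^sub>R h) \<bullet> h)" by simp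
      show ms: "s n \<in> borel_measurable lebesgue" for n unfolding s_def by measurable
      show "(\<lambda>x. u x * - (gradv \<phi> (x - t *\<^sub>R h) \<bullet> h)) \<in> borel_measurable lebesgue"
        by (rule borel_measurable_LIMSEQ_metric[OF ms]) (rule lim)
      show "integrable lebesgue (\<lambda>x. (B * norm h) * \<bar>u x\<bar>)" using u by auto
      show "AE x in lebesgue. norm (s n x) \<le> (B * norm h) * \<bar>u x\<bar>" for n
      proof (rule AE_I2)
        fix x
        have "\<bar>(\<phi> (x - (t + k n) *\<^sub>R h) - \<phi> (x - t *\<^sub>R h)) / k n\<bar> \<le> B * norm h"
          using lip[of x "t + k n"] k(1) by (simp add: abs_divide divide_le_eq)
        from mult_left_mono[OF this abs_ge_zero[of "u x"]]
        show "norm (s n x) \<le> (B * norm h) * \<bar>u x\<bar>" by (simp add: s_def abs_mult mult.commute)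
      qed
    qed
    then show "(\<lambda>n. ((LINT x|lebesgue. u x * \<phi> (x - (t + k n) *\<^sub>R h)) - (LINT x|lebesgue. u x * \<phi> (x - t *\<^sub>R h))) / k n)
      \<longlonglongrightarrow> - (LINT x|lebesgue. u x * (gradv \<phi> (x - t *\<^sub>R h) \<bullet> h))"
      unfolding eq by simp
  qed
  then show ?thesis by (simp add: DERIV_def)
qed

lemma distr_lebesgue_shift: "distr lebesgue lebesgue (\<lambda>x. a + x) = (lebesgue :: 'a::euclidean_space measure)"
  and measurable_lebesgue_shift: "(\<lambda>x. a + x) \<in> lebesgue \<rightarrow>\<^sub>M (lebesgue :: 'a::euclidean_space measure)"
proof -
  have eq: "(\<lambda>x. a + (\<Sum>j\<in>Basis. (1 * (x \<bullet> j)) *\<^sub>R j)) = (\<lambda>x. a + x)"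
    by (simp add: euclidean_representation)
  show m: "(\<lambda>x. a + x) \<in> lebesgue \<rightarrow>\<^sub>M (lebesgue :: 'a measure)"
    using lebesgue_affine_measurable[of "\<lambda>_. 1" a] unfolding eq by simp
  show "distr lebesgue lebesgue (\<lambda>x. a + x) = (lebesgue :: 'a measure)"
    using lebesgue_affine_euclidean[of "\<lambda>_. 1" a] unfolding eq by (simp add: density_1)
qed

lemma integral_lebesgue_shift:
  fixes f :: "'a::euclidean_space \<Rightarrow> 'b::euclidean_space"
  assumes "f \<in> borel_measurable lebesgue"
  shows "(LINT x|lebesgue. f (a + x)) = (LINT x|lebesgue. f x)"
  using integral_distr[OF measurable_lebesgue_shift assms, of a] by (simp add: distr_lebesgue_shift)

lemma sq_int_shift:
  assumes "f \<in> sq_int" shows "(\<lambda>x. f (a + x)) \<in> sq_int"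
proof -
  have "(\<lambda>x. f (a + x)) \<in> borel_measurable lebesgue"
    using measurable_compose[OF measurable_lebesgue_shift sq_intD[OF assms]] by simp
  moreover have "integrable (distr lebesgue lebesgue (\<lambda>x. a + x)) (\<lambda>x. (norm (f x))\<^sup>2)"
    using sq_int_norm2[OF assms] by (simp add: distr_lebesgue_shift)
  then have "integrable lebesgue (\<lambda>x. (norm (f (a + x)))\<^sup>2)"
    by (rule integrable_distr[OF measurable_lebesgue_shift])
  ultimately show ?thesis by (simp add: sq_int_def)
qed

lemma norm_abs_l2_shift:
  assumes "f \<in> sq_int" shows "norm (abs_l2 (\<lambda>x. f (a + x))) = norm (abs_l2 f)"
proof (rule power2_eq_imp_eq)
  have [measurable]: "f \<in> borel_measurable lebesgue" using assms by (rule sq_intD)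
  have "(LINT x|lebesgue. (norm (f (a + x)))\<^sup>2) = (LINT x|lebesgue. (norm (f x))\<^sup>2)"
    by (rule integral_lebesgue_shift) measurable
  then show "(norm (abs_l2 (\<lambda>x. f (a + x))))\<^sup>2 = (norm (abs_l2 f))\<^sup>2"
    by (simp add: norm_abs_l2 assms sq_int_shift)
qed auto

text \<open>The integral of a translate does not depend on the translation, so its derivative vanishes.\<close>

lemma integral_gradv_zero:
  fixes \<phi> :: "real^'n::finite \<Rightarrow> real"
  assumes \<phi>: "\<phi> \<in> test_functions \<Omega>"
  shows "(LINT x|lebesgue. gradv \<phi> x \<bullet> h) = 0"
proof -
  obtain K where K: "compact K" "K \<subseteq> \<Omega>" "\<And>x. x \<notin> K \<Longrightarrow> \<phi> x = 0"
    "\<And>i x. x \<notin> K \<Longrightarrow> partial_deriv \<phi> i x = 0" "\<And>k. C_k k \<phi>"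
    by (rule test_functionE[OF \<phi>]) (rule that)
  obtain r where r: "K \<subseteq> ball 0 r" using bounded_subset_ballD[OF compact_imp_bounded[OF K(1)], of 0] by blast
  define u :: "real^'n \<Rightarrow> real" where "u = indicator (ball 0 (r + norm h))"
  have u: "integrable lebesgue u" unfolding u_def
    by (rule integrable_real_indicator) (use emeasure_bounded_finite[OF bounded_ball] in simp_all)
  have cut: "u x * f (x - t *\<^sub>R h) = f (x - t *\<^sub>R h)"
    if t: "\<bar>t\<bar> < 1" and f: "\<And>x. x \<notin> K \<Longrightarrow> f x = 0" for f :: "real^'n \<Rightarrow> real" and t x
  proof (cases "x - t *\<^sub>R h \<in> K")
    case True
    then have "norm (x - t *\<^sub>R h) < r" using r by auto
    moreover have "norm (t *\<^sub>R h) \<le> 1 * norm h" using t mult_right_mono[of "\<bar>t\<bar>" 1 "norm h"] by simp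
    ultimately have "norm x < r + norm h"
      using norm_triangle_ineq[of "x - t *\<^sub>R h" "t *\<^sub>R h"] by simp
    then show ?thesis by (simp add: u_def)
  next
    case False
    then show ?thesis by (simp add: f)
  qed
  have const: "(LINT x|lebesgue. u x * \<phi> (x - t *\<^sub>R h)) = (LINT x|lebesgue. \<phi> x)" if t: "\<bar>t\<bar> < 1" for t
  proof -
    have "u x * \<phi> (x - t *\<^sub>R h) = \<phi> (- (t *\<^sub>R h) + x)" for x
      using cut[where f = \<phi>, OF t K(3), of x] by simp
    then have "(LINT x|lebesgue. u x * \<phi> (x - t *\<^sub>R h)) = (LINT x|lebesgue. \<phi> (- (t *\<^sub>R h) + x))"
      by (simp only:)
    also have "\<dots> = (LINT x|lebesgue. \<phi> x)" by (rule integral_lebesgue_shift[OF test_measurable[OF \<phi>]])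
    finally show ?thesis .
  qed
  have "((\<lambda>t. LINT x|lebesgue. \<phi> x) has_real_derivative 0) (at 0)" by simp
  then have "((\<lambda>t. LINT x|lebesgue. u x * \<phi> (x - t *\<^sub>R h)) has_real_derivative 0) (at 0)"
    by (rule has_field_derivative_transform_within_open[of _ _ _ "{-1<..<1}"]) (use const in auto)
  from DERIV_unique[OF this deriv_shifted_integral[OF u \<phi>]]
  have "(LINT x|lebesgue. u x * (gradv \<phi> (x - 0 *\<^sub>R h) \<bullet> h)) = 0" by simp
  moreover have "gradv \<phi> x \<bullet> h = 0" if "x \<notin> K" for x
  proof -
    have "gradv \<phi> x = 0" using K(4)[OF that] by (simp add: gradv_def vec_eq_iff)
    then show ?thesis by simp
  qed
  from cut[of 0 "\<lambda>x. gradv \<phi> x \<bullet> h", OF _ this]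
  have "(\<lambda>x. u x * (gradv \<phi> (x - 0 *\<^sub>R h) \<bullet> h)) = (\<lambda>x. gradv \<phi> x \<bullet> h)" by (intro ext) simp
  ultimately show ?thesis by (simp only:)
qed

lemma integral_partial_deriv_zero:
  "\<phi> \<in> test_functions \<Omega> \<Longrightarrow> (LINT x|lebesgue. partial_deriv \<phi> i x) = 0"
  using integral_gradv_zero[of \<phi> \<Omega> "axis i 1"] by (simp add: inner_axis gradv_def)

subsection \<open>The weak gradient as a closed linear relation\<close>

text \<open>The defining identities of the weak gradient are continuous linear conditions on the pair \<open>(u, g)\<close>. In this form
  the weak gradient is visibly linear and closed.\<close>

definition weak_rel :: "(real^'n::finite) set \<Rightarrow> (real^'n, real) l2 \<Rightarrow> (real^'n, real^'n) l2 \<Rightarrow> bool" where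
  "weak_rel \<Omega> u g \<longleftrightarrow> (\<forall>\<phi>\<in>test_functions \<Omega>. \<forall>i.
     inner u (abs_l2 (partial_deriv \<phi> i)) = - inner g (abs_l2 (\<lambda>x. \<phi> x *\<^sub>R axis i 1)))"

lemma test_scaleR_sq_int: "\<phi> \<in> test_functions \<Omega> \<Longrightarrow> (\<lambda>x. \<phi> x *\<^sub>R v) \<in> sq_int"
proof -
  assume \<phi>: "\<phi> \<in> test_functions \<Omega>"
  show ?thesis
    by (rule sq_int_dominated[OF _ test_sq_int[OF \<phi>], where C = "norm v"])
       (use test_measurable[OF \<phi>] in \<open>simp_all add: mult.commute\<close>)
qed

lemma weak_gradient_iff:
  assumes "open \<Omega>"
  shows "weak_gradient \<Omega> u g \<longleftrightarrow> u \<in> L2 \<Omega> \<and> g \<in> L2 \<Omega> \<and> weak_rel \<Omega> (emb \<Omega> u) (emb \<Omega> g)"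
proof -
  have "inner (emb \<Omega> u) (abs_l2 (partial_deriv \<phi> i)) = (LINT x|lebesgue_on \<Omega>. u x * partial_deriv \<phi> i x)"
    if "u \<in> L2 \<Omega>" "\<phi> \<in> test_functions \<Omega>" for \<phi> i
  proof -
    have "(\<lambda>x. ext \<Omega> u x * partial_deriv \<phi> i x) = ext \<Omega> (\<lambda>x. u x * partial_deriv \<phi> i x)" by (auto simp: ext_def)
    then show ?thesis
      using that assms by (simp add: emb_def inner_abs_l2 L2_iff test_sq_int[OF test_partial] integral_ext)
  qed
  moreover have "inner (emb \<Omega> g) (abs_l2 (\<lambda>x. \<phi> x *\<^sub>R axis i 1)) = (LINT x|lebesgue_on \<Omega>. g x $ i * \<phi> x)"
    if "g \<in> L2 \<Omega>" "\<phi> \<in> test_functions \<Omega>" for \<phi> i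
  proof -
    have "(\<lambda>x. ext \<Omega> g x \<bullet> (\<phi> x *\<^sub>R axis i 1)) = ext \<Omega> (\<lambda>x. g x $ i * \<phi> x)"
      by (auto simp: ext_def inner_axis)
    then show ?thesis
      using that assms
      by (simp only: emb_def inner_abs_l2 L2_iff test_scaleR_sq_int integral_ext)
  qed
  ultimately show ?thesis unfolding weak_gradient_def weak_rel_def by auto
qed

lemma weak_rel_add: "weak_rel \<Omega> u g \<Longrightarrow> weak_rel \<Omega> u' g' \<Longrightarrow> weak_rel \<Omega> (u + u') (g + g')"
  by (simp add: weak_rel_def inner_add_left)

lemma weak_rel_scaleR: "weak_rel \<Omega> u g \<Longrightarrow> weak_rel \<Omega> (c *\<^sub>R u) (c *\<^sub>R g)"
  by (simp add: weak_rel_def)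

lemma weak_gradient_add:
  "open \<Omega> \<Longrightarrow> weak_gradient \<Omega> u g \<Longrightarrow> weak_gradient \<Omega> v h
    \<Longrightarrow> weak_gradient \<Omega> (\<lambda>x. u x + v x) (\<lambda>x. g x + h x)"
  by (simp add: weak_gradient_iff emb_add L2_add weak_rel_add)

lemma weak_gradient_scale:
  "open \<Omega> \<Longrightarrow> weak_gradient \<Omega> u g \<Longrightarrow> weak_gradient \<Omega> (\<lambda>x. c * u x) (\<lambda>x. c *\<^sub>R g x)"
  using emb_scaleR[of \<Omega> u c] emb_scaleR[of \<Omega> g c] L2_scaleR[of \<Omega> u c] L2_scaleR[of \<Omega> g c]
  by (simp add: weak_gradient_iff weak_rel_scaleR)

lemma weak_gradient_limit:
  fixes u :: "nat \<Rightarrow> real^'n::finite \<Rightarrow> real"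
  assumes \<Omega>: "open \<Omega>" and w: "\<And>n. weak_gradient \<Omega> (u n) (g n)"
    and "(\<lambda>n. emb \<Omega> (u n)) \<longlonglongrightarrow> U" "(\<lambda>n. emb \<Omega> (g n)) \<longlonglongrightarrow> G"
  shows "\<exists>v h. weak_gradient \<Omega> v h \<and> emb \<Omega> v = U \<and> emb \<Omega> h = G"
proof -
  have L: "u n \<in> L2 \<Omega>" "g n \<in> L2 \<Omega>" "weak_rel \<Omega> (emb \<Omega> (u n)) (emb \<Omega> (g n))" for n
    using w[of n] weak_gradient_iff[OF \<Omega>] by blast+
  obtain v where v: "v \<in> L2 \<Omega>" "U = emb \<Omega> v" using emb_limit[OF \<Omega> L(1) assms(3)] by blast
  obtain h where h: "h \<in> L2 \<Omega>" "G = emb \<Omega> h" using emb_limit[OF \<Omega> L(2) assms(4)] by blast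
  have "weak_rel \<Omega> U G" unfolding weak_rel_def
  proof (intro ballI allI)
    fix \<phi> :: "real^'n \<Rightarrow> real" and i assume \<phi>: "\<phi> \<in> test_functions \<Omega>"
    have "(\<lambda>n. inner (emb \<Omega> (u n)) (abs_l2 (partial_deriv \<phi> i))) \<longlonglongrightarrow> inner U (abs_l2 (partial_deriv \<phi> i))"
      by (intro tendsto_intros assms)
    moreover have "(\<lambda>n. - inner (emb \<Omega> (g n)) (abs_l2 (\<lambda>x. \<phi> x *\<^sub>R axis i 1)))
        \<longlonglongrightarrow> - inner G (abs_l2 (\<lambda>x. \<phi> x *\<^sub>R axis i 1))"
      by (intro tendsto_intros assms)
    moreover have "inner (emb \<Omega> (u n)) (abs_l2 (partial_deriv \<phi> i)) = - inner (emb \<Omega> (g n)) (abs_l2 (\<lambda>x. \<phi> x *\<^sub>R axis i 1))" for n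
      using L(3)[of n] \<phi> unfolding weak_rel_def by blast
    ultimately show "inner U (abs_l2 (partial_deriv \<phi> i)) = - inner G (abs_l2 (\<lambda>x. \<phi> x *\<^sub>R axis i 1))"
      using LIMSEQ_unique by fastforce
  qed
  then show ?thesis using v h weak_gradient_iff[OF \<Omega>] by blast
qed

lemma weak_gradient_zero_unique:
  fixes G :: "real^'n::finite \<Rightarrow> real^'n"
  assumes \<Omega>: "open \<Omega>" and G: "G \<in> L2 \<Omega>"
    and z: "\<And>\<phi> i. \<phi> \<in> test_functions \<Omega> \<Longrightarrow> inner (emb \<Omega> G) (abs_l2 (\<lambda>x. \<phi> x *\<^sub>R axis i 1)) = 0"
  shows "emb \<Omega> G = 0"
proof -
  have s: "ext \<Omega> G \<in> sq_int" using G L2_iff[OF \<Omega>] by blast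
  have comp: "AE x in lebesgue. x \<in> \<Omega> \<longrightarrow> ext \<Omega> G x $ i = 0" for i
  proof (rule fundamental_lemma[OF _ \<Omega>])
    have "(\<lambda>x. ext \<Omega> G x \<bullet> axis i 1) \<in> borel_measurable lebesgue"
      by (intro borel_measurable_inner sq_intD[OF s] borel_measurable_const)
    then have m: "(\<lambda>x. ext \<Omega> G x $ i) \<in> borel_measurable lebesgue" by (simp add: inner_axis)
    show "(\<lambda>x. ext \<Omega> G x $ i) \<in> sq_int"
      by (rule sq_int_dominated[OF m s, where C = 1]) (use component_le_norm_cart in auto)
    fix \<phi> :: "real^'n \<Rightarrow> real" assume \<phi>: "\<phi> \<in> test_functions \<Omega>"
    show "(LINT x|lebesgue. ext \<Omega> G x $ i * \<phi> x) = 0"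
      using z[OF \<phi>, of i] by (simp add: emb_def inner_abs_l2[OF s test_scaleR_sq_int[OF \<phi>]] inner_axis mult.commute)
  qed
  have "AE x in lebesgue. \<forall>i. x \<in> \<Omega> \<longrightarrow> ext \<Omega> G x $ i = 0"
    by (subst AE_all_countable) (use comp in blast)
  then have "AE x in lebesgue. ext \<Omega> G x = 0"
    by eventually_elim (auto simp: ext_def vec_eq_iff)
  then show ?thesis by (simp add: emb_def abs_l2_zero abs_l2_eq s)
qed

lemma weak_gradient_unique:
  assumes \<Omega>: "open \<Omega>" and w: "weak_gradient \<Omega> u g" "weak_gradient \<Omega> v h" and uv: "emb \<Omega> u = emb \<Omega> v"
  shows "emb \<Omega> g = emb \<Omega> h"
proof -
  have L: "g \<in> L2 \<Omega>" "h \<in> L2 \<Omega>" "weak_rel \<Omega> (emb \<Omega> u) (emb \<Omega> g)" "weak_rel \<Omega> (emb \<Omega> v) (emb \<Omega> h)"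
    using w weak_gradient_iff[OF \<Omega>] by blast+
  have e: "emb \<Omega> (\<lambda>x. g x + (-1) *\<^sub>R h x) = emb \<Omega> g - emb \<Omega> h"
    unfolding emb_add[OF \<Omega> L(1) L2_scaleR[OF \<Omega> L(2)]] emb_scaleR[OF \<Omega> L(2)] by simp
  have "emb \<Omega> (\<lambda>x. g x + (-1) *\<^sub>R h x) = 0"
  proof (rule weak_gradient_zero_unique[OF \<Omega> L2_add[OF \<Omega> L(1) L2_scaleR[OF \<Omega> L(2)]]])
    fix \<phi> i assume "\<phi> \<in> test_functions \<Omega>"
    then show "inner (emb \<Omega> (\<lambda>x. g x + (-1) *\<^sub>R h x)) (abs_l2 (\<lambda>x. \<phi> x *\<^sub>R axis i 1)) = 0"
      unfolding e inner_diff_left using L(3,4) uv by (simp add: weak_rel_def)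
  qed
  then show ?thesis using e by simp
qed

lemma ext_test: "\<phi> \<in> test_functions \<Omega> \<Longrightarrow> ext \<Omega> \<phi> = \<phi>" and ext_gradv: "\<phi> \<in> test_functions \<Omega> \<Longrightarrow> ext \<Omega> (gradv \<phi>) = gradv \<phi>"
proof -
  assume \<phi>: "\<phi> \<in> test_functions \<Omega>"
  obtain K where K: "compact K" "K \<subseteq> \<Omega>" "\<And>x. x \<notin> K \<Longrightarrow> \<phi> x = 0"
    "\<And>i x. x \<notin> K \<Longrightarrow> partial_deriv \<phi> i x = 0" "\<And>k. C_k k \<phi>"
    by (rule test_functionE[OF \<phi>]) (rule that)
  show "ext \<Omega> \<phi> = \<phi>" using K(2,3) by (auto simp: ext_def fun_eq_iff)
  show "ext \<Omega> (gradv \<phi>) = gradv \<phi>" using K(2,4) by (auto simp: ext_def fun_eq_iff gradv_def vec_eq_iff)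
qed

text \<open>Integration by parts: the partial derivatives of the test function \<open>u \<phi>\<close> have integral zero.\<close>

lemma weak_gradient_test:
  fixes u :: "real^'n::finite \<Rightarrow> real"
  assumes \<Omega>: "open \<Omega>" and u: "u \<in> test_functions \<Omega>"
  shows "weak_gradient \<Omega> u (gradv u)"
proof -
  have "weak_rel \<Omega> (abs_l2 u) (abs_l2 (gradv u))" unfolding weak_rel_def
  proof (intro ballI allI)
    fix \<phi> :: "real^'n \<Rightarrow> real" and i assume \<phi>: "\<phi> \<in> test_functions \<Omega>"
    have m: "(\<lambda>x. u x * \<phi> x) \<in> test_functions \<Omega>"
    proof (rule test_mult[OF \<phi>])
      show "C_k k u" for k using u unfolding test_functions_def by blast
    qed
    have i1: "integrable lebesgue (\<lambda>x. u x * partial_deriv \<phi> i x)"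
      using sq_int_inner_integrable[OF test_sq_int[OF u] test_sq_int[OF test_partial[OF \<phi>]]] by simp
    have i2: "integrable lebesgue (\<lambda>x. partial_deriv u i x * \<phi> x)"
      using sq_int_inner_integrable[OF test_sq_int[OF test_partial[OF u]] test_sq_int[OF \<phi>]] by simp
    have "(LINT x|lebesgue. u x * partial_deriv \<phi> i x + partial_deriv u i x * \<phi> x) = 0"
      using integral_partial_deriv_zero[OF m, of i]
      by (simp add: partial_deriv_mult test_differentiable[OF u] test_differentiable[OF \<phi>])
    then have "(LINT x|lebesgue. u x * partial_deriv \<phi> i x) + (LINT x|lebesgue. partial_deriv u i x * \<phi> x) = 0"
      using i1 i2 by simp
    then show "inner (abs_l2 u) (abs_l2 (partial_deriv \<phi> i)) = - inner (abs_l2 (gradv u)) (abs_l2 (\<lambda>x. \<phi> x *\<^sub>R axis i 1))"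
      by (simp add: inner_abs_l2 test_sq_int[OF u] test_sq_int[OF test_partial[OF \<phi>]] gradv_sq_int[OF u]
          test_scaleR_sq_int[OF \<phi>] inner_axis gradv_def mult.commute)
  qed
  then show ?thesis
    using \<Omega> u by (simp add: weak_gradient_iff emb_def ext_test ext_gradv sq_int_imp_L2 test_sq_int gradv_sq_int)
qed

lemma const_L2:
  assumes "open \<Omega>" "bounded \<Omega>" shows "(\<lambda>x. c) \<in> L2 \<Omega>"
proof -
  have "(\<lambda>x. indicator \<Omega> x *\<^sub>R c) \<in> borel_measurable lebesgue"
    by (intro borel_measurable_scaleR borel_measurable_indicator open_sets_lebesgue assms borel_measurable_const)
  moreover have "(\<lambda>x. indicator \<Omega> x *\<^sub>R c) = ext \<Omega> (\<lambda>x. c)" by (auto simp: ext_def)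
  ultimately have "ext \<Omega> (\<lambda>x. c) \<in> sq_int"
    by (intro sq_int_bounded_support[of _ "norm c" \<Omega>]) (auto simp: ext_def assms)
  then show ?thesis using L2_iff[OF assms(1)] by blast
qed

lemma weak_gradient_const:
  fixes \<Omega> :: "(real^'n::finite) set"
  assumes \<Omega>: "open \<Omega>" "bounded \<Omega>"
  shows "weak_gradient \<Omega> (\<lambda>x. c) (\<lambda>x. 0)"
  unfolding weak_gradient_def
proof (intro conjI ballI allI const_L2 \<Omega>)
  fix \<phi> :: "real^'n \<Rightarrow> real" and i assume \<phi>: "\<phi> \<in> test_functions \<Omega>"
  have "(LINT x|lebesgue_on \<Omega>. c * partial_deriv \<phi> i x) = (LINT x|lebesgue. ext \<Omega> (\<lambda>x. c * partial_deriv \<phi> i x) x)"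
    by (rule integral_ext[OF \<Omega>(1), symmetric])
  also have "ext \<Omega> (\<lambda>x. c * partial_deriv \<phi> i x) = (\<lambda>x. c * partial_deriv \<phi> i x)"
    using ext_test[OF test_partial[OF \<phi>], of i] by (auto simp: ext_def fun_eq_iff split: if_splits)
  also have "(LINT x|lebesgue. c * partial_deriv \<phi> i x) = 0"
    using integral_partial_deriv_zero[OF \<phi>, of i] by simp
  finally show "(LINT x|lebesgue_on \<Omega>. c * partial_deriv \<phi> i x) = - (LINT x|lebesgue_on \<Omega>. 0 $ i * \<phi> x)"
    by simp
qed

section \<open>The Poincare inequality\<close>

subsection \<open>Translations\<close>

lemma abs_l2_sum_scaleR:
  assumes "finite I" "\<And>i. i \<in> I \<Longrightarrow> f i \<in> sq_int"
  shows "(\<lambda>x. \<Sum>i\<in>I. c i *\<^sub>R f i x) \<in> sq_int \<and> abs_l2 (\<lambda>x. \<Sum>i\<in>I. c i *\<^sub>R f i x) = (\<Sum>i\<in>I. c i *\<^sub>R abs_l2 (f i))"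
  using assms
proof (induction I rule: finite_induct)
  case empty
  then show ?case by (simp add: abs_l2_zero)
next
  case (insert j I)
  have IH: "(\<lambda>x. \<Sum>i\<in>I. c i *\<^sub>R f i x) \<in> sq_int"
    "abs_l2 (\<lambda>x. \<Sum>i\<in>I. c i *\<^sub>R f i x) = (\<Sum>i\<in>I. c i *\<^sub>R abs_l2 (f i))"
    using insert by simp_all
  have j: "f j \<in> sq_int" using insert by simp
  have "(\<lambda>x. \<Sum>i\<in>insert j I. c i *\<^sub>R f i x) = (\<lambda>x. c j *\<^sub>R f j x + (\<Sum>i\<in>I. c i *\<^sub>R f i x))"
    using insert(1,2) by simp
  moreover have "(\<Sum>i\<in>insert j I. c i *\<^sub>R abs_l2 (f i)) = c j *\<^sub>R abs_l2 (f j) + (\<Sum>i\<in>I. c i *\<^sub>R abs_l2 (f i))"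
    using insert(1,2) by simp
  ultimately show ?case
    using sq_int_add[OF sq_int_scaleR[OF j] IH(1)] abs_l2_add[OF sq_int_scaleR[OF j] IH(1)] abs_l2_scaleR[OF j] IH(2)
    by simp
qed

lemma weak_gradient_directional:
  assumes \<Omega>: "open \<Omega>" and w: "weak_gradient \<Omega> u g" and \<phi>: "\<phi> \<in> test_functions \<Omega>"
  shows "inner (emb \<Omega> u) (abs_l2 (\<lambda>x. gradv \<phi> x \<bullet> h)) = - inner (emb \<Omega> g) (abs_l2 (\<lambda>x. \<phi> x *\<^sub>R h))"
proof -
  have rel: "inner (emb \<Omega> u) (abs_l2 (partial_deriv \<phi> i)) = - inner (emb \<Omega> g) (abs_l2 (\<lambda>x. \<phi> x *\<^sub>R axis i 1))" for i
    using w weak_gradient_iff[OF \<Omega>] \<phi> unfolding weak_rel_def by blast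
  have "(\<lambda>x. gradv \<phi> x \<bullet> h) = (\<lambda>x. \<Sum>i\<in>UNIV. (h $ i) *\<^sub>R partial_deriv \<phi> i x)"
    by (simp add: inner_vec_def gradv_def mult.commute)
  then have 1: "abs_l2 (\<lambda>x. gradv \<phi> x \<bullet> h) = (\<Sum>i\<in>UNIV. (h $ i) *\<^sub>R abs_l2 (partial_deriv \<phi> i))"
    using abs_l2_sum_scaleR[of UNIV "partial_deriv \<phi>" "\<lambda>i. h $ i"] test_sq_int[OF test_partial[OF \<phi>]] by simp
  have "\<phi> x *\<^sub>R h = (\<Sum>i\<in>UNIV. (h $ i) *\<^sub>R (\<phi> x *\<^sub>R axis i 1))" for x
  proof -
    have "(\<Sum>i\<in>UNIV. (h $ i) *\<^sub>R (\<phi> x *\<^sub>R axis i (1::real))) = \<phi> x *\<^sub>R (\<Sum>i\<in>UNIV. (h $ i) *s axis i 1)"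
      by (simp add: scaleR_sum_right scalar_mult_eq_scaleR mult.commute)
    then show ?thesis by (simp only: basis_expansion)
  qed
  then have e: "(\<lambda>x. \<phi> x *\<^sub>R h) = (\<lambda>x. \<Sum>i\<in>UNIV. (h $ i) *\<^sub>R (\<phi> x *\<^sub>R axis i 1))" by (rule HOL.ext)
  have 2: "abs_l2 (\<lambda>x. \<phi> x *\<^sub>R h) = (\<Sum>i\<in>UNIV. (h $ i) *\<^sub>R abs_l2 (\<lambda>x. \<phi> x *\<^sub>R axis i 1))"
    by (subst e, rule conjunct2[OF abs_l2_sum_scaleR[OF finite test_scaleR_sq_int[OF \<phi>]]])
  show ?thesis unfolding 1 2 inner_sum_right inner_scaleR_right rel by (simp add: sum_negf)
qed

text \<open>For a test function \<open>\<phi>\<close> on \<open>U\<close>, the function \<open>t \<mapsto> \<integral> u(x) \<phi>(x - t h)\<close> has a derivative that the weak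
  gradient controls; duality then bounds the difference \<open>u(x + h) - u(x)\<close> itself.\<close>

lemma translation_estimate:
  fixes \<Omega> U :: "(real^'n::finite) set"
  assumes \<Omega>: "open \<Omega>" "bounded \<Omega>" and w: "weak_gradient \<Omega> u g" and U: "open U"
    and seg: "\<And>x t. x \<in> U \<Longrightarrow> 0 \<le> t \<Longrightarrow> t \<le> 1 \<Longrightarrow> x + t *\<^sub>R h \<in> \<Omega>"
  shows "norm (emb U (\<lambda>x. ext \<Omega> u (h + x) - ext \<Omega> u x)) \<le> norm h * norm (emb \<Omega> g)"
proof -
  let ?u = "ext \<Omega> u"
  have us: "?u \<in> sq_int" using w weak_gradient_iff[OF \<Omega>(1)] L2_iff[OF \<Omega>(1)] by blast
  have ui: "integrable lebesgue ?u"
    by (rule sq_int_imp_integrable[OF us \<Omega>(2)]) (simp add: ext_def)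
  have ds: "(\<lambda>x. ?u (h + x) - ?u x) \<in> sq_int" by (rule sq_int_diff[OF sq_int_shift[OF us] us])
  show ?thesis unfolding emb_def[of U]
  proof (rule norm_le_by_testing[OF U ext_sq_int[OF U ds]])
    show "ext U (\<lambda>x. ?u (h + x) - ?u x) x = 0" if "x \<notin> U" for x using that by (simp add: ext_def)
    show "0 \<le> norm h * norm (emb \<Omega> g)" by simp
    fix \<phi> :: "real^'n \<Rightarrow> real" assume \<phi>: "\<phi> \<in> test_functions U"
    define F where "F t = (LINT x|lebesgue. ?u x * \<phi> (x - t *\<^sub>R h))" for t
    have sh: "(\<lambda>x. \<phi> (x - t *\<^sub>R h)) \<in> test_functions \<Omega>" if "0 \<le> t" "t \<le> 1" for t
      by (rule test_shift[OF \<phi>]) (rule seg[OF _ that])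
    have gs: "gradv (\<lambda>x. \<phi> (x - t *\<^sub>R h)) x = gradv \<phi> (x - t *\<^sub>R h)" for t x
      using partial_deriv_shift[OF test_differentiable[OF \<phi>], where x = x and a = "- (t *\<^sub>R h)"]
      by (simp add: gradv_def)
    have D: "\<bar>LINT x|lebesgue. ?u x * (gradv \<phi> (x - t *\<^sub>R h) \<bullet> h)\<bar> \<le> norm h * norm (emb \<Omega> g) * norm (abs_l2 \<phi>)"
      if t: "0 \<le> t" "t \<le> 1" for t
    proof -
      let ?p = "\<lambda>x. \<phi> (x - t *\<^sub>R h)"
      have s1: "(\<lambda>x. gradv ?p x \<bullet> h) \<in> sq_int"
      proof (rule sq_int_dominated[OF _ gradv_sq_int[OF sh[OF t]], where C = "norm h"])
        show "(\<lambda>x. gradv ?p x \<bullet> h) \<in> borel_measurable lebesgue"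
          by (intro borel_measurable_inner borel_measurable_const sq_intD[OF gradv_sq_int[OF sh[OF t]]])
        show "norm (gradv ?p x \<bullet> h) \<le> norm h * norm (gradv ?p x)" for x
          using Cauchy_Schwarz_ineq2[of "gradv ?p x" h] by (simp add: mult.commute)
      qed
      have "inner (emb \<Omega> u) (abs_l2 (\<lambda>x. gradv ?p x \<bullet> h)) = (LINT x|lebesgue. ?u x * (gradv ?p x \<bullet> h))"
        unfolding emb_def inner_abs_l2[OF us s1] by simp
      then have "(LINT x|lebesgue. ?u x * (gradv \<phi> (x - t *\<^sub>R h) \<bullet> h)) = inner (emb \<Omega> u) (abs_l2 (\<lambda>x. gradv ?p x \<bullet> h))"
        by (simp only: gs)
      also have "\<dots> = - inner (emb \<Omega> g) (abs_l2 (\<lambda>x. ?p x *\<^sub>R h))"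
        by (rule weak_gradient_directional[OF \<Omega>(1) w sh[OF t]])
      finally have "\<bar>LINT x|lebesgue. ?u x * (gradv \<phi> (x - t *\<^sub>R h) \<bullet> h)\<bar> \<le> norm (emb \<Omega> g) * norm (abs_l2 (\<lambda>x. ?p x *\<^sub>R h))"
        using Cauchy_Schwarz_ineq2[of "emb \<Omega> g" "abs_l2 (\<lambda>x. ?p x *\<^sub>R h)"] by simp
      also have "norm (abs_l2 (\<lambda>x. ?p x *\<^sub>R h)) = norm h * norm (abs_l2 \<phi>)"
      proof (rule power2_eq_imp_eq)
        have "(norm (abs_l2 (\<lambda>x. ?p x *\<^sub>R h)))\<^sup>2 = (LINT x|lebesgue. (norm h)\<^sup>2 * (norm (?p x))\<^sup>2)"
          unfolding norm_abs_l2[OF test_scaleR_sq_int[OF sh[OF t]]] by (simp add: power_mult_distrib mult.commute)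
        also have "\<dots> = (norm h)\<^sup>2 * (norm (abs_l2 ?p))\<^sup>2"
          unfolding norm_abs_l2[OF test_sq_int[OF sh[OF t]]] by (rule integral_mult_right_zero)
        also have "norm (abs_l2 ?p) = norm (abs_l2 \<phi>)"
          using norm_abs_l2_shift[OF test_sq_int[OF \<phi>], of "- (t *\<^sub>R h)"] by simp
        finally show "(norm (abs_l2 (\<lambda>x. ?p x *\<^sub>R h)))\<^sup>2 = (norm h * norm (abs_l2 \<phi>))\<^sup>2"
          by (simp add: power_mult_distrib)
      qed auto
      finally show ?thesis by (simp add: mult_ac)
    qed
    have "norm (F 1 - F 0) \<le> (norm h * norm (emb \<Omega> g) * norm (abs_l2 \<phi>)) * norm (1 - 0 :: real)"
    proof (rule field_differentiable_bound[where S = "{0..1}"])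
      show "(F has_real_derivative - (LINT x|lebesgue. ?u x * (gradv \<phi> (x - t *\<^sub>R h) \<bullet> h))) (at t within {0..1})" for t
        unfolding F_def by (rule has_field_derivative_at_within[OF deriv_shifted_integral[OF ui \<phi>]])
      show "norm (- (LINT x|lebesgue. ?u x * (gradv \<phi> (x - t *\<^sub>R h) \<bullet> h))) \<le> norm h * norm (emb \<Omega> g) * norm (abs_l2 \<phi>)"
        if "t \<in> {0..1}" for t using D[of t] that by simp
    qed auto
    moreover have "(LINT x|lebesgue. ext U (\<lambda>x. ?u (h + x) - ?u x) x * \<phi> x) = F 1 - F 0"
    proof -
      have e: "ext U (\<lambda>x. ?u (h + x) - ?u x) x * \<phi> x = ?u (h + x) * \<phi> x - ?u x * \<phi> x" for x
        using fun_cong[OF ext_test[OF \<phi>], of x] by (auto simp: ext_def left_diff_distrib split: if_splits)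
      have i1: "integrable lebesgue (\<lambda>x. ?u (h + x) * \<phi> x)"
        using sq_int_inner_integrable[OF sq_int_shift[OF us] test_sq_int[OF \<phi>]] by simp
      have i2: "integrable lebesgue (\<lambda>x. ?u x * \<phi> x)"
        using sq_int_inner_integrable[OF us test_sq_int[OF \<phi>]] by simp
      have m: "(\<lambda>x. ?u x * \<phi> (x - h)) \<in> borel_measurable lebesgue"
        using test_measurable[OF sh[of 1]] by (intro borel_measurable_times sq_intD[OF us]) simp
      have "(LINT x|lebesgue. ?u (h + x) * \<phi> x) = (LINT x|lebesgue. ?u x * \<phi> (x - h))"
        using integral_lebesgue_shift[OF m, of h] by simp
      then show ?thesis unfolding e Bochner_Integration.integral_diff[OF i1 i2] by (simp add: F_def)
    qed
    ultimately show "(LINT x|lebesgue. ext U (\<lambda>x. ?u (h + x) - ?u x) x * \<phi> x)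
        \<le> norm h * norm (emb \<Omega> g) * norm (abs_l2 \<phi>)" by simp
  qed
qed

subsection \<open>The inequality on a ball\<close>

lemma nn_integral_lborel_shift:
  assumes [measurable]: "f \<in> borel_measurable borel"
  shows "(\<integral>\<^sup>+y. f y \<partial>lborel) = (\<integral>\<^sup>+h. f (x + h) \<partial>(lborel :: 'a::euclidean_space measure))"
proof -
  have "(\<integral>\<^sup>+y. f y \<partial>lborel) = (\<integral>\<^sup>+y. f y \<partial>distr lborel borel ((+) x))"
    by (simp add: lborel_distr_plus)
  also have "\<dots> = (\<integral>\<^sup>+h. f (x + h) \<partial>lborel)"
    by (subst nn_integral_distr) auto
  finally show ?thesis .
qed

lemma norm_abs_l2_nn_integral:
  assumes "f \<in> sq_int"
  shows "(\<integral>\<^sup>+x. ennreal ((norm (f x))\<^sup>2) \<partial>lebesgue) = ennreal ((norm (abs_l2 f))\<^sup>2)"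
  unfolding norm_abs_l2[OF assms] by (rule nn_integral_eq_integral[OF sq_int_norm2[OF assms]]) simp

text \<open>Expand the square; the mixed term vanishes because \<open>v\<close> has mean zero.\<close>

lemma variance_lower_bound:
  fixes v :: "'a::euclidean_space \<Rightarrow> real"
  assumes v: "v \<in> sq_int" "\<And>y. y \<notin> B \<Longrightarrow> v y = 0" and B: "B \<in> sets lborel" "bounded B"
    and mean: "(LINT y|lebesgue. v y) = 0"
  shows "ennreal (measure lborel B * c\<^sup>2) \<le> (\<integral>\<^sup>+y. indicator B y * ennreal ((c - v y)\<^sup>2) \<partial>lebesgue)"
proof -
  have Bi: "integrable lebesgue (indicator B :: 'a \<Rightarrow> real)"
    by (rule integrable_real_indicator) (use B emeasure_bounded_finite[OF B(2)] in simp_all)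
  have vi: "integrable lebesgue v" by (rule sq_int_imp_integrable[OF v(1) B(2) v(2)])
  have v2: "integrable lebesgue (\<lambda>y. (v y)\<^sup>2)" using sq_int_norm2[OF v(1)] by simp
  have e: "indicator B y * (c - v y)\<^sup>2 = c\<^sup>2 * indicator B y - 2 * c * v y + (v y)\<^sup>2" for y
    using v(2)[of y] by (cases "y \<in> B") (auto simp: power2_eq_square algebra_simps)
  have i: "integrable lebesgue (\<lambda>y. indicator B y * (c - v y)\<^sup>2)"
    unfolding e using Bi vi v2 by (intro Bochner_Integration.integrable_add Bochner_Integration.integrable_diff integrable_mult_right) auto
  have "(LINT y|lebesgue. indicator B y * (c - v y)\<^sup>2) = c\<^sup>2 * measure lborel B + (LINT y|lebesgue. (v y)\<^sup>2)"
    unfolding e using Bi vi v2 mean B(1) by simp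
  moreover have "0 \<le> (LINT y|lebesgue. (v y)\<^sup>2)" by simp
  ultimately have "ennreal (measure lborel B * c\<^sup>2) \<le> ennreal (LINT y|lebesgue. indicator B y * (c - v y)\<^sup>2)"
    by (intro ennreal_leI) (simp add: mult.commute)
  also have "\<dots> = (\<integral>\<^sup>+y. ennreal (indicator B y * (c - v y)\<^sup>2) \<partial>lebesgue)"
    by (rule nn_integral_eq_integral[OF i, symmetric]) simp
  also have "\<dots> = (\<integral>\<^sup>+y. indicator B y * ennreal ((c - v y)\<^sup>2) \<partial>lebesgue)"
    by (rule nn_integral_cong) (simp split: split_indicator)
  finally show ?thesis .
qed

text \<open>Integrating the translation estimate over all \<open>h\<close> bounds the double integral of \<open>(u(x) - u(y))\<^sup>2\<close>.\<close>

lemma poincare_ball: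
  fixes \<Omega> :: "(real^'n::finite) set"
  assumes \<Omega>: "open \<Omega>" "bounded \<Omega>" and r: "r > 0" and B\<Omega>: "ball x0 r \<subseteq> \<Omega>"
    and w: "weak_gradient \<Omega> u g" and mean: "(LINT x|lebesgue_on (ball x0 r). u x) = 0"
  shows "measure lborel (ball x0 r) * (norm (emb (ball x0 r) u))\<^sup>2
      \<le> (2 * r)\<^sup>2 * (norm (emb \<Omega> g))\<^sup>2 * measure lborel (ball (0::real^'n) (2 * r))"
proof -
  define B where "B = ball x0 r"
  have B: "open B" "bounded B" "B \<subseteq> \<Omega>" "convex B" using B\<Omega> by (auto simp: B_def)
  have [measurable]: "B \<in> sets borel" by (simp add: B_def)
  define G where "G = norm (emb \<Omega> g)"
  let ?u = "ext \<Omega> u"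
  have us: "?u \<in> sq_int" using w weak_gradient_iff[OF \<Omega>(1)] L2_iff[OF \<Omega>(1)] by blast
  have eB: "ext B ?u = ext B u" using B(3) by (auto simp: ext_def fun_eq_iff)
  have Bs: "ext B u \<in> sq_int" using ext_sq_int[OF B(1) us] eB by simp
  obtain v0 where v0: "v0 \<in> borel_measurable lborel" "AE x in lborel. ext B u x = v0 x"
    using completion_ex_borel_measurable_real[OF sq_intD[OF Bs]] by blast
  define v where "v x = indicator B x * v0 x" for x
  have v [measurable]: "v \<in> borel_measurable borel" unfolding v_def using v0(1) by simp
  have vB: "v x = 0" if "x \<notin> B" for x using that by (simp add: v_def)
  have ae: "AE x in lebesgue. ext B u x = v x"
  proof -
    have "AE x in lebesgue. ext B u x = v0 x" using v0(2) by (rule AE_completion)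
    then show ?thesis by eventually_elim (auto simp: v_def ext_def indicator_def)
  qed
  have vm: "v \<in> borel_measurable lebesgue" using v by (intro measurable_completion) simp
  have vs: "v \<in> sq_int"
  proof -
    have "integrable lebesgue (\<lambda>x. (norm (v x))\<^sup>2)"
    proof (rule integrable_cong_AE_imp[OF sq_int_norm2[OF Bs]])
      show "(\<lambda>x. (norm (v x))\<^sup>2) \<in> borel_measurable lebesgue" using vm by simp
      show "AE x in lebesgue. (norm (ext B u x))\<^sup>2 = (norm (v x))\<^sup>2" using ae by eventually_elim simp
    qed
    then show ?thesis using vm by (simp add: sq_int_def)
  qed
  have vn: "norm (abs_l2 v) = norm (emb B u)"
    using abs_l2_eq[OF Bs vs] ae by (simp add: emb_def)
  have vmean: "(LINT y|lebesgue. v y) = 0"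
  proof -
    have "(LINT y|lebesgue. v y) = (LINT y|lebesgue. ext B u y)"
    proof (rule integral_cong_AE[OF vm sq_intD[OF Bs]])
      show "AE y in lebesgue. v y = ext B u y" using ae by eventually_elim simp
    qed
    then show ?thesis using mean integral_ext[OF B(1), of u] by (simp add: B_def)
  qed
  define J where "J = (\<integral>\<^sup>+x. \<integral>\<^sup>+y. indicator B x * (indicator B y * ennreal ((v x - v y)\<^sup>2)) \<partial>lborel \<partial>lborel)"
  have lower: "ennreal (measure lborel B * (norm (emb B u))\<^sup>2) \<le> J"
  proof -
    have "ennreal (measure lborel B * (norm (emb B u))\<^sup>2) = ennreal (measure lborel B) * (\<integral>\<^sup>+x. ennreal ((norm (v x))\<^sup>2) \<partial>lebesgue)"
      unfolding norm_abs_l2_nn_integral[OF vs] vn by (simp add: ennreal_mult)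
    also have "\<dots> = (\<integral>\<^sup>+x. ennreal (measure lborel B) * ennreal ((norm (v x))\<^sup>2) \<partial>lborel)"
      by (simp add: nn_integral_completion nn_integral_cmult)
    also have "\<dots> \<le> J" unfolding J_def
    proof (rule nn_integral_mono)
      fix x
      show "ennreal (measure lborel B) * ennreal ((norm (v x))\<^sup>2)
          \<le> (\<integral>\<^sup>+y. indicator B x * (indicator B y * ennreal ((v x - v y)\<^sup>2)) \<partial>lborel)"
      proof (cases "x \<in> B")
        case True
        have "ennreal (measure lborel B * (v x)\<^sup>2) \<le> (\<integral>\<^sup>+y. indicator B y * ennreal ((v x - v y)\<^sup>2) \<partial>lebesgue)"
          by (rule variance_lower_bound[OF vs vB _ B(2) vmean]) simp_all
        then show ?thesis using True by (simp add: nn_integral_completion ennreal_mult)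
      qed (simp add: vB)
    qed
    finally show ?thesis .
  qed
  have upper: "J \<le> ennreal ((2 * r)\<^sup>2 * G\<^sup>2 * measure lborel (ball (0::real^'n) (2 * r)))"
  proof -
    have "J = (\<integral>\<^sup>+x. \<integral>\<^sup>+h. indicator B x * (indicator B (x + h) * ennreal ((v x - v (x + h))\<^sup>2)) \<partial>lborel \<partial>lborel)"
      unfolding J_def by (intro nn_integral_cong nn_integral_lborel_shift) measurable
    also have "\<dots> = (\<integral>\<^sup>+h. \<integral>\<^sup>+x. indicator B x * (indicator B (x + h) * ennreal ((v x - v (x + h))\<^sup>2)) \<partial>lborel \<partial>lborel)"
      by (rule lborel_pair.Fubini') measurable
    also have "\<dots> \<le> (\<integral>\<^sup>+h. ennreal ((2 * r)\<^sup>2 * G\<^sup>2) * indicator (ball (0::real^'n) (2 * r)) h \<partial>lborel)"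
    proof (rule nn_integral_mono)
      fix h :: "real^'n"
      define U where "U = B \<inter> {x. x + h \<in> B}"
      have "open ((\<lambda>x. x + h) -` B)" by (rule open_vimage[OF B(1)]) (intro continuous_intros)
      then have U: "open U" unfolding U_def vimage_def using B(1) by blast
      have lt: "norm h < 2 * r" if "x \<in> U" for x
      proof -
        have "dist x0 x < r" "dist x0 (x + h) < r" using that by (auto simp: U_def B_def)
        then have "dist x (x + h) < 2 * r" using dist_triangle[of x "x + h" x0] by (simp add: dist_commute)
        then show ?thesis by (simp add: dist_norm)
      qed
      have seg: "x + t *\<^sub>R h \<in> \<Omega>" if "x \<in> U" "0 \<le> t" "t \<le> 1" for x t
      proof -
        have "(1 - t) *\<^sub>R x + t *\<^sub>R (x + h) \<in> B"
          by (rule convexD[OF B(4)]) (use that in \<open>auto simp: U_def\<close>)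
        then show ?thesis using B(3) by (auto simp: algebra_simps)
      qed
      have ds: "(\<lambda>x. ?u (h + x) - ?u x) \<in> sq_int" by (rule sq_int_diff[OF sq_int_shift[OF us] us])
      have aeh: "AE x in lebesgue. ext B u (h + x) = v (h + x)"
      proof -
        have "AE x in distr lebesgue lebesgue (\<lambda>x. h + x). ext B u x = v x"
          unfolding distr_lebesgue_shift by (rule ae)
        then show ?thesis by (rule AE_distrD[OF measurable_lebesgue_shift])
      qed
      have "(\<integral>\<^sup>+x. indicator B x * (indicator B (x + h) * ennreal ((v x - v (x + h))\<^sup>2)) \<partial>lborel)
          = (\<integral>\<^sup>+x. indicator B x * (indicator B (x + h) * ennreal ((v x - v (x + h))\<^sup>2)) \<partial>lebesgue)"
        by (rule nn_integral_completion[symmetric])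
      also have "\<dots> = (\<integral>\<^sup>+x. ennreal ((norm (ext U (\<lambda>x. ?u (h + x) - ?u x) x))\<^sup>2) \<partial>lebesgue)"
      proof (rule nn_integral_cong_AE)
        show "AE x in lebesgue. indicator B x * (indicator B (x + h) * ennreal ((v x - v (x + h))\<^sup>2))
            = ennreal ((norm (ext U (\<lambda>x. ?u (h + x) - ?u x) x))\<^sup>2)"
          using ae aeh
        proof eventually_elim
          case (elim x)
          show ?case
          proof (cases "x \<in> U")
            case True
            then have "x \<in> B" "h + x \<in> B" by (auto simp: U_def add.commute)
            then show ?thesis using True elim B(3) by (auto simp: ext_def add.commute power2_commute)
          next
            case False
            then show ?thesis by (auto simp: U_def ext_def indicator_def)
          qed
        qed
      qed
      also have "\<dots> = ennreal ((norm (emb U (\<lambda>x. ?u (h + x) - ?u x)))\<^sup>2)"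
        unfolding emb_def[of U] by (rule norm_abs_l2_nn_integral[OF ext_sq_int[OF U ds]])
      also have "\<dots> \<le> ennreal ((2 * r)\<^sup>2 * G\<^sup>2) * indicator (ball (0::real^'n) (2 * r)) h"
      proof (cases "norm h < 2 * r")
        case True
        have "norm (emb U (\<lambda>x. ?u (h + x) - ?u x)) \<le> norm h * G"
          unfolding G_def by (rule translation_estimate[OF \<Omega> w U seg])
        also have "\<dots> \<le> 2 * r * G" using True by (intro mult_right_mono) (auto simp: G_def)
        finally have "(norm (emb U (\<lambda>x. ?u (h + x) - ?u x)))\<^sup>2 \<le> (2 * r * G)\<^sup>2" by (rule power_mono) simp
        then show ?thesis using True by (simp add: power_mult_distrib ennreal_leI)
      next
        case False
        then have "U = {}" using lt by blast
        then have "ext U (\<lambda>x. ?u (h + x) - ?u x) = (\<lambda>x. 0)" by (auto simp: ext_def)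
        then have "emb U (\<lambda>x. ?u (h + x) - ?u x) = 0" by (simp add: emb_def abs_l2_zero)
        then show ?thesis by simp
      qed
      finally show "(\<integral>\<^sup>+x. indicator B x * (indicator B (x + h) * ennreal ((v x - v (x + h))\<^sup>2)) \<partial>lborel)
          \<le> ennreal ((2 * r)\<^sup>2 * G\<^sup>2) * indicator (ball (0::real^'n) (2 * r)) h" .
    qed
    also have "\<dots> = ennreal ((2 * r)\<^sup>2 * G\<^sup>2) * emeasure lborel (ball (0::real^'n) (2 * r))"
      by (rule nn_integral_cmult_indicator) simp
    also have "emeasure lborel (ball (0::real^'n) (2 * r)) = ennreal (measure lborel (ball (0::real^'n) (2 * r)))"
      by (rule emeasure_eq_ennreal_measure) (use emeasure_bounded_finite[OF bounded_ball, of "0::real^'n" "2 * r"] in auto)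
    finally show ?thesis by (simp add: ennreal_mult)
  qed
  have "ennreal (measure lborel B * (norm (emb B u))\<^sup>2) \<le> ennreal ((2 * r)\<^sup>2 * G\<^sup>2 * measure lborel (ball (0::real^'n) (2 * r)))"
    using lower upper by (rule order.trans)
  then show ?thesis by (simp add: ennreal_le_iff B_def G_def)
qed

subsection \<open>Propagation along translations\<close>

text \<open>This is the Poincare inequality on \<open>U\<close>, except that the gradient counts over all of \<open>\<Omega>\<close> and that the mean is
  taken over a fixed reference set \<open>B\<close>; in this form it can be passed from one set to another.\<close>

definition controlled :: "(real^'n::finite) set \<Rightarrow> (real^'n) set \<Rightarrow> (real^'n) set \<Rightarrow> bool" where
  "controlled \<Omega> B U \<longleftrightarrow> (\<exists>C\<ge>0. \<forall>u g. weak_gradient \<Omega> u g \<longrightarrow> (LINT x|lebesgue_on B. u x) = 0 \<longrightarrow>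
     norm (emb U u) \<le> C * norm (emb \<Omega> g))"

lemma weak_gradient_ext_sq_int:
  assumes \<Omega>: "open \<Omega>" and U: "open U" "U \<subseteq> \<Omega>" and w: "weak_gradient \<Omega> u g"
  shows "ext U u \<in> sq_int"
proof -
  have "ext U (ext \<Omega> u) = ext U u" using U(2) by (auto simp: ext_def fun_eq_iff)
  moreover have "ext \<Omega> u \<in> sq_int" using w weak_gradient_iff[OF \<Omega>] L2_iff[OF \<Omega>] by blast
  ultimately show ?thesis using ext_sq_int[OF U(1), of "ext \<Omega> u"] by simp
qed

lemma controlled_Un:
  assumes \<Omega>: "open \<Omega>" and c: "controlled \<Omega> B U" "controlled \<Omega> B W"
    and U: "open U" "U \<subseteq> \<Omega>" "open W" "W \<subseteq> \<Omega>"
  shows "controlled \<Omega> B (U \<union> W)"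
proof -
  obtain C where C: "C \<ge> 0" "\<And>u g. weak_gradient \<Omega> u g \<Longrightarrow> (LINT x|lebesgue_on B. u x) = 0 \<Longrightarrow>
     norm (emb U u) \<le> C * norm (emb \<Omega> g)" using c(1) unfolding controlled_def by blast
  obtain D where D: "D \<ge> 0" "\<And>u g. weak_gradient \<Omega> u g \<Longrightarrow> (LINT x|lebesgue_on B. u x) = 0 \<Longrightarrow>
     norm (emb W u) \<le> D * norm (emb \<Omega> g)" using c(2) unfolding controlled_def by blast
  have "norm (emb (U \<union> W) u) \<le> (C + D) * norm (emb \<Omega> g)"
    if w: "weak_gradient \<Omega> u g" "(LINT x|lebesgue_on B. u x) = 0" for u g
  proof -
    have s: "ext U u \<in> sq_int" "ext W u \<in> sq_int" "ext (U \<union> W) u \<in> sq_int"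
      by (rule weak_gradient_ext_sq_int[OF \<Omega> _ _ w(1)]; use U in auto)+
    have "(norm (emb (U \<union> W) u))\<^sup>2 \<le> (LINT x|lebesgue. (norm (ext U u x))\<^sup>2 + (norm (ext W u x))\<^sup>2)"
      unfolding emb_def norm_abs_l2[OF s(3)]
      by (rule integral_mono[OF sq_int_norm2[OF s(3)] Bochner_Integration.integrable_add[OF sq_int_norm2[OF s(1)] sq_int_norm2[OF s(2)]]])
         (auto simp: ext_def)
    also have "\<dots> = (norm (emb U u))\<^sup>2 + (norm (emb W u))\<^sup>2"
      unfolding emb_def norm_abs_l2[OF s(1)] norm_abs_l2[OF s(2)]
      by (rule Bochner_Integration.integral_add[OF sq_int_norm2[OF s(1)] sq_int_norm2[OF s(2)]])
    also have "\<dots> \<le> (norm (emb U u) + norm (emb W u))\<^sup>2" by (simp add: power2_sum)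
    finally have "norm (emb (U \<union> W) u) \<le> norm (emb U u) + norm (emb W u)" by (rule power2_le_imp_le) simp
    then show ?thesis using C(2)[OF w] D(2)[OF w] by (simp add: distrib_right)
  qed
  then show ?thesis unfolding controlled_def using C(1) D(1) by (intro exI[of _ "C + D"]) auto
qed

lemma controlled_empty: "controlled \<Omega> B {}"
proof -
  have "emb {} u = (0 :: (real^'a, real) l2)" for u
    unfolding emb_def ext_def by (simp add: abs_l2_zero)
  then show ?thesis unfolding controlled_def by (intro exI[of _ 0]) simp
qed

text \<open>Write \<open>u(x) = u(x + h) - (u(x + h) - u(x))\<close>: the first term is controlled because \<open>W + h\<close> lies in \<open>U\<close>, the second
  by the translation estimate. Applied to small balls this reaches every interior point along chains of balls, and
  applied with an upward shift it reaches the boundary.\<close>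

lemma controlled_translate:
  fixes \<Omega> :: "(real^'n::finite) set"
  assumes \<Omega>: "open \<Omega>" "bounded \<Omega>" and c: "controlled \<Omega> B U" and U: "open U" "U \<subseteq> \<Omega>"
    and W: "open W" "\<And>x. x \<in> W \<Longrightarrow> h + x \<in> U"
    and seg: "\<And>x t. x \<in> W \<Longrightarrow> 0 \<le> t \<Longrightarrow> t \<le> 1 \<Longrightarrow> x + t *\<^sub>R h \<in> \<Omega>"
  shows "controlled \<Omega> B W"
proof -
  obtain C where C: "C \<ge> 0" "\<And>u g. weak_gradient \<Omega> u g \<Longrightarrow> (LINT x|lebesgue_on B. u x) = 0 \<Longrightarrow>
     norm (emb U u) \<le> C * norm (emb \<Omega> g)" using c unfolding controlled_def by blast
  have "norm (emb W u) \<le> (C + norm h) * norm (emb \<Omega> g)"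
    if w: "weak_gradient \<Omega> u g" "(LINT x|lebesgue_on B. u x) = 0" for u g
  proof -
    let ?u = "ext \<Omega> u" and ?s = "\<lambda>x. ext U u (h + x)"
    have us: "?u \<in> sq_int" "ext U u \<in> sq_int"
      by (rule weak_gradient_ext_sq_int[OF \<Omega>(1) _ _ w(1)]; use U \<Omega> in auto)+
    have ds: "(\<lambda>x. ?u (h + x) - ?u x) \<in> sq_int" by (rule sq_int_diff[OF sq_int_shift[OF us(1)] us(1)])
    have ss: "?s \<in> sq_int" by (rule sq_int_shift[OF us(2)])
    have "ext W u = (\<lambda>x. ext W ?s x - ext W (\<lambda>x. ?u (h + x) - ?u x) x)"
    proof
      fix x
      show "ext W u x = ext W ?s x - ext W (\<lambda>x. ?u (h + x) - ?u x) x"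
        using W(2)[of x] U(2) seg[of x 0] by (cases "x \<in> W") (auto simp: ext_def)
    qed
    then have "emb W u = emb W ?s - emb W (\<lambda>x. ?u (h + x) - ?u x)"
      unfolding emb_def abs_l2_diff[OF ext_sq_int[OF W(1) ss] ext_sq_int[OF W(1) ds]] by simp
    then have "norm (emb W u) \<le> norm (emb W ?s) + norm (emb W (\<lambda>x. ?u (h + x) - ?u x))"
      by (simp only: norm_triangle_ineq4)
    also have "norm (emb W ?s) \<le> norm (abs_l2 ?s)" by (rule norm_emb_le[OF W(1) ss])
    also have "norm (abs_l2 ?s) = norm (emb U u)" unfolding emb_def by (rule norm_abs_l2_shift[OF us(2)])
    also have "\<dots> \<le> C * norm (emb \<Omega> g)" by (rule C(2)[OF w])
    also have "norm (emb W (\<lambda>x. ?u (h + x) - ?u x)) \<le> norm h * norm (emb \<Omega> g)"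
      by (rule translation_estimate[OF \<Omega> w(1) W(1) seg])
    finally show ?thesis by (simp add: distrib_right)
  qed
  then show ?thesis unfolding controlled_def using C(1) by (intro exI[of _ "C + norm h"]) auto
qed

lemma controlled_reference_ball:
  fixes \<Omega> :: "(real^'n::finite) set"
  assumes \<Omega>: "open \<Omega>" "bounded \<Omega>" and r: "r > 0" and B: "ball x0 r \<subseteq> \<Omega>"
  shows "controlled \<Omega> (ball x0 r) (ball x0 r)"
proof -
  define m where "m = measure lborel (ball x0 r)"
  have m: "m > 0"
  proof -
    have "emeasure lborel (ball x0 r) \<noteq> 0"
      using r open_not_negligible[of "ball x0 r"]
      by (simp add: negligible_iff_emeasure0 emeasure_completion)
    moreover have "emeasure lborel (ball x0 r) \<noteq> \<infinity>" using emeasure_bounded_finite[OF bounded_ball] by (simp add: less_top)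
    ultimately show ?thesis unfolding m_def measure_def by (simp add: enn2real_positive_iff less_top zero_less_iff_neq_zero)
  qed
  define k where "k = (2 * r)\<^sup>2 * measure lborel (ball (0::real^'n) (2 * r)) / m"
  have k: "k \<ge> 0" using m by (simp add: k_def)
  have "norm (emb (ball x0 r) u) \<le> sqrt k * norm (emb \<Omega> g)"
    if w: "weak_gradient \<Omega> u g" "(LINT x|lebesgue_on (ball x0 r). u x) = 0" for u g
  proof (rule power2_le_imp_le)
    have "m * (norm (emb (ball x0 r) u))\<^sup>2 \<le> m * (k * (norm (emb \<Omega> g))\<^sup>2)"
      using poincare_ball[OF \<Omega> r B w] m by (simp add: m_def k_def mult_ac)
    then have "(norm (emb (ball x0 r) u))\<^sup>2 \<le> k * (norm (emb \<Omega> g))\<^sup>2" using m by simp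
    then show "(norm (emb (ball x0 r) u))\<^sup>2 \<le> (sqrt k * norm (emb \<Omega> g))\<^sup>2" using k by (simp add: power_mult_distrib)
  qed (use k in simp)
  then show ?thesis unfolding controlled_def using k by (intro exI[of _ "sqrt k"]) auto
qed

text \<open>Having a controlled neighbourhood is passed on between any two nearby points by a translation, hence to all points
  of a connected set.\<close>

lemma controlled_interior:
  fixes \<Omega> :: "(real^'n::finite) set"
  assumes \<Omega>: "open \<Omega>" "bounded \<Omega>" "connected \<Omega>" and r: "r > 0" and B: "ball x0 r \<subseteq> \<Omega>" and x: "x \<in> \<Omega>"
  shows "\<exists>\<rho>>0. ball x \<rho> \<subseteq> \<Omega> \<and> controlled \<Omega> (ball x0 r) (ball x \<rho>)"
proof (rule connected_induction_simple[OF \<Omega>(3), where a = x0 and b = x])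
  show "x0 \<in> \<Omega>" using B r by auto
  show "x \<in> \<Omega>" by fact
  show "\<exists>\<rho>>0. ball x0 \<rho> \<subseteq> \<Omega> \<and> controlled \<Omega> (ball x0 r) (ball x0 \<rho>)"
    by (intro exI[of _ r] conjI r B controlled_reference_ball[OF \<Omega>(1,2) r B])
  fix a assume "a \<in> \<Omega>"
  then obtain e where e: "e > 0" "ball a e \<subseteq> \<Omega>" by (rule openE[OF \<Omega>(1)])
  have "\<exists>\<rho>>0. ball z \<rho> \<subseteq> \<Omega> \<and> controlled \<Omega> (ball x0 r) (ball z \<rho>)"
    if yz: "y \<in> ball a (e/2)" "z \<in> ball a (e/2)" and y: "\<exists>\<rho>>0. ball y \<rho> \<subseteq> \<Omega> \<and> controlled \<Omega> (ball x0 r) (ball y \<rho>)" for y z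
  proof -
    obtain \<rho> where \<rho>: "\<rho> > 0" "ball y \<rho> \<subseteq> \<Omega>" "controlled \<Omega> (ball x0 r) (ball y \<rho>)" using y by blast
    define s where "s = min \<rho> (e/2)"
    have s: "s > 0" "s \<le> e/2" "s \<le> \<rho>" using \<rho> e by (auto simp: s_def)
    have seg: "p + t *\<^sub>R (y - z) \<in> \<Omega>" if p: "p \<in> ball z s" and t: "0 \<le> t" "t \<le> 1" for p t
    proof -
      have "(1 - t) *\<^sub>R z + t *\<^sub>R y \<in> ball a (e/2)"
        by (rule convexD[OF convex_ball yz(2,1)]) (use t in simp_all)
      then have "norm (a - ((1 - t) *\<^sub>R z + t *\<^sub>R y)) < e/2" by (simp add: dist_norm)
      moreover have "norm (z - p) < e/2" using p s(2) by (simp add: dist_norm)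
      moreover have eq: "a - (p + t *\<^sub>R (y - z)) = (a - ((1 - t) *\<^sub>R z + t *\<^sub>R y)) + (z - p)"
        by (simp add: algebra_simps)
      ultimately have "norm (a - (p + t *\<^sub>R (y - z))) < e"
        unfolding eq using norm_triangle_ineq[of "a - ((1 - t) *\<^sub>R z + t *\<^sub>R y)" "z - p"] by linarith
      then show ?thesis using e(2) by (auto simp: dist_norm)
    qed
    have "controlled \<Omega> (ball x0 r) (ball z s)"
    proof (rule controlled_translate[OF \<Omega>(1,2) \<rho>(3) open_ball \<rho>(2) open_ball _ seg])
      fix p assume "p \<in> ball z s"
      then have "dist z p < \<rho>" using s(3) by simp
      moreover have "dist y (y - z + p) = dist z p" by (simp add: dist_norm)
      ultimately show "y - z + p \<in> ball y \<rho>" by simp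
    qed
    moreover have "ball z s \<subseteq> \<Omega>"
    proof
      fix p assume "p \<in> ball z s"
      from seg[OF this, of 0] show "p \<in> \<Omega>" by simp
    qed
    ultimately show ?thesis using s(1) by blast
  qed
  moreover have "openin (top_of_set \<Omega>) (ball a (e/2))"
  proof (rule open_openin_trans[OF \<Omega>(1)])
    show "ball a (e/2) \<subseteq> \<Omega>" using e(1) subset_ball[of "e/2" e a] e(2) by auto
  qed simp
  moreover have "a \<in> ball a (e/2)" using e by simp
  ultimately show "\<exists>T. openin (top_of_set \<Omega>) T \<and> a \<in> T \<and> (\<forall>y\<in>T. \<forall>z\<in>T.
      (\<exists>\<rho>>0. ball y \<rho> \<subseteq> \<Omega> \<and> controlled \<Omega> (ball x0 r) (ball y \<rho>)) \<longrightarrow>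
      (\<exists>\<rho>>0. ball z \<rho> \<subseteq> \<Omega> \<and> controlled \<Omega> (ball x0 r) (ball z \<rho>)))"
    by (intro exI[of _ "ball a (e/2)"] conjI ballI impI)
qed

lemma controlled_compact:
  fixes \<Omega> :: "(real^'n::finite) set"
  assumes \<Omega>: "open \<Omega>" and K: "compact K"
    and loc: "\<And>p. p \<in> K \<Longrightarrow> \<exists>\<rho>>0. controlled \<Omega> B (\<Omega> \<inter> ball p \<rho>)"
  shows "\<exists>W. open W \<and> K \<subseteq> W \<and> controlled \<Omega> B (\<Omega> \<inter> W)"
proof -
  have "\<forall>p\<in>K. \<exists>\<rho>. \<rho> > 0 \<and> controlled \<Omega> B (\<Omega> \<inter> ball p \<rho>)" using loc by blast
  from bchoice[OF this] obtain \<rho> where \<rho>: "\<And>p. p \<in> K \<Longrightarrow> \<rho> p > 0 \<and> controlled \<Omega> B (\<Omega> \<inter> ball p (\<rho> p))" by blast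
  have "K \<subseteq> (\<Union>p\<in>K. ball p (\<rho> p))" using \<rho> by force
  then obtain F where F: "F \<subseteq> K" "finite F" "K \<subseteq> (\<Union>p\<in>F. ball p (\<rho> p))"
    using compactE_image[OF K, of K "\<lambda>p. ball p (\<rho> p)"] by blast
  have "controlled \<Omega> B (\<Omega> \<inter> (\<Union>p\<in>F. ball p (\<rho> p)))" using F(2,1)
  proof (induction F rule: finite_induct)
    case empty
    then show ?case by (simp add: controlled_empty)
  next
    case (insert p F)
    have "controlled \<Omega> B (\<Omega> \<inter> ball p (\<rho> p) \<union> \<Omega> \<inter> (\<Union>p\<in>F. ball p (\<rho> p)))"
      by (rule controlled_Un[OF \<Omega>]) (use insert \<rho> \<Omega> in auto)
    then show ?case by (simp add: Int_Un_distrib)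
  qed
  then show ?thesis using F(3) by (intro exI[of _ "\<Union>p\<in>F. ball p (\<rho> p)"]) auto
qed

text \<open>Near a boundary point, moving up by a fixed amount leads into a compact subset of the domain.\<close>

lemma controlled_boundary:
  fixes \<Omega> :: "(real^2) set"
  assumes \<Omega>: "open \<Omega>" "bounded \<Omega>" and lip: "lipschitz_boundary \<Omega>" and p: "p \<in> frontier \<Omega>"
    and int: "\<And>x. x \<in> \<Omega> \<Longrightarrow> \<exists>\<rho>>0. ball x \<rho> \<subseteq> \<Omega> \<and> controlled \<Omega> B (ball x \<rho>)"
  shows "\<exists>\<rho>>0. controlled \<Omega> B (\<Omega> \<inter> ball p \<rho>)"
proof -
  obtain r R \<gamma> C where r: "r > 0" and R: "orthogonal_transformation (R :: real^2 \<Rightarrow> real^2)"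
    and \<gamma>: "C-lipschitz_on UNIV (\<gamma> :: real \<Rightarrow> real)"
    and graph: "\<Omega> \<inter> ball p r = {x \<in> ball p r. R x $ 2 > \<gamma> (R x $ 1)}"
    using lip p unfolding lipschitz_boundary_def by blast
  have linR: "linear R" by (rule orthogonal_transformation_linear[OF R])
  obtain e where e: "R e = axis 2 1" using surjD[OF orthogonal_transformation_surj[OF R], of "axis 2 1"] by auto
  have ne: "norm e = 1" using orthogonal_transformation_norm[OF R, of e] e by (simp add: norm_axis_1)
  define \<tau> where "\<tau> = r / 3"
  have \<tau>: "\<tau> > 0" "\<tau> + \<tau> < r" using r by (auto simp: \<tau>_def)
  define h where "h = \<tau> *\<^sub>R e"
  have nh: "norm h = \<tau>" using ne \<tau> by (simp add: h_def)
  have Rh: "R (x + t *\<^sub>R h) $ 1 = R x $ 1" "R (x + t *\<^sub>R h) $ 2 = R x $ 2 + t * \<tau>" for x t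
    using e by (simp_all add: h_def linear_add[OF linR] linear_scale[OF linR] axis_def)
  define K where "K = {y \<in> cball p (\<tau> + \<tau>). \<gamma> (R y $ 1) + \<tau> \<le> R y $ 2}"
  have "continuous_on UNIV R" using linR linear_continuous_on linear_conv_bounded_linear by blast
  moreover have "continuous_on UNIV \<gamma>" using \<gamma> by (rule lipschitz_on_continuous_on)
  ultimately have cont: "continuous_on UNIV (\<lambda>y. \<gamma> (R y $ 1) + \<tau>)" "continuous_on UNIV (\<lambda>y. R y $ 2)"
    by (auto intro!: continuous_intros continuous_on_compose2[of UNIV \<gamma>])
  have "K = cball p (\<tau> + \<tau>) \<inter> {y. \<gamma> (R y $ 1) + \<tau> \<le> R y $ 2}" by (auto simp: K_def)
  then have K: "compact K" using compact_Int_closed[OF compact_cball closed_Collect_le[OF cont]] by simp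
  have K\<Omega>: "K \<subseteq> \<Omega>"
  proof
    fix y assume "y \<in> K"
    then have "y \<in> ball p r" "\<gamma> (R y $ 1) < R y $ 2" using \<tau> by (auto simp: K_def)
    then show "y \<in> \<Omega>" using graph by blast
  qed
  have "\<exists>\<rho>>0. controlled \<Omega> B (\<Omega> \<inter> ball x \<rho>)" if "x \<in> K" for x
  proof -
    have "x \<in> \<Omega>" using that K\<Omega> by blast
    then obtain \<rho> where "\<rho> > 0" "ball x \<rho> \<subseteq> \<Omega>" "controlled \<Omega> B (ball x \<rho>)" using int by blast
    moreover then have "\<Omega> \<inter> ball x \<rho> = ball x \<rho>" by blast
    ultimately show ?thesis by auto
  qed
  then obtain W where W: "open W" "K \<subseteq> W" "controlled \<Omega> B (\<Omega> \<inter> W)"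
    using controlled_compact[OF \<Omega>(1) K] by blast
  have "controlled \<Omega> B (\<Omega> \<inter> ball p \<tau>)"
  proof (rule controlled_translate[OF \<Omega> W(3)])
    show "open (\<Omega> \<inter> W)" "\<Omega> \<inter> W \<subseteq> \<Omega>" "open (\<Omega> \<inter> ball p \<tau>)" using \<Omega>(1) W(1) by auto
    have near: "dist p (x + t *\<^sub>R h) \<le> \<tau> + \<tau>" if "x \<in> \<Omega> \<inter> ball p \<tau>" "0 \<le> t" "t \<le> 1" for x t
    proof -
      have "norm (t *\<^sub>R h) \<le> \<tau>" using that nh \<tau> mult_right_mono[of t 1 \<tau>] by simp
      moreover have "dist p (x + t *\<^sub>R h) \<le> dist p x + norm (t *\<^sub>R h)"
        using dist_triangle[of p "x + t *\<^sub>R h" x] by (simp add: dist_norm)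
      ultimately show ?thesis using that by auto
    qed
    have above: "\<gamma> (R (x + t *\<^sub>R h) $ 1) + t * \<tau> \<le> R (x + t *\<^sub>R h) $ 2" "\<gamma> (R (x + t *\<^sub>R h) $ 1) < R (x + t *\<^sub>R h) $ 2"
      if "x \<in> \<Omega> \<inter> ball p \<tau>" "0 \<le> t" "t \<le> 1" for x t
    proof -
      have "x \<in> \<Omega> \<inter> ball p r" using that \<tau> by auto
      then have "\<gamma> (R x $ 1) < R x $ 2" using graph by blast
      moreover have "0 \<le> t * \<tau>" using that \<tau> by simp
      ultimately show "\<gamma> (R (x + t *\<^sub>R h) $ 1) + t * \<tau> \<le> R (x + t *\<^sub>R h) $ 2"
        "\<gamma> (R (x + t *\<^sub>R h) $ 1) < R (x + t *\<^sub>R h) $ 2" unfolding Rh by linarith+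
    qed
    show "x + t *\<^sub>R h \<in> \<Omega>" if "x \<in> \<Omega> \<inter> ball p \<tau>" "0 \<le> t" "t \<le> 1" for x t
    proof -
      have "x + t *\<^sub>R h \<in> ball p r" using near[OF that] \<tau> by simp
      then show ?thesis using above(2)[OF that] graph by blast
    qed
    show "h + x \<in> \<Omega> \<inter> W" if "x \<in> \<Omega> \<inter> ball p \<tau>" for x
    proof -
      have "x + 1 *\<^sub>R h \<in> K" using near[OF that, of 1] above(1)[OF that, of 1] by (simp add: K_def)
      then show ?thesis using K\<Omega> W(2) by (auto simp: add.commute)
    qed
  qed
  then show ?thesis using \<tau>(1) by blast
qed

text \<open>Controlled neighbourhoods exist around all points of the compact set \<open>closure \<Omega>\<close>; finitely many of them suffice.\<close>

lemma poincare_inequality: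
  fixes \<Omega> :: "(real^2) set"
  assumes dom: "domain_set \<Omega>" and bdd: "bounded \<Omega>" and lip: "lipschitz_boundary \<Omega>"
  shows "\<exists>x0 r. r > 0 \<and> ball x0 r \<subseteq> \<Omega> \<and> controlled \<Omega> (ball x0 r) \<Omega>"
proof -
  have \<Omega>: "open \<Omega>" "bounded \<Omega>" "connected \<Omega>" and ne: "\<Omega> \<noteq> {}" using dom bdd by (auto simp: domain_set_def)
  obtain x0 where "x0 \<in> \<Omega>" using ne by blast
  then obtain r where r: "r > 0" "ball x0 r \<subseteq> \<Omega>" by (rule openE[OF \<Omega>(1)])
  note int = controlled_interior[OF \<Omega> r]
  have "\<exists>\<rho>>0. controlled \<Omega> (ball x0 r) (\<Omega> \<inter> ball p \<rho>)" if "p \<in> closure \<Omega>" for p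
  proof (cases "p \<in> \<Omega>")
    case True
    then obtain \<rho> where "\<rho> > 0" "ball p \<rho> \<subseteq> \<Omega>" "controlled \<Omega> (ball x0 r) (ball p \<rho>)" using int by blast
    moreover then have "\<Omega> \<inter> ball p \<rho> = ball p \<rho>" by blast
    ultimately show ?thesis by auto
  next
    case False
    then have "p \<in> frontier \<Omega>" using that \<Omega>(1) by (simp add: frontier_def interior_open)
    then show ?thesis by (rule controlled_boundary[OF \<Omega>(1,2) lip _ int])
  qed
  then obtain W where W: "closure \<Omega> \<subseteq> W" "controlled \<Omega> (ball x0 r) (\<Omega> \<inter> W)"
    using controlled_compact[OF \<Omega>(1) compact_closure[THEN iffD2, OF bdd]] by blast
  then have "\<Omega> \<inter> W = \<Omega>" using closure_subset by blast
  then show ?thesis using r W(2) by auto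
qed

section \<open>The spectrum of a symmetric operator on a complexified Hilbert space\<close>

text \<open>The complexification of a real Hilbert space is represented by pairs (real part, imaginary part), with the
  norm of the product space. There \<open>cmul c\<close> is multiplication by \<open>c\<close>, and \<open>cres z T\<close> is \<open>z - T\<close>.\<close>

definition cres :: "complex \<Rightarrow> ('h \<Rightarrow> 'h) \<Rightarrow> 'h \<times> 'h \<Rightarrow> 'h \<times> ('h::real_vector)" where
  "cres z T w = (Re z *\<^sub>R fst w - T (fst w) - Im z *\<^sub>R snd w, Re z *\<^sub>R snd w - T (snd w) + Im z *\<^sub>R fst w)"

definition cmul :: "complex \<Rightarrow> 'h \<times> 'h \<Rightarrow> 'h \<times> ('h::real_vector)" where
  "cmul c w = (Re c *\<^sub>R fst w - Im c *\<^sub>R snd w, Re c *\<^sub>R snd w + Im c *\<^sub>R fst w)"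

lemma cres_cmul:
  assumes "bounded_linear T" shows "cres z T (cmul c w) = cmul c (cres z T w)"
proof -
  interpret T: bounded_linear T by fact
  show ?thesis by (simp add: cres_def cmul_def T.diff T.add T.scaleR algebra_simps)
qed

lemma bounded_linear_cres:
  assumes "bounded_linear T" shows "bounded_linear (cres z T)"
proof -
  have T: "bounded_linear (\<lambda>w. T (fst w))" "bounded_linear (\<lambda>w. T (snd w))"
    by (rule bounded_linear_compose[OF assms bounded_linear_fst], rule bounded_linear_compose[OF assms bounded_linear_snd])
  have F: "bounded_linear (\<lambda>w::'a \<times> 'a. r *\<^sub>R fst w)" "bounded_linear (\<lambda>w::'a \<times> 'a. r *\<^sub>R snd w)" for r
    by (rule bounded_linear_compose[OF bounded_linear_scaleR_right bounded_linear_fst],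
        rule bounded_linear_compose[OF bounded_linear_scaleR_right bounded_linear_snd])
  show ?thesis unfolding cres_def[abs_def]
    by (rule bounded_linear_Pair[OF bounded_linear_sub[OF bounded_linear_sub[OF F(1) T(1)] F(2)]
          bounded_linear_add[OF bounded_linear_sub[OF F(2) T(2)] F(1)]])
qed

lemma cres_in:
  assumes "subspace S" "\<And>p. p \<in> S \<Longrightarrow> T p \<in> S" "w \<in> S \<times> S"
  shows "cres z T w \<in> S \<times> S"
proof -
  obtain p q where pq: "w = (p, q)" "p \<in> S" "q \<in> S" using assms(3) by blast
  have "Re z *\<^sub>R p - T p - Im z *\<^sub>R q \<in> S" "Re z *\<^sub>R q - T q + Im z *\<^sub>R p \<in> S"
    by (intro subspace_diff[OF assms(1)] subspace_add[OF assms(1)] subspace_scale[OF assms(1)] assms(2) pq)+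
  then show ?thesis by (simp add: cres_def pq(1))
qed

lemma cres_adjoint:
  assumes sym: "\<And>p q. p \<in> S \<Longrightarrow> q \<in> S \<Longrightarrow> inner (T p) q = inner p (T q)"
    and "w \<in> S \<times> S" "w' \<in> S \<times> S"
  shows "inner (cres z T w) w' = inner w (cres (cnj z) T w')"
proof -
  obtain p q where pq: "w = (p, q)" "p \<in> S" "q \<in> S" using assms(2) by blast
  obtain p' q' where pq': "w' = (p', q')" "p' \<in> S" "q' \<in> S" using assms(3) by blast
  show ?thesis unfolding pq(1) pq'(1) cres_def
    by (simp add: inner_diff_left inner_diff_right inner_add_left inner_add_right
        sym[OF pq(2) pq'(2)] sym[OF pq(3) pq'(3)])
qed

text \<open>The cross terms cancel by symmetry: \<open>\<parallel>(z - T) w\<parallel>\<^sup>2 = \<parallel>(Re z - T) w\<parallel>\<^sup>2 + (Im z)\<^sup>2 \<parallel>w\<parallel>\<^sup>2\<close>.\<close>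

lemma cres_lower_bound:
  assumes sym: "\<And>p q. p \<in> S \<Longrightarrow> q \<in> S \<Longrightarrow> inner (T p) q = inner p (T q)"
    and d: "d \<ge> 0" "\<And>p. p \<in> S \<Longrightarrow> d * norm p \<le> norm (Re z *\<^sub>R p - T p)"
    and w: "w \<in> S \<times> S"
  shows "(d\<^sup>2 + (Im z)\<^sup>2) * (norm w)\<^sup>2 \<le> (norm (cres z T w))\<^sup>2"
proof -
  obtain p q where pq: "w = (p, q)" "p \<in> S" "q \<in> S" using w by auto
  define X where "X = Re z *\<^sub>R p - T p"
  define Y where "Y = Re z *\<^sub>R q - T q"
  have XY: "inner X q = inner Y p"
    by (simp only: X_def Y_def inner_diff_left inner_scaleR_left sym[OF pq(2,3)]
        inner_commute[of q p] inner_commute[of "T q" p])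
  have "(norm (cres z T w))\<^sup>2 = (norm (X - Im z *\<^sub>R q))\<^sup>2 + (norm (Y - (- Im z) *\<^sub>R p))\<^sup>2"
    by (simp add: pq cres_def norm_Pair X_def Y_def)
  also have "\<dots> = (norm X)\<^sup>2 + (norm Y)\<^sup>2 + (Im z)\<^sup>2 * ((norm p)\<^sup>2 + (norm q)\<^sup>2)"
    unfolding norm_diff_scaleR_squared XY by (simp add: algebra_simps)
  finally have e: "(norm (cres z T w))\<^sup>2 = (norm X)\<^sup>2 + (norm Y)\<^sup>2 + (Im z)\<^sup>2 * (norm w)\<^sup>2"
    by (simp add: pq norm_Pair)
  have "(d * norm p)\<^sup>2 \<le> (norm X)\<^sup>2" "(d * norm q)\<^sup>2 \<le> (norm Y)\<^sup>2"
    unfolding X_def Y_def using d pq by (intro power_mono; simp)+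
  then have "d\<^sup>2 * (norm w)\<^sup>2 \<le> (norm X)\<^sup>2 + (norm Y)\<^sup>2"
    by (simp add: pq norm_Pair power_mult_distrib distrib_left)
  then show ?thesis unfolding e by (simp add: distrib_right)
qed

lemma real_resolvent_lower_bound:
  fixes T :: "'h::real_inner \<Rightarrow> 'h"
  assumes bd: "\<And>p. p \<in> S \<Longrightarrow> m * (norm p)\<^sup>2 \<le> inner (T p) p" "\<And>p. p \<in> S \<Longrightarrow> inner (T p) p \<le> M * (norm p)\<^sup>2"
    and a: "a < m \<or> M < a"
  shows "\<exists>d>0. \<forall>p\<in>S. d * norm p \<le> norm (a *\<^sub>R p - T p)"
proof -
  define d where "d = (if a < m then m - a else a - M)"
  have d: "d > 0" using a by (auto simp: d_def)
  have "d * norm p \<le> norm (a *\<^sub>R p - T p)" if p: "p \<in> S" for p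
  proof (cases "p = 0")
    case False
    have "d * (norm p)\<^sup>2 \<le> \<bar>inner (a *\<^sub>R p - T p) p\<bar>"
      using bd[OF p] a unfolding d_def inner_diff_left inner_scaleR_left power2_norm_eq_inner[symmetric]
      by (auto simp: algebra_simps abs_if)
    also have "\<dots> \<le> norm (a *\<^sub>R p - T p) * norm p" by (rule Cauchy_Schwarz_ineq2)
    finally have "(d * norm p) * norm p \<le> norm (a *\<^sub>R p - T p) * norm p" by (simp add: power2_eq_square mult.assoc)
    then show ?thesis using False by (auto dest: mult_right_le_imp_le)
  qed simp
  then show ?thesis using d by blast
qed

lemma closed_Times_subspace: "subspace S \<Longrightarrow> closed S \<Longrightarrow> subspace (S \<times> S) \<and> closed (S \<times> S)"
  by (auto simp: closed_Times subspace_def zero_prod_def)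

text \<open>Off the interval \<open>{m..M}\<close> either \<open>Re z - T\<close> is bounded below or \<open>Im z \<noteq> 0\<close>; in both cases \<open>z - T\<close> and its adjoint,
  which is the operator of the conjugate, are bounded below.\<close>

proposition cres_bijective_off_numerical_range:
  fixes T :: "'h::{real_inner, complete_space} \<Rightarrow> 'h"
  assumes S: "subspace S" "closed S" and T: "bounded_linear T" "\<And>p. p \<in> S \<Longrightarrow> T p \<in> S"
    and sym: "\<And>p q. p \<in> S \<Longrightarrow> q \<in> S \<Longrightarrow> inner (T p) q = inner p (T q)"
    and bd: "\<And>p. p \<in> S \<Longrightarrow> m * (norm p)\<^sup>2 \<le> inner (T p) p" "\<And>p. p \<in> S \<Longrightarrow> inner (T p) p \<le> M * (norm p)\<^sup>2"
    and z: "z \<notin> complex_of_real ` {m..M}"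
  shows "\<exists>c>0. \<forall>w\<in>S \<times> S. c * norm w \<le> norm (cres z T w)"
    and "\<And>f. f \<in> S \<times> S \<Longrightarrow> \<exists>w\<in>S \<times> S. cres z T w = f"
proof -
  have "\<exists>d\<ge>0. (\<forall>p\<in>S. d * norm p \<le> norm (Re z *\<^sub>R p - T p)) \<and> d\<^sup>2 + (Im z)\<^sup>2 > 0"
  proof (cases "Im z = 0")
    case True
    then have "Re z < m \<or> M < Re z" using z complex_is_Real_iff
      by (auto simp: image_iff complex_eq_iff not_less intro: ccontr)
    from real_resolvent_lower_bound[OF bd this] obtain d where "d > 0" "\<forall>p\<in>S. d * norm p \<le> norm (Re z *\<^sub>R p - T p)" by blast
    then show ?thesis by (intro exI[of _ d]) (auto intro: add_pos_nonneg)
  next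
    case False
    then show ?thesis by (intro exI[of _ 0]) auto
  qed
  then obtain d where d: "d \<ge> 0" "\<And>p. p \<in> S \<Longrightarrow> d * norm p \<le> norm (Re z *\<^sub>R p - T p)" "d\<^sup>2 + (Im z)\<^sup>2 > 0" by blast
  define c where "c = d\<^sup>2 + (Im z)\<^sup>2"
  have lb: "c * (norm w)\<^sup>2 \<le> (norm (cres z T w))\<^sup>2" if "w \<in> S \<times> S" for w
    unfolding c_def by (rule cres_lower_bound[OF sym d(1,2) that])
  have lb': "c * (norm w)\<^sup>2 \<le> (norm (cres (cnj z) T w))\<^sup>2" if "w \<in> S \<times> S" for w
    using cres_lower_bound[of S T d "cnj z" w, OF sym d(1) _ that] d(2) by (simp add: c_def)
  have "sqrt c * norm w \<le> norm (cres z T w)" if "w \<in> S \<times> S" for w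
    by (rule power2_le_imp_le) (use lb[OF that] d(3) in \<open>auto simp: c_def power_mult_distrib\<close>)
  then show "\<exists>c>0. \<forall>w\<in>S \<times> S. c * norm w \<le> norm (cres z T w)"
    using d(3) by (intro exI[of _ "sqrt c"]) (auto simp: c_def)
  note SS = closed_Times_subspace[OF S]
  show "\<exists>w\<in>S \<times> S. cres z T w = f" if f: "f \<in> S \<times> S" for f
    by (rule surj_if_adjoint_bounded_below[OF SS[THEN conjunct1] SS[THEN conjunct2]
          bounded_linear_cres[OF T(1)] cres_in[OF S(1) T(2)] bounded_linear_cres[OF T(1)] cres_in[OF S(1) T(2)]
          cres_adjoint[OF sym] _ lb' f])
       (use d(3) in \<open>simp_all add: c_def\<close>)
qed

section \<open>The energy space\<close>

text \<open>The geometry of the domain enters through the Poincare inequality. \<open>V\<close> is identified with the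
  closed subspace \<open>G\<close> of gradients in \<open>L\<^sup>2\<close>, the energy norm of \<open>u\<close> being the \<open>L\<^sup>2\<close> norm of \<open>D u\<close>.\<close>

locale poincare_domain =
  fixes \<Omega> :: "(real^'n::finite) set"
  assumes open_domain: "open \<Omega>" and bounded_domain: "bounded \<Omega>"
    and poincare: "\<exists>x0 r. r > 0 \<and> ball x0 r \<subseteq> \<Omega> \<and> controlled \<Omega> (ball x0 r) \<Omega>"
begin

definition D :: "(real^'n \<Rightarrow> real) \<Rightarrow> (real^'n, real^'n) l2" where
  "D u = emb \<Omega> (grad \<Omega> u)"

definition G :: "(real^'n, real^'n) l2 set" where
  "G = D ` V \<Omega>"

lemma weak_gradient_grad: "u \<in> H1 \<Omega> \<Longrightarrow> weak_gradient \<Omega> u (grad \<Omega> u)"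
  unfolding H1_def grad_def using someI_ex[of "weak_gradient \<Omega> u"] by blast

lemma D_eq: "weak_gradient \<Omega> u g \<Longrightarrow> D u = emb \<Omega> g"
proof -
  assume w: "weak_gradient \<Omega> u g"
  then have "u \<in> H1 \<Omega>" unfolding H1_def by blast
  then show ?thesis unfolding D_def by (rule weak_gradient_unique[OF open_domain weak_gradient_grad w refl])
qed

lemma grad_L2: "u \<in> H1 \<Omega> \<Longrightarrow> grad \<Omega> u \<in> L2 \<Omega>"
  using weak_gradient_grad by (auto simp: weak_gradient_def)

lemma V_imp_H1: "u \<in> V \<Omega> \<Longrightarrow> u \<in> H1 \<Omega>" by (simp add: V_def)

lemma V_weak_gradient: "u \<in> V \<Omega> \<Longrightarrow> weak_gradient \<Omega> u (grad \<Omega> u)"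
  by (simp add: weak_gradient_grad V_imp_H1)

lemma weak_gradient_L2: "weak_gradient \<Omega> u g \<Longrightarrow> u \<in> L2 \<Omega>" by (simp add: weak_gradient_def)

lemma integral_as_inner:
  assumes "open B" "B \<subseteq> \<Omega>" "u \<in> L2 \<Omega>"
  shows "(LINT x|lebesgue_on B. u x) = inner (emb \<Omega> u) (emb B (\<lambda>x. 1))"
proof -
  have b: "bounded B" using bounded_subset[OF bounded_domain assms(2)] .
  have 1: "ext B (\<lambda>x. 1::real) \<in> sq_int" using const_L2[OF assms(1) b] L2_iff[OF assms(1)] by blast
  have 2: "ext \<Omega> u \<in> sq_int" using assms(3) L2_iff[OF open_domain] by blast
  have "(\<lambda>x. inner (ext \<Omega> u x) (ext B (\<lambda>x. 1) x)) = ext B u"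
    using assms(2) by (auto simp: ext_def fun_eq_iff)
  then show ?thesis unfolding emb_def inner_abs_l2[OF 2 1] by (simp add: integral_ext[OF assms(1), of u])
qed

lemma V_iff:
  assumes "weak_gradient \<Omega> u g"
  shows "u \<in> V \<Omega> \<longleftrightarrow> inner (emb \<Omega> u) (emb \<Omega> (\<lambda>x. 1)) = 0"
  using assms integral_as_inner[OF open_domain subset_refl weak_gradient_L2[OF assms]]
  unfolding V_def H1_def by auto

lemma V_add: "u \<in> V \<Omega> \<Longrightarrow> v \<in> V \<Omega> \<Longrightarrow> (\<lambda>x. u x + v x) \<in> V \<Omega> \<and> D (\<lambda>x. u x + v x) = D u + D v"
proof -
  assume uv: "u \<in> V \<Omega>" "v \<in> V \<Omega>"
  note w = V_weak_gradient[OF uv(1)] V_weak_gradient[OF uv(2)]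
  note L = weak_gradient_L2[OF w(1)] weak_gradient_L2[OF w(2)]
  note ww = weak_gradient_add[OF open_domain w]
  have "inner (emb \<Omega> (\<lambda>x. u x + v x)) (emb \<Omega> (\<lambda>x. 1)) = 0"
    using uv V_iff[OF w(1)] V_iff[OF w(2)] by (simp add: emb_add[OF open_domain L] inner_add_left)
  then show ?thesis using V_iff[OF ww] D_eq[OF ww]
    by (simp add: D_def emb_add[OF open_domain grad_L2[OF V_imp_H1[OF uv(1)]] grad_L2[OF V_imp_H1[OF uv(2)]]])
qed

lemma V_scale: "u \<in> V \<Omega> \<Longrightarrow> (\<lambda>x. c * u x) \<in> V \<Omega> \<and> D (\<lambda>x. c * u x) = c *\<^sub>R D u"
proof -
  assume u: "u \<in> V \<Omega>"
  note w = V_weak_gradient[OF u]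
  note ww = weak_gradient_scale[OF open_domain w, of c]
  have "emb \<Omega> (\<lambda>x. c * u x) = c *\<^sub>R emb \<Omega> u"
    using emb_scaleR[OF open_domain weak_gradient_L2[OF w], of c] by simp
  then have "inner (emb \<Omega> (\<lambda>x. c * u x)) (emb \<Omega> (\<lambda>x. 1)) = 0" using u V_iff[OF w] by simp
  then show ?thesis using V_iff[OF ww] D_eq[OF ww]
    by (simp add: D_def emb_scaleR[OF open_domain grad_L2[OF V_imp_H1[OF u]]])
qed

lemma V_diff: "u \<in> V \<Omega> \<Longrightarrow> v \<in> V \<Omega> \<Longrightarrow> (\<lambda>x. u x - v x) \<in> V \<Omega> \<and> D (\<lambda>x. u x - v x) = D u - D v"
  using V_add[of u "\<lambda>x. (-1) * v x"] V_scale[of v "-1"] by simp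

lemma emb_one_nonzero:
  assumes "open B" "B \<noteq> {}" "B \<subseteq> \<Omega>"
  shows "inner (emb \<Omega> (\<lambda>x. 1)) (emb B (\<lambda>x. 1::real)) \<noteq> 0"
proof
  have b: "bounded B" using bounded_subset[OF bounded_domain assms(3)] .
  have s: "ext B (\<lambda>x. 1::real) \<in> sq_int" "ext \<Omega> (\<lambda>x. 1::real) \<in> sq_int"
    using const_L2[OF assms(1) b] L2_iff[OF assms(1)] const_L2[OF open_domain bounded_domain] L2_iff[OF open_domain] by blast+
  assume "inner (emb \<Omega> (\<lambda>x. 1)) (emb B (\<lambda>x. 1::real)) = 0"
  moreover have "(\<lambda>x. inner (ext \<Omega> (\<lambda>x. 1::real) x) (ext B (\<lambda>x. 1) x)) = (\<lambda>x. inner (ext B (\<lambda>x. 1::real) x) (ext B (\<lambda>x. 1) x))"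
    using assms(3) by (auto simp: ext_def fun_eq_iff)
  ultimately have "inner (emb B (\<lambda>x. 1::real)) (emb B (\<lambda>x. 1)) = 0"
    unfolding emb_def inner_abs_l2[OF s(2) s(1)] inner_abs_l2[OF s(1) s(1)] by simp
  then have "abs_l2 (ext B (\<lambda>x. 1::real)) = abs_l2 (\<lambda>x. 0)" by (simp add: emb_def abs_l2_zero)
  then have "AE x in lebesgue. ext B (\<lambda>x. 1::real) x = 0" by (simp add: abs_l2_eq s(1))
  then have "AE x in lebesgue. x \<notin> B" by eventually_elim (auto simp: ext_def split: if_splits)
  then show False by (rule open_not_AE_avoided[OF assms(1,2)])
qed

lemma adjust_mean:
  assumes w: "weak_gradient \<Omega> u g" and B: "open B" "B \<noteq> {}" "B \<subseteq> \<Omega>"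
  shows "\<exists>c. weak_gradient \<Omega> (\<lambda>x. u x + c) g \<and> (LINT x|lebesgue_on B. u x + c) = 0"
proof -
  define c where "c = - inner (emb \<Omega> u) (emb B (\<lambda>x. 1)) / inner (emb \<Omega> (\<lambda>x. 1)) (emb B (\<lambda>x. 1::real))"
  have wc: "weak_gradient \<Omega> (\<lambda>x. u x + c) g"
    using weak_gradient_add[OF open_domain w weak_gradient_const[OF open_domain bounded_domain, of c]] by simp
  have 1: "(\<lambda>x. 1::real) \<in> L2 \<Omega>" by (rule const_L2[OF open_domain bounded_domain])
  have "emb \<Omega> (\<lambda>x. c) = c *\<^sub>R emb \<Omega> (\<lambda>x. 1)" using emb_scaleR[OF open_domain 1, of c] by simp
  then have "emb \<Omega> (\<lambda>x. u x + c) = emb \<Omega> u + c *\<^sub>R emb \<Omega> (\<lambda>x. 1)"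
    using emb_add[OF open_domain weak_gradient_L2[OF w] const_L2[OF open_domain bounded_domain, of c]] by simp
  moreover have "inner (emb \<Omega> u) (emb B (\<lambda>x. 1)) + c * inner (emb \<Omega> (\<lambda>x. 1::real)) (emb B (\<lambda>x. 1)) = 0"
    using emb_one_nonzero[OF B] by (simp add: c_def)
  ultimately have "inner (emb \<Omega> (\<lambda>x. u x + c)) (emb B (\<lambda>x. 1)) = 0"
    by (simp only: inner_add_left inner_scaleR_left)
  then show ?thesis using wc integral_as_inner[OF B(1,3) weak_gradient_L2[OF wc]] by auto
qed

lemma G_eq: "G = {emb \<Omega> g | g. \<exists>u. weak_gradient \<Omega> u g}"
proof (intro equalityI subsetI)
  fix w assume "w \<in> G"
  then obtain u where "u \<in> V \<Omega>" "w = emb \<Omega> (grad \<Omega> u)" unfolding G_def D_def by blast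
  then show "w \<in> {emb \<Omega> g | g. \<exists>u. weak_gradient \<Omega> u g}" using V_weak_gradient by blast
next
  fix w assume "w \<in> {emb \<Omega> g | g. \<exists>u. weak_gradient \<Omega> u g}"
  then obtain g u where w: "w = emb \<Omega> g" "weak_gradient \<Omega> u g" by blast
  have ne: "\<Omega> \<noteq> {}" using poincare by auto
  obtain c where c: "weak_gradient \<Omega> (\<lambda>x. u x + c) g" "(LINT x|lebesgue_on \<Omega>. u x + c) = 0"
    using adjust_mean[OF w(2) open_domain ne subset_refl] by blast
  then have "(\<lambda>x. u x + c) \<in> V \<Omega>" unfolding V_def H1_def by blast
  then show "w \<in> G" unfolding G_def using D_eq[OF c(1)] w(1) by (intro image_eqI[of _ _ "\<lambda>x. u x + c"]) auto
qed

text \<open>After subtracting the mean over a ball, \<open>u\<close> vanishes by the Poincare inequality; so \<open>u\<close> is constant, and its mean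
  over \<open>\<Omega>\<close> is zero.\<close>

lemma D_zero_imp:
  assumes u: "u \<in> V \<Omega>" "D u = 0"
  shows "emb \<Omega> u = 0"
proof -
  obtain x0 r where B: "r > 0" "ball x0 r \<subseteq> \<Omega>" "controlled \<Omega> (ball x0 r) \<Omega>" using poincare by blast
  note w = V_weak_gradient[OF u(1)]
  have Bn: "ball x0 r \<noteq> {}" using B(1) by simp
  obtain c where c: "weak_gradient \<Omega> (\<lambda>x. u x + c) (grad \<Omega> u)" "(LINT x|lebesgue_on (ball x0 r). u x + c) = 0"
    using adjust_mean[OF w open_ball Bn B(2)] by blast
  obtain C where "norm (emb \<Omega> (\<lambda>x. u x + c)) \<le> C * norm (emb \<Omega> (grad \<Omega> u))"
    using B(3) c unfolding controlled_def by blast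
  then have z: "emb \<Omega> (\<lambda>x. u x + c) = 0" using u(2) by (simp add: D_def)
  have 1: "(\<lambda>x. 1::real) \<in> L2 \<Omega>" by (rule const_L2[OF open_domain bounded_domain])
  have "emb \<Omega> (\<lambda>x. c) = c *\<^sub>R emb \<Omega> (\<lambda>x. 1)" using emb_scaleR[OF open_domain 1, of c] by simp
  then have e: "emb \<Omega> u = - (c *\<^sub>R emb \<Omega> (\<lambda>x. 1))"
    using z emb_add[OF open_domain weak_gradient_L2[OF w] const_L2[OF open_domain bounded_domain, of c]]
    by (simp add: eq_neg_iff_add_eq_0)
  have "inner (emb \<Omega> u) (emb \<Omega> (\<lambda>x. 1)) = 0" using u(1) V_iff[OF w] by blast
  moreover have "\<Omega> \<noteq> {}" using Bn B(2) by blast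
  ultimately have "c = 0" using e emb_one_nonzero[OF open_domain _ subset_refl] by simp
  then show ?thesis using e by simp
qed

lemma V_ae_eq_iff:
  assumes "u \<in> V \<Omega>" "v \<in> V \<Omega>" shows "ae_eq \<Omega> u v \<longleftrightarrow> D u = D v"
proof -
  note w = V_weak_gradient[OF assms(1)] V_weak_gradient[OF assms(2)]
  note L = weak_gradient_L2[OF w(1)] weak_gradient_L2[OF w(2)]
  have "emb \<Omega> (\<lambda>x. u x - v x) = emb \<Omega> u - emb \<Omega> v"
    using emb_add[OF open_domain L(1) L2_scaleR[OF open_domain L(2), of "-1"]] emb_scaleR[OF open_domain L(2), of "-1"]
    by simp
  then have "emb \<Omega> u = emb \<Omega> v" if "D u = D v"
    using D_zero_imp[of "\<lambda>x. u x - v x"] V_diff[OF assms] that by simp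
  moreover have "D u = D v" if "emb \<Omega> u = emb \<Omega> v"
    unfolding D_def by (rule weak_gradient_unique[OF open_domain w that])
  ultimately show ?thesis using emb_eq_iff[OF open_domain L] by blast
qed

lemma subspace_G: "subspace G"
proof (rule subspaceI)
  have "ext \<Omega> (\<lambda>x. 0 :: real^'n) = (\<lambda>x. 0)" by (auto simp: ext_def)
  then have "emb \<Omega> (\<lambda>x. 0 :: real^'n) = 0" by (simp add: emb_def abs_l2_zero)
  then show "0 \<in> G" unfolding G_eq using weak_gradient_const[OF open_domain bounded_domain, of 0] by force
  show "x + y \<in> G" if xy: "x \<in> G" "y \<in> G" for x y
  proof -
    obtain u v where "u \<in> V \<Omega>" "x = D u" "v \<in> V \<Omega>" "y = D v" using xy unfolding G_def by blast
    then show ?thesis unfolding G_def using V_add[of u v] by (intro image_eqI[of _ _ "\<lambda>x. u x + v x"]) auto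
  qed
  show "c *\<^sub>R x \<in> G" if x: "x \<in> G" for c x
  proof -
    obtain u where "u \<in> V \<Omega>" "x = D u" using x unfolding G_def by blast
    then show ?thesis unfolding G_def using V_scale[of u c] by (intro image_eqI[of _ _ "\<lambda>x. c * u x"]) auto
  qed
qed

text \<open>Once the functions are normalised to mean zero over the reference ball, the Poincare inequality turns
  convergence of the gradients into convergence of the functions, and the weak gradient is closed.\<close>

lemma closed_G: "closed G"
  unfolding closed_sequential_limits
proof (intro allI impI)
  fix X \<gamma> assume X: "(\<forall>n. X n \<in> G) \<and> X \<longlonglongrightarrow> \<gamma>"
  obtain x0 r where B: "r > 0" "ball x0 r \<subseteq> \<Omega>" "controlled \<Omega> (ball x0 r) \<Omega>" using poincare by blast
  have Bn: "ball x0 r \<noteq> {}" using B(1) by simp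
  have "\<exists>u g. weak_gradient \<Omega> u g \<and> X n = emb \<Omega> g \<and> (LINT x|lebesgue_on (ball x0 r). u x) = 0" for n
  proof -
    obtain g u where "X n = emb \<Omega> g" "weak_gradient \<Omega> u g" using X unfolding G_eq by blast
    then show ?thesis using adjust_mean[OF _ open_ball Bn B(2), of u g] by blast
  qed
  then have "\<forall>n. \<exists>p. weak_gradient \<Omega> (fst p) (snd p) \<and> X n = emb \<Omega> (snd p) \<and> (LINT x|lebesgue_on (ball x0 r). fst p x) = 0"
    by simp
  from choice[OF this] obtain p where p: "\<And>n. weak_gradient \<Omega> (fst (p n)) (snd (p n))" "\<And>n. X n = emb \<Omega> (snd (p n))"
    "\<And>n. (LINT x|lebesgue_on (ball x0 r). fst (p n) x) = 0" by blast
  define u where "u n = fst (p n)" for n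
  define g where "g n = snd (p n)" for n
  have ug: "weak_gradient \<Omega> (u n) (g n)" "X n = emb \<Omega> (g n)" "(LINT x|lebesgue_on (ball x0 r). u n x) = 0" for n
    using p[of n] by (simp_all add: u_def g_def)
  have uL: "u n \<in> L2 \<Omega>" "g n \<in> L2 \<Omega>" for n using ug(1)[of n] by (simp_all add: weak_gradient_def)
  obtain C where C: "C \<ge> 0" "\<And>u g. weak_gradient \<Omega> u g \<Longrightarrow> (LINT x|lebesgue_on (ball x0 r). u x) = 0 \<Longrightarrow>
     norm (emb \<Omega> u) \<le> C * norm (emb \<Omega> g)" using B(3) unfolding controlled_def by blast
  have est: "norm (emb \<Omega> (u n) - emb \<Omega> (u k)) \<le> C * norm (X n - X k)" for n k
  proof -
    have w: "weak_gradient \<Omega> (\<lambda>x. u n x + (-1) * u k x) (\<lambda>x. g n x + (-1) *\<^sub>R g k x)"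
      by (rule weak_gradient_add[OF open_domain ug(1) weak_gradient_scale[OF open_domain ug(1)]])
    have e1: "emb \<Omega> (\<lambda>x. u n x + (-1) * u k x) = emb \<Omega> (u n) - emb \<Omega> (u k)"
      using emb_add[OF open_domain uL(1)[of n] L2_scaleR[OF open_domain uL(1)[of k], of "-1"]]
        emb_scaleR[OF open_domain uL(1)[of k], of "-1"] by simp
    have e2: "emb \<Omega> (\<lambda>x. g n x + (-1) *\<^sub>R g k x) = X n - X k"
      using emb_add[OF open_domain uL(2)[of n] L2_scaleR[OF open_domain uL(2)[of k], of "-1"]]
        emb_scaleR[OF open_domain uL(2)[of k], of "-1"] ug(2) by simp
    have "inner (emb \<Omega> (u j)) (emb (ball x0 r) (\<lambda>x. 1)) = 0" for j
      using integral_as_inner[OF open_ball B(2) uL(1)[of j]] ug(3)[of j] by simp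
    then have "(LINT x|lebesgue_on (ball x0 r). u n x + (-1) * u k x) = 0"
      unfolding integral_as_inner[OF open_ball B(2) weak_gradient_L2[OF w]] e1 by (simp add: inner_diff_left)
    from C(2)[OF w this] show ?thesis unfolding e1 e2 .
  qed
  have CX: "Cauchy X" using X by (blast intro: LIMSEQ_imp_Cauchy)
  have "Cauchy (\<lambda>n. emb \<Omega> (u n))"
  proof (rule CauchyI)
    fix e :: real assume e: "e > 0"
    have C1: "C + 1 > 0" using C(1) by simp
    obtain N where N: "\<forall>m\<ge>N. \<forall>n\<ge>N. norm (X m - X n) < e / (C + 1)" using CauchyD[OF CX divide_pos_pos[OF e C1]] by blast
    have "norm (emb \<Omega> (u m) - emb \<Omega> (u n)) < e" if "m \<ge> N" "n \<ge> N" for m n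
    proof -
      have "norm (emb \<Omega> (u m) - emb \<Omega> (u n)) \<le> (C + 1) * norm (X m - X n)"
        using est[of m n] by (simp add: distrib_right add_increasing2)
      also have "\<dots> < (C + 1) * (e / (C + 1))" by (rule mult_strict_left_mono) (use N that C1 in auto)
      finally show ?thesis using C1 by simp
    qed
    then show "\<exists>M. \<forall>m\<ge>M. \<forall>n\<ge>M. norm (emb \<Omega> (u m) - emb \<Omega> (u n)) < e" by blast
  qed
  then obtain w where "(\<lambda>n. emb \<Omega> (u n)) \<longlonglongrightarrow> w" using Cauchy_convergent convergent_def by blast
  moreover have "X = (\<lambda>n. emb \<Omega> (g n))" using ug(2) by (rule HOL.ext)
  then have "(\<lambda>n. emb \<Omega> (g n)) \<longlonglongrightarrow> \<gamma>" using X by blast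
  ultimately obtain v h where "weak_gradient \<Omega> v h" "emb \<Omega> h = \<gamma>"
    using weak_gradient_limit[OF open_domain, of u g w \<gamma>, OF ug(1)] by blast
  then show "\<gamma> \<in> G" unfolding G_eq by blast
qed

subsection \<open>The preconditioned operator\<close>

lemma op_L_eq:
  assumes "u \<in> V \<Omega>" shows "op_L \<Omega> u = (\<lambda>\<psi>\<in>V \<Omega>. inner (D u) (D \<psi>))"
  unfolding op_L_def D_def
  by (rule restrict_ext) (simp add: inner_emb[OF open_domain] grad_L2 V_imp_H1 assms)

lemma norm_V_complex_eq:
  assumes "f \<in> V_complex \<Omega>"
  shows "norm_V_complex \<Omega> f = norm (D (\<lambda>x. Re (f x)), D (\<lambda>x. Im (f x)))"
  using assms by (simp add: norm_V_complex_def V_complex_def op_L_eq norm_Pair power2_norm_eq_inner)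

definition J :: "(real^'n \<Rightarrow> complex) \<Rightarrow> (real^'n, real^'n) l2 \<times> (real^'n, real^'n) l2" where
  "J f = (D (\<lambda>x. Re (f x)), D (\<lambda>x. Im (f x)))"

lemma J_in: "f \<in> V_complex \<Omega> \<Longrightarrow> J f \<in> G \<times> G"
  by (simp add: V_complex_def J_def G_def)

lemma J_add:
  assumes "f \<in> V_complex \<Omega>" "g \<in> V_complex \<Omega>"
  shows "(\<lambda>x. f x + g x) \<in> V_complex \<Omega> \<and> J (\<lambda>x. f x + g x) = J f + J g"
  using assms V_add[of "\<lambda>x. Re (f x)" "\<lambda>x. Re (g x)"] V_add[of "\<lambda>x. Im (f x)" "\<lambda>x. Im (g x)"]
  by (simp add: V_complex_def J_def)

lemma J_cmul:
  assumes "f \<in> V_complex \<Omega>"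
  shows "(\<lambda>x. c * f x) \<in> V_complex \<Omega> \<and> J (\<lambda>x. c * f x) = cmul c (J f)"
proof -
  have f: "(\<lambda>x. Re (f x)) \<in> V \<Omega>" "(\<lambda>x. Im (f x)) \<in> V \<Omega>" using assms by (auto simp: V_complex_def)
  note s = V_scale[OF f(1), of "Re c"] V_scale[OF f(1), of "Im c"] V_scale[OF f(2), of "Re c"] V_scale[OF f(2), of "Im c"]
  show ?thesis using V_diff[OF s(1)[THEN conjunct1] s(4)[THEN conjunct1]] V_add[OF s(3)[THEN conjunct1] s(2)[THEN conjunct1]] s
    by (simp add: V_complex_def J_def cmul_def)
qed

lemma J_ae_eq_iff:
  assumes "f \<in> V_complex \<Omega>" "g \<in> V_complex \<Omega>"
  shows "ae_eq \<Omega> f g \<longleftrightarrow> J f = J g"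
proof -
  have "ae_eq \<Omega> f g \<longleftrightarrow> ae_eq \<Omega> (\<lambda>x. Re (f x)) (\<lambda>x. Re (g x)) \<and> ae_eq \<Omega> (\<lambda>x. Im (f x)) (\<lambda>x. Im (g x))"
    by (simp add: ae_eq_def complex_eq_iff)
  then show ?thesis using assms by (simp add: V_complex_def J_def V_ae_eq_iff)
qed

lemma J_surj:
  assumes "w \<in> G \<times> G" shows "\<exists>f\<in>V_complex \<Omega>. J f = w"
proof -
  obtain u v where "u \<in> V \<Omega>" "v \<in> V \<Omega>" "w = (D u, D v)" using assms unfolding G_def by auto
  then show ?thesis by (intro bexI[of _ "\<lambda>x. Complex (u x) (v x)"]) (auto simp: V_complex_def J_def)
qed

lemma norm_J: "f \<in> V_complex \<Omega> \<Longrightarrow> norm_V_complex \<Omega> f = norm (J f)"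
  by (simp add: norm_V_complex_eq J_def)

text \<open>An operator \<open>P\<close> on \<open>V\<close> is determined only up to null sets; all that matters is the operator \<open>T\<close> with
  \<open>D (P u) = T (D u)\<close> that it induces on gradients.\<close>

lemma resolvent_represented:
  assumes P: "\<forall>u\<in>V \<Omega>. P u \<in> V \<Omega> \<and> D (P u) = T (D u)" and f: "f \<in> V_complex \<Omega>"
  shows "(\<lambda>x. z * f x - complexify_op P f x) \<in> V_complex \<Omega> \<and> J (\<lambda>x. z * f x - complexify_op P f x) = cres z T (J f)"
proof -
  have f': "(\<lambda>x. Re (f x)) \<in> V \<Omega>" "(\<lambda>x. Im (f x)) \<in> V \<Omega>" using f by (auto simp: V_complex_def)
  note zf = J_cmul[OF f, of z]
  have z': "(\<lambda>x. Re (z * f x)) \<in> V \<Omega>" "(\<lambda>x. Im (z * f x)) \<in> V \<Omega>"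
    using zf unfolding V_complex_def by blast+
  have Dz: "D (\<lambda>x. Re (z * f x)) = fst (cmul z (J f))" "D (\<lambda>x. Im (z * f x)) = snd (cmul z (J f))"
    using zf[THEN conjunct2, symmetric] by (simp_all only: J_def fst_conv snd_conv)
  note d = V_diff[OF z'(1) bspec[OF P f'(1), THEN conjunct1]] V_diff[OF z'(2) bspec[OF P f'(2), THEN conjunct1]]
  have 1: "(\<lambda>x. z * f x - complexify_op P f x) \<in> V_complex \<Omega>"
    unfolding V_complex_def complexify_op_def mem_Collect_eq minus_complex.sel complex.sel using d by blast
  have 2: "J (\<lambda>x. z * f x - complexify_op P f x) = (D (\<lambda>x. Re (z * f x)) - D (P (\<lambda>x. Re (f x))), D (\<lambda>x. Im (z * f x)) - D (P (\<lambda>x. Im (f x))))"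
    unfolding J_def complexify_op_def minus_complex.sel complex.sel using d by blast
  show ?thesis using 1 unfolding 2 Dz using P f' by (simp add: cres_def cmul_def J_def)
qed

lemma has_bounded_inverseI:
  assumes P: "\<forall>u\<in>V \<Omega>. P u \<in> V \<Omega> \<and> D (P u) = T (D u)" and T: "bounded_linear T"
    and c: "c > 0" "\<And>w. w \<in> G \<times> G \<Longrightarrow> c * norm w \<le> norm (cres z T w)"
    and surj: "\<And>f. f \<in> G \<times> G \<Longrightarrow> \<exists>w\<in>G \<times> G. cres z T w = f"
  shows "has_bounded_inverse \<Omega> (\<lambda>f x. z * f x - complexify_op P f x)"
proof -
  let ?B = "\<lambda>f x. z * f x - complexify_op P f x"
  interpret A: bounded_linear "cres z T" by (rule bounded_linear_cres[OF T])
  note SS = closed_Times_subspace[OF subspace_G closed_G, THEN conjunct1]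
  have inj: "w = w'" if "w \<in> G \<times> G" "w' \<in> G \<times> G" "cres z T w = cres z T w'" for w w'
  proof -
    have "w - w' \<in> G \<times> G" by (rule subspace_diff[OF SS that(1,2)])
    from c(2)[OF this] have "c * norm (w - w') \<le> 0" unfolding A.diff that(3) by simp
    then have "norm (w - w') \<le> 0" using c(1) by (simp add: mult_le_0_iff)
    then show ?thesis by simp
  qed
  define S where "S f = (SOME g. g \<in> V_complex \<Omega> \<and> cres z T (J g) = J f)" for f
  have S: "S f \<in> V_complex \<Omega>" "cres z T (J (S f)) = J f" if f: "f \<in> V_complex \<Omega>" for f
  proof -
    obtain w where w: "w \<in> G \<times> G" "cres z T w = J f" using surj[OF J_in[OF f]] by (elim bexE)
    obtain g where "g \<in> V_complex \<Omega>" "J g = w" using J_surj[OF w(1)] by (elim bexE)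
    then have "\<exists>g. g \<in> V_complex \<Omega> \<and> cres z T (J g) = J f" using w(2) by (intro exI[of _ g]) simp
    from someI_ex[OF this] show "S f \<in> V_complex \<Omega>" "cres z T (J (S f)) = J f"
      unfolding S_def by (rule conjunct1, rule conjunct2)
  qed
  note JS = J_in[OF S(1)]
  have "bounded_op_V_complex \<Omega> S"
    unfolding bounded_op_V_complex_def
  proof (intro conjI ballI allI)
    show "S \<in> V_complex \<Omega> \<rightarrow> V_complex \<Omega>" using S(1) by blast
    fix f assume f: "f \<in> V_complex \<Omega>"
    show "ae_eq \<Omega> (S (\<lambda>x. f x + g x)) (\<lambda>x. S f x + S g x)" if g: "g \<in> V_complex \<Omega>" for g
    proof -
      note a = J_add[OF f g, THEN conjunct1] J_add[OF f g, THEN conjunct2]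
      note b = J_add[OF S(1)[OF f] S(1)[OF g], THEN conjunct1] J_add[OF S(1)[OF f] S(1)[OF g], THEN conjunct2]
      have "J (S (\<lambda>x. f x + g x)) = J (\<lambda>x. S f x + S g x)"
        by (rule inj[OF JS[OF a(1)] J_in[OF b(1)]]) (simp only: S(2)[OF a(1)] a(2) b(2) A.add S(2)[OF f] S(2)[OF g])
      then show ?thesis using J_ae_eq_iff[OF S(1)[OF a(1)] b(1)] by blast
    qed
    show "ae_eq \<Omega> (S (\<lambda>x. k * f x)) (\<lambda>x. k * S f x)" for k
    proof -
      note a = J_cmul[OF f, of k, THEN conjunct1] J_cmul[OF f, of k, THEN conjunct2]
      note b = J_cmul[OF S(1)[OF f], of k, THEN conjunct1] J_cmul[OF S(1)[OF f], of k, THEN conjunct2]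
      have "J (S (\<lambda>x. k * f x)) = J (\<lambda>x. k * S f x)"
        by (rule inj[OF JS[OF a(1)] J_in[OF b(1)]]) (simp only: S(2)[OF a(1)] a(2) b(2) cres_cmul[OF T] S(2)[OF f])
      then show ?thesis using J_ae_eq_iff[OF S(1)[OF a(1)] b(1)] by blast
    qed
  next
    have "norm_V_complex \<Omega> (S f) \<le> inverse c * norm_V_complex \<Omega> f" if f: "f \<in> V_complex \<Omega>" for f
      using c(2)[OF JS[OF f]] c(1) unfolding S(2)[OF f] norm_J[OF S(1)[OF f]] norm_J[OF f]
      by (simp add: field_simps)
    then show "\<exists>M. \<forall>f\<in>V_complex \<Omega>. norm_V_complex \<Omega> (S f) \<le> M * norm_V_complex \<Omega> f" by blast
  qed
  moreover have "ae_eq \<Omega> (S (?B f)) f \<and> ae_eq \<Omega> (?B (S f)) f" if f: "f \<in> V_complex \<Omega>" for f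
  proof
    note b = resolvent_represented[where P = P and T = T and z = z, OF P f]
    note bS = resolvent_represented[where P = P and T = T and z = z, OF P S(1)[OF f]]
    have "J (S (?B f)) = J f"
      by (rule inj[OF JS[OF b[THEN conjunct1]] J_in[OF f]]) (rule trans[OF S(2)[OF b[THEN conjunct1]] b[THEN conjunct2]])
    then show "ae_eq \<Omega> (S (?B f)) f" using J_ae_eq_iff[OF S(1)[OF b[THEN conjunct1]] f] by blast
    have "J (?B (S f)) = J f" by (rule trans[OF bS[THEN conjunct2] S(2)[OF f]])
    then show "ae_eq \<Omega> (?B (S f)) f" using J_ae_eq_iff[OF bS[THEN conjunct1] f] by blast
  qed
  ultimately show ?thesis unfolding has_bounded_inverse_def by blast
qed

lemma has_bounded_inverseD:
  assumes P: "\<forall>u\<in>V \<Omega>. P u \<in> V \<Omega> \<and> D (P u) = T (D u)"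
    and inv: "has_bounded_inverse \<Omega> (\<lambda>f x. z * f x - complexify_op P f x)"
  shows "\<exists>M. \<forall>w\<in>G \<times> G. norm w \<le> M * norm (cres z T w)"
proof -
  let ?B = "\<lambda>f x. z * f x - complexify_op P f x"
  obtain S where S: "bounded_op_V_complex \<Omega> S" "\<And>f. f \<in> V_complex \<Omega> \<Longrightarrow> ae_eq \<Omega> (S (?B f)) f"
    using inv unfolding has_bounded_inverse_def by blast
  obtain M where M: "\<And>f. f \<in> V_complex \<Omega> \<Longrightarrow> norm_V_complex \<Omega> (S f) \<le> M * norm_V_complex \<Omega> f"
    using S(1) unfolding bounded_op_V_complex_def by blast
  have SV: "S f \<in> V_complex \<Omega>" if "f \<in> V_complex \<Omega>" for f using S(1) that unfolding bounded_op_V_complex_def by blast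
  have "norm w \<le> M * norm (cres z T w)" if w: "w \<in> G \<times> G" for w
  proof -
    obtain f where f: "f \<in> V_complex \<Omega>" "J f = w" using J_surj[OF w] by blast
    note b = resolvent_represented[where P = P and T = T and z = z, OF P f(1)]
    have "J (S (?B f)) = J f" using S(2)[OF f(1)] J_ae_eq_iff[OF SV[OF b[THEN conjunct1]] f(1)] by blast
    then show ?thesis
      using M[OF b[THEN conjunct1]] f(2) b[THEN conjunct2] norm_J[OF b[THEN conjunct1]] norm_J[OF SV[OF b[THEN conjunct1]]]
      by simp
  qed
  then show ?thesis by blast
qed

end

section \<open>The preconditioned operator of a tensor\<close>

lemma norm_matrix_vector_le:
  fixes A :: "real^'n::finite^'m::finite"
  shows "norm (A *v v) \<le> real CARD('m) * norm A * norm v"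
proof -
  have "norm (A *v v) \<le> (\<Sum>i\<in>UNIV. \<bar>(A *v v) $ i\<bar>)" by (rule norm_le_l1_cart)
  also have "\<dots> \<le> (\<Sum>i\<in>(UNIV::'m set). norm A * norm v)"
  proof (rule sum_mono)
    fix i
    have "\<bar>(A *v v) $ i\<bar> = \<bar>(A $ i) \<bullet> v\<bar>" by (simp add: matrix_vector_mul_component)
    also have "\<dots> \<le> norm (A $ i) * norm v" by (rule Cauchy_Schwarz_ineq2)
    also have "\<dots> \<le> norm A * norm v" by (rule mult_right_mono[OF Finite_Cartesian_Product.norm_nth_le norm_ge_zero])
    finally show "\<bar>(A *v v) $ i\<bar> \<le> norm A * norm v" .
  qed
  finally show ?thesis by simp
qed

lemma continuous_matrix_vector: "continuous_on UNIV (\<lambda>p. fst p *v (snd p :: real^'n::finite) :: real^'m::finite)"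
  unfolding matrix_vector_mult_def by (intro continuous_on_vec_lambda continuous_intros)

lemma norm_abs_l2_mono:
  assumes "f \<in> sq_int" "g \<in> sq_int" "C \<ge> 0" "\<And>x. norm (f x) \<le> C * norm (g x)"
  shows "norm (abs_l2 f) \<le> C * norm (abs_l2 g)"
proof (rule power2_le_imp_le)
  have "(norm (abs_l2 f))\<^sup>2 \<le> (LINT x|lebesgue. C\<^sup>2 * (norm (g x))\<^sup>2)"
    unfolding norm_abs_l2[OF assms(1)]
  proof (rule integral_mono)
    show "integrable lebesgue (\<lambda>x. C\<^sup>2 * (norm (g x))\<^sup>2)" by (intro integrable_mult_right sq_int_norm2 assms)
    show "(norm (f x))\<^sup>2 \<le> C\<^sup>2 * (norm (g x))\<^sup>2" for x
      using power_mono[OF assms(4)[of x] norm_ge_zero, of 2] by (simp add: power_mult_distrib)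
  qed (rule sq_int_norm2[OF assms(1)])
  also have "\<dots> = C\<^sup>2 * (norm (abs_l2 g))\<^sup>2" unfolding norm_abs_l2[OF assms(2)] by (rule integral_mult_right_zero)
  finally show "(norm (abs_l2 f))\<^sup>2 \<le> (C * norm (abs_l2 g))\<^sup>2" by (simp add: power_mult_distrib)
qed (use assms(3) in simp)

locale tensor_domain = poincare_domain \<Omega> for \<Omega> :: "(real^2) set" +
  fixes K :: "real^2 \<Rightarrow> real^2^2" and m M C\<^sub>K :: real
  assumes K_cont: "continuous_on \<Omega> K"
    and K_sym: "\<And>x. x \<in> \<Omega> \<Longrightarrow> transpose (K x) = K x"
    and K_lower: "\<And>x v. x \<in> \<Omega> \<Longrightarrow> m * (norm v)\<^sup>2 \<le> (K x *v v) \<bullet> v"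
    and K_upper: "\<And>x v. x \<in> \<Omega> \<Longrightarrow> (K x *v v) \<bullet> v \<le> M * (norm v)\<^sup>2"
    and K_bound: "C\<^sub>K \<ge> 0" "\<And>x v. x \<in> \<Omega> \<Longrightarrow> norm (K x *v v) \<le> C\<^sub>K * norm v"
begin

text \<open>Testing \<open>K \<nabla>u\<close> against gradients only sees its orthogonal projection to \<open>G\<close>. So on gradients \<open>T\<close> is
  multiplication by \<open>K\<close> followed by that projection.\<close>

definition mulK :: "(real^2, real^2) l2 \<Rightarrow> (real^2, real^2) l2" where
  "mulK w = emb \<Omega> (\<lambda>x. K x *v rep_l2 w x)"

definition T :: "(real^2, real^2) l2 \<Rightarrow> (real^2, real^2) l2" where
  "T w = proj G (mulK w)"

lemma K_L2:
  assumes f: "f \<in> L2 \<Omega>" shows "(\<lambda>x. K x *v f x) \<in> L2 \<Omega>"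
proof -
  have fs: "ext \<Omega> f \<in> sq_int" using f L2_iff[OF open_domain] by blast
  have "K \<in> borel_measurable (lebesgue_on \<Omega>)"
    by (rule continuous_imp_measurable_on_sets_lebesgue[OF K_cont open_sets_lebesgue[OF open_domain]])
  then have "(\<lambda>x. K x *v f x) \<in> borel_measurable (lebesgue_on \<Omega>)"
    by (rule borel_measurable_continuous_Pair[OF _ _ continuous_matrix_vector]) (use f in \<open>simp add: L2_def\<close>)
  then have "ext \<Omega> (\<lambda>x. K x *v f x) \<in> borel_measurable lebesgue"
    using borel_measurable_if[OF open_sets_lebesgue[OF open_domain], of "\<lambda>x. K x *v f x"] by (simp add: ext_def[abs_def])
  then have "ext \<Omega> (\<lambda>x. K x *v f x) \<in> sq_int"
    by (rule sq_int_dominated[OF _ fs, where C = C\<^sub>K]) (simp add: ext_def K_bound)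
  then show ?thesis using L2_iff[OF open_domain] by blast
qed

lemma mulK_abs:
  assumes f: "f \<in> sq_int" shows "mulK (abs_l2 f) = emb \<Omega> (\<lambda>x. K x *v f x)"
proof -
  have r: "rep_l2 (abs_l2 f) \<in> sq_int" using Quotient_rep_reflp[OF Quotient_l2, of "abs_l2 f"] by blast
  have "abs_l2 (rep_l2 (abs_l2 f)) = abs_l2 f" by (rule Quotient_abs_rep[OF Quotient_l2])
  then have "AE x in lebesgue. rep_l2 (abs_l2 f) x = f x" using abs_l2_eq[OF r f] by blast
  then have "AE x in lebesgue_on \<Omega>. K x *v rep_l2 (abs_l2 f) x = K x *v f x"
    using open_sets_lebesgue[OF open_domain] by (simp add: AE_restrict_space_iff) (erule AE_mp, simp)
  then have "ae_eq \<Omega> (\<lambda>x. K x *v rep_l2 (abs_l2 f) x) (\<lambda>x. K x *v f x)" by (simp add: ae_eq_def)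
  then show ?thesis unfolding mulK_def
    using emb_eq_iff[OF open_domain K_L2[OF sq_int_imp_L2[OF open_domain r]] K_L2[OF sq_int_imp_L2[OF open_domain f]]]
    by blast
qed

lemma mulK_emb:
  assumes "g \<in> L2 \<Omega>" shows "mulK (emb \<Omega> g) = emb \<Omega> (\<lambda>x. K x *v g x)"
proof -
  have "ext \<Omega> g \<in> sq_int" using assms L2_iff[OF open_domain] by blast
  moreover have "ext \<Omega> (\<lambda>x. K x *v ext \<Omega> g x) = ext \<Omega> (\<lambda>x. K x *v g x)" by (auto simp: ext_def)
  ultimately show ?thesis using mulK_abs[of "ext \<Omega> g"] by (simp add: emb_def)
qed

lemma bounded_linear_mulK: "bounded_linear mulK"
proof (rule bounded_linear_intro[where K = C\<^sub>K])
  fix w w' :: "(real^2, real^2) l2" and r :: real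
  obtain f where f: "f \<in> sq_int" "w = abs_l2 f" using abs_l2_rep by blast
  obtain f' where f': "f' \<in> sq_int" "w' = abs_l2 f'" using abs_l2_rep by blast
  note L = K_L2[OF sq_int_imp_L2[OF open_domain f(1)]] K_L2[OF sq_int_imp_L2[OF open_domain f'(1)]]
  have "mulK (w + w') = emb \<Omega> (\<lambda>x. K x *v f x + K x *v f' x)"
    unfolding f(2) f'(2) abs_l2_add[OF f(1) f'(1)] mulK_abs[OF sq_int_add[OF f(1) f'(1)]] matrix_vector_right_distrib ..
  also have "\<dots> = mulK w + mulK w'"
    unfolding f(2) f'(2) mulK_abs[OF f(1)] mulK_abs[OF f'(1)] by (rule emb_add[OF open_domain L])
  finally show "mulK (w + w') = mulK w + mulK w'" .
  have "mulK (r *\<^sub>R w) = emb \<Omega> (\<lambda>x. r *\<^sub>R (K x *v f x))"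
    unfolding f(2) abs_l2_scaleR[OF f(1)] mulK_abs[OF sq_int_scaleR[OF f(1)]] matrix_vector_mult_scaleR ..
  also have "\<dots> = r *\<^sub>R mulK w"
    unfolding f(2) mulK_abs[OF f(1)] by (rule emb_scaleR[OF open_domain L(1)])
  finally show "mulK (r *\<^sub>R w) = r *\<^sub>R mulK w" .
  have "ext \<Omega> (\<lambda>x. K x *v f x) \<in> sq_int" using L(1) L2_iff[OF open_domain] by blast
  then have "norm (mulK w) \<le> C\<^sub>K * norm w"
    unfolding f(2) mulK_abs[OF f(1)] unfolding emb_def
    by (rule norm_abs_l2_mono[OF _ f(1) K_bound(1)]) (simp add: ext_def K_bound)
  then show "norm (mulK w) \<le> norm w * C\<^sub>K" by (simp add: mult.commute)
qed

lemma bounded_linear_T: "bounded_linear T"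
  unfolding T_def[abs_def]
  by (rule bounded_linear_compose[OF bounded_linear_proj[OF subspace_G closed_G] bounded_linear_mulK])

lemma T_in_G: "T w \<in> G" and inner_T: "s \<in> G \<Longrightarrow> inner (T w) s = inner (mulK w) s"
  unfolding T_def by (rule proj[OF subspace_G closed_G], rule proj(2)[OF subspace_G closed_G])

lemma G_emb:
  assumes "w \<in> G" obtains g where "g \<in> L2 \<Omega>" "w = emb \<Omega> g"
proof -
  obtain u where "u \<in> V \<Omega>" "w = emb \<Omega> (grad \<Omega> u)" using assms unfolding G_def D_def by blast
  then show ?thesis using that grad_L2[OF V_imp_H1] by blast
qed

lemma inner_mulK_emb:
  assumes "g \<in> L2 \<Omega>" "h \<in> L2 \<Omega>"
  shows "inner (mulK (emb \<Omega> g)) (emb \<Omega> h) = (LINT x|lebesgue_on \<Omega>. (K x *v g x) \<bullet> h x)"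
  unfolding mulK_emb[OF assms(1)] by (rule inner_emb[OF open_domain K_L2[OF assms(1)] assms(2)])

lemma T_symmetric:
  assumes "p \<in> G" "q \<in> G" shows "inner (T p) q = inner p (T q)"
proof -
  obtain g where g: "g \<in> L2 \<Omega>" "p = emb \<Omega> g" using G_emb[OF assms(1)] .
  obtain h where h: "h \<in> L2 \<Omega>" "q = emb \<Omega> h" using G_emb[OF assms(2)] .
  have "(K x *v v) \<bullet> w = (K x *v w) \<bullet> v" if "x \<in> \<Omega>" for x v w
  proof -
    have "(K x *v v) \<bullet> w = (v v* K x) \<bullet> w" using K_sym[OF that] transpose_matrix_vector[of "K x" v] by simp
    also have "\<dots> = v \<bullet> (K x *v w)" by (rule dot_lmul_matrix)
    finally show ?thesis by (simp add: inner_commute)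
  qed
  then have "inner (mulK p) q = inner (mulK q) p"
    unfolding g(2) h(2) inner_mulK_emb[OF g(1) h(1)] inner_mulK_emb[OF h(1) g(1)]
    by (intro Bochner_Integration.integral_cong) simp_all
  then show ?thesis using inner_T[OF assms(2)] inner_T[OF assms(1), of q] by (simp add: inner_commute)
qed

lemma T_bounds:
  assumes "p \<in> G"
  shows "m * (norm p)\<^sup>2 \<le> inner (T p) p" "inner (T p) p \<le> M * (norm p)\<^sup>2"
proof -
  obtain g where g: "g \<in> L2 \<Omega>" "p = emb \<Omega> g" using G_emb[OF assms(1)] .
  have gs: "ext \<Omega> g \<in> sq_int" "ext \<Omega> (\<lambda>x. K x *v g x) \<in> sq_int"
    using g(1) K_L2[OF g(1)] L2_iff[OF open_domain] by blast+
  have "inner (mulK p) p = (LINT x|lebesgue. ext \<Omega> (\<lambda>x. K x *v g x) x \<bullet> ext \<Omega> g x)"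
    unfolding g(2) mulK_emb[OF g(1)] unfolding emb_def by (rule inner_abs_l2[OF gs(2,1)])
  then have e: "inner (T p) p = (LINT x|lebesgue. ext \<Omega> (\<lambda>x. K x *v g x) x \<bullet> ext \<Omega> g x)"
    using inner_T[OF assms] by simp
  have n: "r * (norm p)\<^sup>2 = (LINT x|lebesgue. r * (norm (ext \<Omega> g x))\<^sup>2)" for r
    unfolding g(2) emb_def norm_abs_l2[OF gs(1)] by (rule integral_mult_right_zero[symmetric])
  note int = sq_int_inner_integrable[OF gs(2,1)] integrable_mult_right[OF sq_int_norm2[OF gs(1)]]
  show "m * (norm p)\<^sup>2 \<le> inner (T p) p" unfolding e n
    by (rule integral_mono[OF int(2,1)]) (simp add: ext_def K_lower)
  show "inner (T p) p \<le> M * (norm p)\<^sup>2" unfolding e n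
    by (rule integral_mono[OF int]) (simp add: ext_def K_upper)
qed

text \<open>The projection of \<open>K \<nabla>u\<close> to \<open>G\<close> provides a preimage of \<open>op_A \<Omega> K u\<close> under \<open>op_L \<Omega>\<close>, so that \<open>inv_into\<close> is meaningful;
  all preimages have the same gradient.\<close>

lemma precond_op_represented: "\<forall>u\<in>V \<Omega>. precond_op \<Omega> K u \<in> V \<Omega> \<and> D (precond_op \<Omega> K u) = T (D u)"
proof
  fix u assume u: "u \<in> V \<Omega>"
  have A: "op_A \<Omega> K u = (\<lambda>\<psi>\<in>V \<Omega>. inner (mulK (D u)) (D \<psi>))"
    unfolding op_A_def D_def
    by (rule restrict_ext) (simp add: inner_mulK_emb grad_L2 V_imp_H1 u)
  obtain u' where u': "u' \<in> V \<Omega>" "T (D u) = D u'" using T_in_G[of "D u"] unfolding G_def by blast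
  have "op_L \<Omega> u' = op_A \<Omega> K u"
    unfolding A op_L_eq[OF u'(1)]
    by (rule restrict_ext) (simp add: u'(2)[symmetric] inner_T G_def)
  then have "op_A \<Omega> K u \<in> op_L \<Omega> ` V \<Omega>" by (rule image_eqI[OF HOL.sym, OF _ u'(1)])
  then have w: "precond_op \<Omega> K u \<in> V \<Omega>" "op_L \<Omega> (precond_op \<Omega> K u) = op_A \<Omega> K u"
    unfolding precond_op_def by (rule inv_into_into, rule f_inv_into_f)
  have "D (precond_op \<Omega> K u) = T (D u)"
  proof (rule subspace_eqI[OF subspace_G])
    show "D (precond_op \<Omega> K u) \<in> G" "T (D u) \<in> G" using w(1) T_in_G by (simp_all add: G_def)
    fix s assume s: "s \<in> G"
    then obtain \<psi> where \<psi>: "\<psi> \<in> V \<Omega>" "s = D \<psi>" unfolding G_def by blast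
    have "inner (D (precond_op \<Omega> K u)) (D \<psi>) = inner (mulK (D u)) (D \<psi>)"
      using fun_cong[OF w(2), of \<psi>] unfolding A op_L_eq[OF w(1)] using \<psi>(1) by simp
    then show "inner (D (precond_op \<Omega> K u)) s = inner (T (D u)) s" using inner_T[OF s] \<psi>(2) by simp
  qed
  then show "precond_op \<Omega> K u \<in> V \<Omega> \<and> D (precond_op \<Omega> K u) = T (D u)" using w(1) by blast
qed

lemma spectrum_subset: "spectrum_V \<Omega> (precond_op \<Omega> K) \<subseteq> complex_of_real ` {m..M}"
proof
  fix z assume z: "z \<in> spectrum_V \<Omega> (precond_op \<Omega> K)"
  show "z \<in> complex_of_real ` {m..M}"
  proof (rule ccontr)
    assume n: "z \<notin> complex_of_real ` {m..M}"
    have "\<exists>c>0. \<forall>w\<in>G \<times> G. c * norm w \<le> norm (cres z T w)"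
      by (rule cres_bijective_off_numerical_range(1)[OF subspace_G closed_G bounded_linear_T _ _ _ _ n])
         (rule T_in_G T_symmetric T_bounds; assumption)+
    then obtain c where c: "c > 0" "\<forall>w\<in>G \<times> G. c * norm w \<le> norm (cres z T w)" by (elim exE conjE)
    have surj: "\<exists>w\<in>G \<times> G. cres z T w = f" if "f \<in> G \<times> G" for f
      by (rule cres_bijective_off_numerical_range(2)[OF subspace_G closed_G bounded_linear_T _ _ _ _ n that])
         (rule T_in_G T_symmetric T_bounds; assumption)+
    have "has_bounded_inverse \<Omega> (\<lambda>f x. z * f x - complexify_op (precond_op \<Omega> K) f x)"
      using bspec[OF c(2)] surj by (rule has_bounded_inverseI[OF precond_op_represented bounded_linear_T c(1)])
    then show False using z by (simp add: spectrum_V_def)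
  qed
qed

text \<open>Weyl's criterion: approximate eigenfunctions rule out a bounded inverse.\<close>

lemma in_spectrum_if_approximate_eigenfunctions:
  assumes approx: "\<And>\<epsilon>. \<epsilon> > 0 \<Longrightarrow> \<exists>w\<in>G. w \<noteq> 0 \<and>
      (\<forall>s\<in>G. inner (l *\<^sub>R w - mulK w) s \<le> \<epsilon> * norm w * norm s)"
  shows "complex_of_real l \<in> spectrum_V \<Omega> (precond_op \<Omega> K)"
proof -
  have "\<not> has_bounded_inverse \<Omega> (\<lambda>f x. complex_of_real l * f x - complexify_op (precond_op \<Omega> K) f x)"
  proof
    assume "has_bounded_inverse \<Omega> (\<lambda>f x. complex_of_real l * f x - complexify_op (precond_op \<Omega> K) f x)"
    from has_bounded_inverseD[OF precond_op_represented this]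
    obtain B where B: "\<forall>w\<in>G \<times> G. norm w \<le> B * norm (cres (complex_of_real l) T w)" by (elim exE)
    \<comment> \<open>Any \<open>\<epsilon>\<close> with \<open>\<bar>B\<bar> \<epsilon> < 1\<close> contradicts the bound \<open>B\<close> of the inverse.\<close>
  define \<epsilon> where "\<epsilon> = 1 / (2 * (\<bar>B\<bar> + 1))"
    have \<epsilon>: "\<epsilon> > 0" "\<bar>B\<bar> * \<epsilon> < 1" by (auto simp: \<epsilon>_def field_simps)
    obtain w where w: "w \<in> G" "w \<noteq> 0" "\<forall>s\<in>G. inner (l *\<^sub>R w - mulK w) s \<le> \<epsilon> * norm w * norm s"
      using approx[OF \<epsilon>(1)] by (elim bexE conjE)
    define y where "y = l *\<^sub>R w - T w"
    have y: "y \<in> G" unfolding y_def by (intro subspace_diff[OF subspace_G] subspace_scale[OF subspace_G] w(1) T_in_G)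
    have "norm y * norm y = inner y y" by (simp only: power2_norm_eq_inner[symmetric] power2_eq_square)
    also have "\<dots> = inner (l *\<^sub>R w - mulK w) y"
      unfolding y_def[of] inner_diff_left[of _ _ "l *\<^sub>R w - T w"] using inner_T[OF y] by (simp add: y_def)
    also have "\<dots> \<le> \<epsilon> * norm w * norm y" using w(3) y by blast
    finally have yn: "norm y \<le> \<epsilon> * norm w"
      by (cases "y = 0") (use \<epsilon>(1) in \<open>auto dest: mult_right_le_imp_le\<close>)
    interpret T: bounded_linear T by (rule bounded_linear_T)
    have "cres (complex_of_real l) T (w, 0) = (y, 0)" by (simp add: cres_def y_def T.zero)
    moreover have "(w, 0) \<in> G \<times> G" using w(1) subspace_0[OF subspace_G] by simp
    ultimately have "norm (w, 0 :: (real^2, real^2) l2) \<le> B * norm (y, 0 :: (real^2, real^2) l2)" using B by force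
    then have "norm w \<le> B * norm y" by (simp add: norm_Pair)
    also have "\<dots> \<le> \<bar>B\<bar> * (\<epsilon> * norm w)"
      by (rule order.trans[OF mult_right_mono[OF abs_ge_self norm_ge_zero] mult_left_mono[OF yn abs_ge_zero]])
    also have "\<dots> < norm w" using mult_strict_right_mono[OF \<epsilon>(2), of "norm w"] w(2) by (simp add: mult.assoc)
    finally show False by simp
  qed
  then show ?thesis by (simp add: spectrum_V_def)
qed

end

section \<open>Approximate eigenfunctions\<close>

subsection \<open>Commuting second derivatives\<close>

text \<open>Equality of mixed partial derivatives makes rotated gradients divergence free. It passes from ridge
  functions to their products, which are the functions used below.\<close>

definition comm_smooth :: "(real^'n::finite \<Rightarrow> real) \<Rightarrow> bool" where
  "comm_smooth f \<longleftrightarrow> (\<forall>k. C_k k f) \<and> (\<forall>i j. partial_deriv (partial_deriv f i) j = partial_deriv (partial_deriv f j) i)"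

lemma comm_smooth_const: "comm_smooth (\<lambda>x. c)"
proof -
  have "partial_deriv (\<lambda>x. c) i = (\<lambda>x. 0)" for c :: real and i :: 'a by (rule HOL.ext) simp
  then show ?thesis by (simp only: comm_smooth_def C_k_const simp_thms)
qed

lemma comm_smooth_mult:
  assumes "comm_smooth f" "comm_smooth g"
  shows "comm_smooth (\<lambda>x. f x * g x)"
proof -
  have C: "C_k k f" "C_k k g" for k using assms by (auto simp: comm_smooth_def simp del: C_k.simps)
  note Cd = C_k_SucD(2)[OF C(1)] C_k_SucD(2)[OF C(2)]
  note d = C_k_SucD(1)[OF C(1)] C_k_SucD(1)[OF C(2)] C_k_SucD(1)[OF Cd(1)] C_k_SucD(1)[OF Cd(2)]
  have c: "partial_deriv (partial_deriv f i) j = partial_deriv (partial_deriv f j) i"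
    "partial_deriv (partial_deriv g i) j = partial_deriv (partial_deriv g j) i" for i j
    using assms unfolding comm_smooth_def by blast+
  have 1: "partial_deriv (\<lambda>x. f x * g x) i = (\<lambda>x. f x * partial_deriv g i x + partial_deriv f i x * g x)" for i
    by (rule HOL.ext, rule partial_deriv_mult[OF d(1,2)])
  have dm: "(\<lambda>x. f x * partial_deriv g i x) differentiable (at x)" "(\<lambda>x. partial_deriv f i x * g x) differentiable (at x)" for i x
    by (rule differentiable_mult[OF d(1) d(4)], rule differentiable_mult[OF d(3) d(2)])
  have 2: "partial_deriv (partial_deriv (\<lambda>x. f x * g x) i) j x
     = (f x * partial_deriv (partial_deriv g i) j x + partial_deriv f j x * partial_deriv g i x)
     + (partial_deriv f i x * partial_deriv g j x + partial_deriv (partial_deriv f i) j x * g x)" for i j x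
    unfolding 1 partial_deriv_add[OF dm] partial_deriv_mult[OF d(1) d(4)] partial_deriv_mult[OF d(3) d(2)] ..
  have "partial_deriv (partial_deriv (\<lambda>x. f x * g x) i) j = partial_deriv (partial_deriv (\<lambda>x. f x * g x) j) i" for i j
  proof
    fix x
    show "partial_deriv (partial_deriv (\<lambda>x. f x * g x) i) j x = partial_deriv (partial_deriv (\<lambda>x. f x * g x) j) i x"
      unfolding 2 c(1)[of i j] c(2)[of i j] by (simp only: ac_simps)
  qed
  then show ?thesis unfolding comm_smooth_def using C_k_mult[OF C] by blast
qed

lemma comm_smooth_prod: "finite I \<Longrightarrow> (\<And>j. j \<in> I \<Longrightarrow> comm_smooth (f j)) \<Longrightarrow> comm_smooth (\<lambda>x. \<Prod>j\<in>I. f j x)"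
  by (induction I rule: finite_induct) (simp_all add: comm_smooth_const comm_smooth_mult)

lemma comm_smooth_ridge:
  fixes v :: "real^'n::finite"
  assumes C: "\<And>k. C_k k (\<lambda>x. H (v \<bullet> x + c))"
    and H: "\<And>t. (H has_real_derivative Hd t) (at t)" "\<And>t. (Hd has_real_derivative Hdd t) (at t)"
  shows "comm_smooth (\<lambda>x. H (v \<bullet> x + c))"
proof -
  have 1: "partial_deriv (\<lambda>x. H (v \<bullet> x + c)) i = (\<lambda>x. v $ i * Hd (v \<bullet> x + c))" for i
    by (rule HOL.ext, rule partial_deriv_ridge[OF H(1)])
  have d: "(\<lambda>x. Hd (v \<bullet> x + c)) differentiable (at x)" for x
    unfolding differentiable_def by (rule exI, rule has_derivative_ridge[OF H(2)])
  have 2: "partial_deriv (\<lambda>x. v $ i * Hd (v \<bullet> x + c)) j x = v $ i * (v $ j * Hdd (v \<bullet> x + c))" for i j x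
  proof -
    have "partial_deriv (\<lambda>x. v $ i * Hd (v \<bullet> x + c)) j x
        = v $ i * partial_deriv (\<lambda>x. Hd (v \<bullet> x + c)) j x + partial_deriv (\<lambda>x. v $ i) j x * Hd (v \<bullet> x + c)"
      by (rule partial_deriv_mult[OF differentiable_const d])
    then show ?thesis by (simp add: partial_deriv_ridge[OF H(2)])
  qed
  show ?thesis unfolding comm_smooth_def 1
  proof (intro conjI allI C HOL.ext)
    fix i j x
    show "partial_deriv (\<lambda>x. v $ i * Hd (v \<bullet> x + c)) j x = partial_deriv (\<lambda>x. v $ j * Hd (v \<bullet> x + c)) i x"
      unfolding 2 by (simp only: ac_simps)
  qed
qed

lemma comm_smooth_box_bump:
  fixes a b :: "real^'n::finite"
  shows "comm_smooth (box_bump a b m)"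
proof -
  have r: "comm_smooth (\<lambda>x. flat 0 (v \<bullet> x + c))" for v :: "real^'n" and c
    by (rule comm_smooth_ridge[where H = "flat 0" and Hd = "flat 2" and Hdd = "\<lambda>t. flat 4 t - 2 * flat 3 t", OF C_k_flat_ridge])
       (use flat_has_derivative[of 0] flat_has_derivative[of 2] in \<open>simp_all add: numeral_eq_Suc\<close>)
  show ?thesis unfolding box_bump_ridges by (intro comm_smooth_prod comm_smooth_mult r) simp
qed

text \<open>Phase shifts of the sine by quarter periods: each is the derivative of its predecessor.\<close>

definition wave :: "nat \<Rightarrow> real \<Rightarrow> real" where
  "wave k t = sin (t + real k * (pi / 2))"

lemma wave_has_derivative: "(wave k has_real_derivative wave (Suc k) t) (at t)"
proof -
  have "t + real (Suc k) * (pi / 2) = (t + real k * (pi / 2)) + pi / 2" by (simp add: algebra_simps)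
  moreover have "sin (y + pi / 2) = cos y" for y :: real by (simp add: sin_add)
  ultimately have "wave (Suc k) t = cos (t + real k * (pi / 2))" by (simp only: wave_def)
  then show ?thesis unfolding wave_def[abs_def] by (auto intro!: derivative_eq_intros)
qed

lemma wave_bound: "\<bar>wave k t\<bar> \<le> 1" by (simp add: wave_def)

lemma wave_squares: "(wave 1 t)\<^sup>2 + (wave 2 t)\<^sup>2 = 1"
  by (simp add: wave_def sin_add)

lemma C_k_wave: "C_k l (\<lambda>x. wave k (v \<bullet> x + c))"
  by (rule C_k_ridge[where F = wave, OF wave_has_derivative])

lemma comm_smooth_wave: "comm_smooth (\<lambda>x. wave k (v \<bullet> x + c))"
  by (rule comm_smooth_ridge[where H = "wave k" and Hd = "wave (Suc k)" and Hdd = "wave (Suc (Suc k))",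
        OF C_k_wave wave_has_derivative wave_has_derivative])

subsection \<open>Rotation by a right angle\<close>

definition perp :: "real^2 \<Rightarrow> real^2" where
  "perp v = (\<chi> i. if i = 1 then - v $ 2 else v $ 1)"

lemma perp_nth: "perp v $ 1 = - v $ 2" "perp v $ 2 = v $ 1"
  by (simp_all add: perp_def)

lemma linear_perp: "linear perp"
  by (rule linearI) (simp_all add: vec_eq_iff forall_2 perp_nth)

lemma orthogonal_imp_multiple_perp:
  assumes "norm \<xi> = 1" "w \<bullet> \<xi> = 0" shows "w = (w \<bullet> perp \<xi>) *\<^sub>R perp \<xi>"
proof -
  have "(norm \<xi>)\<^sup>2 = 1" using assms(1) by simp
  then have 1: "\<xi> $ 1 * \<xi> $ 1 + \<xi> $ 2 * \<xi> $ 2 = 1"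
    by (simp add: power2_norm_eq_inner inner_vec_def sum_2)
  have 2: "w $ 1 * \<xi> $ 1 + w $ 2 * \<xi> $ 2 = 0" using assms(2) by (simp add: inner_vec_def sum_2)
  have "w $ 1 = (w $ 1 * - \<xi> $ 2 + w $ 2 * \<xi> $ 1) * - \<xi> $ 2" using 1 2 by algebra
  moreover have "w $ 2 = (w $ 1 * - \<xi> $ 2 + w $ 2 * \<xi> $ 1) * \<xi> $ 1" using 1 2 by algebra
  ultimately show ?thesis by (simp add: vec_eq_iff forall_2 perp_nth inner_vec_def sum_2)
qed

text \<open>Rotated gradients of test functions are divergence free, hence orthogonal to all gradients.\<close>

lemma perp_gradv_orthogonal:
  fixes \<Omega> :: "(real^2) set"
  assumes \<Omega>: "open \<Omega>" and u: "u \<in> test_functions \<Omega>" "comm_smooth u" and w: "weak_gradient \<Omega> \<psi> g"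
  shows "inner (abs_l2 (\<lambda>x. perp (gradv u x))) (emb \<Omega> g) = 0"
proof -
  have rel: "inner (abs_l2 (\<lambda>x. partial_deriv u j x *\<^sub>R axis i 1)) (emb \<Omega> g)
      = - inner (emb \<Omega> \<psi>) (abs_l2 (partial_deriv (partial_deriv u j) i))" for i j
  proof -
    have "inner (emb \<Omega> \<psi>) (abs_l2 (partial_deriv (partial_deriv u j) i))
      = - inner (emb \<Omega> g) (abs_l2 (\<lambda>x. partial_deriv u j x *\<^sub>R axis i 1))"
      using w weak_gradient_iff[OF \<Omega>] test_partial[OF u(1), of j] unfolding weak_rel_def by blast
    then show ?thesis by (simp add: inner_commute[of _ "emb \<Omega> g"])
  qed
  note s = test_scaleR_sq_int[OF test_partial[OF u(1)]]
  have "(\<lambda>x. perp (gradv u x)) = (\<lambda>x. partial_deriv u 1 x *\<^sub>R axis 2 1 - partial_deriv u 2 x *\<^sub>R axis 1 1)"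
    by (rule HOL.ext) (simp add: vec_eq_iff forall_2 perp_nth gradv_def axis_def)
  then have "abs_l2 (\<lambda>x. perp (gradv u x)) = abs_l2 (\<lambda>x. partial_deriv u 1 x *\<^sub>R axis 2 1) - abs_l2 (\<lambda>x. partial_deriv u 2 x *\<^sub>R axis 1 1)"
    by (simp only: abs_l2_diff[OF s s])
  then have "inner (abs_l2 (\<lambda>x. perp (gradv u x))) (emb \<Omega> g)
      = inner (emb \<Omega> \<psi>) (abs_l2 (partial_deriv (partial_deriv u 2) 1)) - inner (emb \<Omega> \<psi>) (abs_l2 (partial_deriv (partial_deriv u 1) 2))"
    by (simp add: inner_diff_left rel)
  also have "partial_deriv (partial_deriv u 2) 1 = partial_deriv (partial_deriv u 1) 2"
    using u(2) unfolding comm_smooth_def by blast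
  finally show ?thesis by simp
qed

subsection \<open>Oscillating functions\<close>

lemma abs_l2_test_nonzero:
  assumes \<phi>: "\<phi> \<in> test_functions \<Omega>" and B: "open B" "B \<noteq> {}" "\<And>x. x \<in> B \<Longrightarrow> \<phi> x \<noteq> 0"
  shows "norm (abs_l2 \<phi>) > 0"
proof -
  have "abs_l2 \<phi> \<noteq> 0"
  proof
    assume "abs_l2 \<phi> = 0"
    then have "AE x in lebesgue. \<phi> x = 0" by (simp add: abs_l2_zero abs_l2_eq test_sq_int[OF \<phi>])
    then have "AE x in lebesgue. x \<notin> B" by eventually_elim (use B(3) in auto)
    then show False by (rule open_not_AE_avoided[OF B(1,2)])
  qed
  then show ?thesis by simp
qed

text \<open>Waves in direction \<open>\<xi>\<close> cut off by \<open>\<phi>\<close>: one of the two phases keeps half of the mass, and all of the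
  gradient that is not parallel to \<open>\<xi>\<close> comes from the cut-off and decays with the frequency \<open>n\<close>.\<close>

lemma oscillating_test_function:
  fixes \<phi> :: "real^2 \<Rightarrow> real"
  assumes \<phi>: "\<phi> \<in> test_functions W" "comm_smooth \<phi>" and \<xi>: "norm \<xi> = 1" and n: "n > 0"
  shows "\<exists>u a. u \<in> test_functions W \<and> comm_smooth u \<and> (\<lambda>x. a x *\<^sub>R \<xi>) \<in> sq_int
    \<and> norm (abs_l2 \<phi>) / 2 \<le> norm (abs_l2 (\<lambda>x. a x *\<^sub>R \<xi>))
    \<and> (\<forall>x. norm (gradv u x - a x *\<^sub>R \<xi>) \<le> (1 / n) * norm (gradv \<phi> x))"
proof -
  define s where "s k x = wave k ((n *\<^sub>R \<xi>) \<bullet> x + 0) * \<phi> x" for k x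
  have st: "s k \<in> test_functions W" for k unfolding s_def[abs_def] by (rule test_mult[OF \<phi>(1) C_k_wave])
  have "(norm (abs_l2 (s 1)))\<^sup>2 + (norm (abs_l2 (s 2)))\<^sup>2 = (norm (abs_l2 \<phi>))\<^sup>2"
  proof -
    have "(norm (s 1 x))\<^sup>2 + (norm (s 2 x))\<^sup>2 = (norm (\<phi> x))\<^sup>2" for x
    proof -
      have "(norm (s 1 x))\<^sup>2 + (norm (s 2 x))\<^sup>2
          = ((wave 1 ((n *\<^sub>R \<xi>) \<bullet> x + 0))\<^sup>2 + (wave 2 ((n *\<^sub>R \<xi>) \<bullet> x + 0))\<^sup>2) * (\<phi> x)\<^sup>2"
        by (simp add: s_def power_mult_distrib distrib_right)
      then show ?thesis unfolding wave_squares by simp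
    qed
    then show ?thesis
      unfolding norm_abs_l2[OF test_sq_int[OF st]] norm_abs_l2[OF test_sq_int[OF \<phi>(1)]]
        Bochner_Integration.integral_add[OF sq_int_norm2[OF test_sq_int[OF st]] sq_int_norm2[OF test_sq_int[OF st]], symmetric]
      by (simp only:)
  qed
  then have "\<exists>j. (norm (abs_l2 \<phi>))\<^sup>2 / 2 \<le> (norm (abs_l2 (s (Suc j))))\<^sup>2"
    by (cases "(norm (abs_l2 \<phi>))\<^sup>2 / 2 \<le> (norm (abs_l2 (s 1)))\<^sup>2")
       (auto intro: exI[of _ 0] exI[of _ 1] simp: numeral_2_eq_2)
  then obtain j where j: "(norm (abs_l2 \<phi>))\<^sup>2 / 2 \<le> (norm (abs_l2 (s (Suc j))))\<^sup>2" by blast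
  define \<eta> where "\<eta> x = (1 / n) * wave j ((n *\<^sub>R \<xi>) \<bullet> x + 0)" for x
  define u where "u x = \<eta> x * \<phi> x" for x
  have \<eta>c: "comm_smooth \<eta>" unfolding \<eta>_def[abs_def] by (rule comm_smooth_mult[OF comm_smooth_const comm_smooth_wave])
  then have \<eta>C: "C_k k \<eta>" for k unfolding comm_smooth_def by blast
  have ut: "u \<in> test_functions W" unfolding u_def[abs_def] by (rule test_mult[OF \<phi>(1) \<eta>C])
  have uc: "comm_smooth u" unfolding u_def[abs_def] by (rule comm_smooth_mult[OF \<eta>c \<phi>(2)])
  have wd: "(\<lambda>x. wave j ((n *\<^sub>R \<xi>) \<bullet> x + 0)) differentiable (at x)" for x
    unfolding differentiable_def by (rule exI, rule has_derivative_ridge[OF wave_has_derivative])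
  have p\<eta>: "partial_deriv \<eta> i x = \<xi> $ i * wave (Suc j) ((n *\<^sub>R \<xi>) \<bullet> x + 0)" for i x
    unfolding \<eta>_def[abs_def] partial_deriv_mult[OF differentiable_const wd] partial_deriv_ridge[OF wave_has_derivative]
    using n by simp
  have gu: "gradv u x - s (Suc j) x *\<^sub>R \<xi> = \<eta> x *\<^sub>R gradv \<phi> x" for x
  proof -
    have "partial_deriv u i x = \<eta> x * partial_deriv \<phi> i x + (\<xi> $ i * wave (Suc j) ((n *\<^sub>R \<xi>) \<bullet> x + 0)) * \<phi> x" for i
      unfolding u_def[abs_def] partial_deriv_mult[OF C_k_SucD(1)[OF \<eta>C] test_differentiable[OF \<phi>(1)]] p\<eta> ..
    then show ?thesis by (simp add: vec_eq_iff gradv_def s_def)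
  qed
  have "norm (gradv u x - s (Suc j) x *\<^sub>R \<xi>) \<le> (1 / n) * norm (gradv \<phi> x)" for x
  proof -
    have "\<bar>\<eta> x\<bar> \<le> (1 / n) * 1" unfolding \<eta>_def abs_mult
      by (rule mult_mono) (use n wave_bound in auto)
    then have "\<bar>\<eta> x\<bar> * norm (gradv \<phi> x) \<le> (1 / n) * norm (gradv \<phi> x)" by (intro mult_right_mono) simp_all
    then show ?thesis unfolding gu by simp
  qed
  moreover have "norm (abs_l2 \<phi>) / 2 \<le> norm (abs_l2 (\<lambda>x. s (Suc j) x *\<^sub>R \<xi>))"
  proof (rule power2_le_imp_le)
    have "(norm (abs_l2 (\<lambda>x. s (Suc j) x *\<^sub>R \<xi>)))\<^sup>2 = (norm (abs_l2 (s (Suc j))))\<^sup>2"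
      unfolding norm_abs_l2[OF test_scaleR_sq_int[OF st]] norm_abs_l2[OF test_sq_int[OF st]] norm_scaleR \<xi> by simp
    moreover have "(norm (abs_l2 \<phi>) / 2)\<^sup>2 \<le> (norm (abs_l2 \<phi>))\<^sup>2 / 2" by (simp add: power_divide)
    ultimately show "(norm (abs_l2 \<phi>) / 2)\<^sup>2 \<le> (norm (abs_l2 (\<lambda>x. s (Suc j) x *\<^sub>R \<xi>)))\<^sup>2" using j by linarith
  qed simp
  ultimately show ?thesis using ut uc test_scaleR_sq_int[OF st, of "Suc j" \<xi>]
    by (intro exI[of _ u] exI[of _ "s (Suc j)"]) blast
qed

lemma compose_linear_sq_int:
  fixes f :: "'a::euclidean_space \<Rightarrow> 'b::euclidean_space" and L :: "'b \<Rightarrow> 'c::euclidean_space"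
  assumes "linear L" "f \<in> sq_int" shows "(\<lambda>x. L (f x)) \<in> sq_int"
proof -
  have bl: "bounded_linear L" using assms(1) by (simp add: linear_conv_bounded_linear)
  then obtain C where C: "\<And>v. norm (L v) \<le> norm v * C" using bounded_linear.bounded by blast
  have "continuous_on UNIV L" by (rule linear_continuous_on[OF bl])
  then have m: "L \<in> borel_measurable borel" by (rule borel_measurable_continuous_onI)
  show ?thesis
    by (rule sq_int_dominated[OF measurable_compose[OF sq_intD[OF assms(2)] m] assms(2), where C = C])
       (use C in \<open>simp add: mult.commute\<close>)
qed

context tensor_domain
begin

text \<open>With \<open>l = K(x1) \<xi> \<bullet> \<xi>\<close>, the vector \<open>l \<xi> - K(x1) \<xi>\<close> is a multiple of the rotated \<open>\<xi>\<close>. Subtracting that multiple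
  of the rotation, which does not act against gradients, gives a constant matrix \<open>L\<close> with \<open>L \<xi> = 0\<close>.\<close>

lemma approximate_eigenfunction:
  assumes x1: "x1 \<in> \<Omega>" and \<xi>: "norm \<xi> = 1" and \<epsilon>: "\<epsilon> > 0"
  shows "\<exists>w\<in>G. w \<noteq> 0 \<and> (\<forall>s\<in>G. inner (((K x1 *v \<xi>) \<bullet> \<xi>) *\<^sub>R w - mulK w) s \<le> \<epsilon> * norm w * norm s)"
proof -
  define l where "l = (K x1 *v \<xi>) \<bullet> \<xi>"
  define c where "c = (l *\<^sub>R \<xi> - K x1 *v \<xi>) \<bullet> perp \<xi>"
  define L where "L v = l *\<^sub>R v - K x1 *v v - c *\<^sub>R perp v" for v
  have linL: "linear L"
    unfolding L_def[abs_def]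
    by (intro linear_compose_sub linear_compose_scale_right linear_perp linear_ident matrix_vector_mul_linear)
  have "\<xi> \<bullet> \<xi> = 1" using \<xi> by (simp add: norm_eq_1)
  then have "(l *\<^sub>R \<xi> - K x1 *v \<xi>) \<bullet> \<xi> = 0" by (simp add: inner_diff_left l_def)
  from orthogonal_imp_multiple_perp[OF \<xi> this] have L\<xi>: "L \<xi> = 0" by (simp add: L_def c_def)
  obtain C where C: "C > 0" "\<And>v. norm (L v) \<le> C * norm v"
    using linear_bounded_pos[OF linL] by blast
  define \<delta> where "\<delta> = \<epsilon> / 2"
  have \<delta>: "\<delta> > 0" using \<epsilon> by (simp add: \<delta>_def)
  obtain d0 where d0: "d0 > 0" "ball x1 d0 \<subseteq> \<Omega>" using open_domain x1 by (rule openE)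
  obtain d1 where d1: "d1 > 0" "\<forall>x\<in>\<Omega>. dist x x1 < d1 \<longrightarrow> dist (K x) (K x1) < \<delta> / 2"
    using K_cont x1 half_gt_zero[OF \<delta>] unfolding continuous_on_iff by blast
  define W where "W = ball x1 (min d0 d1)"
  have W: "open W" "x1 \<in> W" "W \<subseteq> \<Omega>" using d0 d1(1) by (auto simp: W_def)
  have KW: "norm (K x1 *v v - K x *v v) \<le> \<delta> * norm v" if "x \<in> W" for x v
  proof -
    have "x \<in> \<Omega>" "dist x x1 < d1" using W(3) that by (auto simp: W_def dist_commute)
    then have "dist (K x) (K x1) < \<delta> / 2" using d1(2) by blast
    then have "2 * norm (K x1 - K x) \<le> \<delta>" by (simp add: dist_norm norm_minus_commute)
    then have "2 * norm (K x1 - K x) * norm v \<le> \<delta> * norm v" by (rule mult_right_mono) simp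
    moreover have "norm ((K x1 - K x) *v v) \<le> 2 * norm (K x1 - K x) * norm v"
      using norm_matrix_vector_le[of "K x1 - K x" v] by simp
    ultimately show ?thesis by (simp add: matrix_vector_mult_diff_rdistrib)
  qed
  obtain a b where ab: "cbox a b \<subseteq> W" "x1 \<in> box a b"
    using open_contains_cbox[OF W(1,2)] by metis
  define \<phi> where "\<phi> = box_bump a b 1"
  have \<phi>: "\<phi> \<in> test_functions W" "comm_smooth \<phi>"
    unfolding \<phi>_def by (rule test_box_bump[OF zero_less_one ab(1)], rule comm_smooth_box_bump)
  define N0 where "N0 = norm (abs_l2 \<phi>)"
  define N1 where "N1 = norm (abs_l2 (gradv \<phi>))"
  have N0: "N0 > 0" unfolding N0_def
    by (rule abs_l2_test_nonzero[OF \<phi>(1) open_box]) (use ab(2) box_bump_nonzero[of 1 a b] in \<open>auto simp: \<phi>_def\<close>)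
  have N1: "N1 \<ge> 0" by (simp add: N1_def)
  \<comment> \<open>This frequency makes the part of the gradient that is not parallel to \<open>\<xi>\<close> small in both estimates \<open>n1\<close>.\<close>
  define n where "n = 1 + 4 * N1 / N0 + 4 * C * N1 / (\<delta> * N0)"
  have n0: "n > 0" using N0 N1 C(1) \<delta> by (simp add: n_def add_pos_nonneg)
  have n1: "N1 / n \<le> N0 / 4" "C * (N1 / n) \<le> \<delta> * N0 / 4"
  proof -
    have "4 * N1 / N0 \<le> n" "4 * C * N1 / (\<delta> * N0) \<le> n"
      using N0 N1 C(1) \<delta> by (simp_all add: n_def)
    then show "N1 / n \<le> N0 / 4" "C * (N1 / n) \<le> \<delta> * N0 / 4"
      using N0 n0 \<delta> by (simp_all add: field_simps)
  qed
  obtain u \<alpha> where u: "u \<in> test_functions W" "comm_smooth u" "(\<lambda>x. \<alpha> x *\<^sub>R \<xi>) \<in> sq_int"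
    "N0 / 2 \<le> norm (abs_l2 (\<lambda>x. \<alpha> x *\<^sub>R \<xi>))"
    "\<And>x. norm (gradv u x - \<alpha> x *\<^sub>R \<xi>) \<le> (1 / n) * norm (gradv \<phi> x)"
    using oscillating_test_function[OF \<phi> \<xi> n0] unfolding N0_def by blast
  have u\<Omega>: "u \<in> test_functions \<Omega>" using u(1) test_mono[OF W(3)] by blast
  define r where "r x = gradv u x - \<alpha> x *\<^sub>R \<xi>" for x
  have gs: "gradv u \<in> sq_int" by (rule gradv_sq_int[OF u(1)])
  have rs: "r \<in> sq_int" unfolding r_def[abs_def] by (rule sq_int_diff[OF gs u(3)])
  have rn: "norm (abs_l2 r) \<le> N1 / n"
    using norm_abs_l2_mono[OF rs gradv_sq_int[OF \<phi>(1)], of "1 / n"] u(5) n0 by (simp add: r_def N1_def)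
  define w where "w = abs_l2 (gradv u)"
  have wn: "N0 / 4 \<le> norm w"
  proof -
    have "abs_l2 (\<lambda>x. \<alpha> x *\<^sub>R \<xi>) = abs_l2 (\<lambda>x. gradv u x - r x)" by (simp add: r_def)
    also have "\<dots> = w - abs_l2 r" unfolding w_def by (rule abs_l2_diff[OF gs rs, symmetric])
    finally have "norm (abs_l2 (\<lambda>x. \<alpha> x *\<^sub>R \<xi>)) \<le> norm w + norm (abs_l2 r)" by (simp only: norm_triangle_ineq4)
    then show ?thesis using u(4) rn n1(1) by linarith
  qed
  note wg = weak_gradient_test[OF open_domain u\<Omega>]
  have we: "w = emb \<Omega> (gradv u)" by (simp add: w_def emb_def ext_gradv[OF u\<Omega>])
  have wG: "w \<in> G" unfolding G_eq we using wg by blast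
  have gL: "gradv u \<in> L2 \<Omega>" by (rule sq_int_imp_L2[OF open_domain gs])
  define k where "k = ext \<Omega> (\<lambda>x. K x *v gradv u x)"
  have ks: "k \<in> sq_int" "mulK w = abs_l2 k"
    using K_L2[OF gL] L2_iff[OF open_domain] mulK_emb[OF gL] by (auto simp: k_def we emb_def)
  define e1 where "e1 x = L (r x)" for x
  define e2 where "e2 x = perp (gradv u x)" for x
  define e where "e x = l *\<^sub>R gradv u x - k x" for x
  \<comment> \<open>What remains after \<open>L\<close> and the rotation: the oscillation of \<open>K\<close> over \<open>W\<close>.\<close>
  define e3 where "e3 x = e x - (e1 x + c *\<^sub>R e2 x)" for x
  have s1: "e1 \<in> sq_int" unfolding e1_def[abs_def] by (rule compose_linear_sq_int[OF linL rs])
  have s2: "e2 \<in> sq_int" unfolding e2_def[abs_def] by (rule compose_linear_sq_int[OF linear_perp gs])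
  have s: "e \<in> sq_int" unfolding e_def[abs_def] by (rule sq_int_diff[OF sq_int_scaleR[OF gs] ks(1)])
  have s12: "(\<lambda>x. e1 x + c *\<^sub>R e2 x) \<in> sq_int" by (rule sq_int_add[OF s1 sq_int_scaleR[OF s2]])
  have s3: "e3 \<in> sq_int" unfolding e3_def[abs_def] by (rule sq_int_diff[OF s s12])
  have "l *\<^sub>R w - mulK w = abs_l2 e"
    unfolding ks(2) unfolding w_def abs_l2_scaleR[OF gs] e_def[abs_def] by (rule abs_l2_diff[OF sq_int_scaleR[OF gs] ks(1)])
  also have "\<dots> = abs_l2 (\<lambda>x. (e1 x + c *\<^sub>R e2 x) + e3 x)" by (simp add: e3_def)
  also have "\<dots> = abs_l2 e1 + c *\<^sub>R abs_l2 e2 + abs_l2 e3"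
    unfolding abs_l2_add[OF s12 s3, symmetric] abs_l2_add[OF s1 sq_int_scaleR[OF s2], symmetric] abs_l2_scaleR[OF s2] ..
  finally have split: "l *\<^sub>R w - mulK w = abs_l2 e1 + c *\<^sub>R abs_l2 e2 + abs_l2 e3" .
  have e1n: "norm (abs_l2 e1) \<le> \<delta> * norm w"
  proof -
    have "norm (abs_l2 e1) \<le> C * norm (abs_l2 r)"
      by (rule norm_abs_l2_mono[OF s1 rs]) (use C in \<open>simp_all add: e1_def\<close>)
    also have "\<dots> \<le> C * (N1 / n)" using rn C(1) by (intro mult_left_mono) simp_all
    also have "\<dots> \<le> \<delta> * (N0 / 4)" using n1(2) by simp
    also have "\<dots> \<le> \<delta> * norm w" using wn \<delta> by (intro mult_left_mono) simp_all
    finally show ?thesis .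
  qed
  have e3n: "norm (abs_l2 e3) \<le> \<delta> * norm w"
    unfolding w_def
  proof (rule norm_abs_l2_mono[OF s3 gs])
    fix x
    have "L (\<alpha> x *\<^sub>R \<xi>) = 0" using linear_scale[OF linL, of "\<alpha> x" \<xi>] L\<xi> by simp
    then have Lr: "L (r x) = L (gradv u x)" using linear_diff[OF linL, of "gradv u x" "\<alpha> x *\<^sub>R \<xi>"] by (simp add: r_def)
    have e3: "e3 x = K x1 *v gradv u x - k x"
      unfolding e3_def e_def e1_def e2_def Lr by (simp add: L_def)
    show "norm (e3 x) \<le> \<delta> * norm (gradv u x)"
    proof (cases "x \<in> W")
      case True
      then have "k x = K x *v gradv u x" using W(3) by (auto simp: k_def ext_def)
      then show ?thesis using KW[OF True] e3 by simp
    next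
      case False
      have "gradv u x = 0" using fun_cong[OF ext_gradv[OF u(1)], of x] False by (simp add: ext_def)
      then show ?thesis using e3 by (simp add: k_def ext_def)
    qed
  qed (use \<delta> in simp)
  have "inner (l *\<^sub>R w - mulK w) t \<le> \<epsilon> * norm w * norm t" if t: "t \<in> G" for t
  proof -
    obtain g \<psi> where g: "t = emb \<Omega> g" "weak_gradient \<Omega> \<psi> g" using t unfolding G_eq by blast
    have "inner (abs_l2 e2) t = 0"
      unfolding g(1) e2_def[abs_def] by (rule perp_gradv_orthogonal[OF open_domain u\<Omega> u(2) g(2)])
    then have "inner (l *\<^sub>R w - mulK w) t = inner (abs_l2 e1) t + inner (abs_l2 e3) t"
      unfolding split by (simp add: inner_add_left)
    also have "\<dots> \<le> norm (abs_l2 e1) * norm t + norm (abs_l2 e3) * norm t"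
      by (intro add_mono norm_cauchy_schwarz)
    also have "\<dots> \<le> \<delta> * norm w * norm t + \<delta> * norm w * norm t"
      by (intro add_mono mult_right_mono e1n e3n) simp_all
    also have "\<dots> = \<epsilon> * norm w * norm t" by (simp add: \<delta>_def field_simps)
    finally show ?thesis .
  qed
  moreover have "w \<noteq> 0" using wn N0 by auto
  ultimately show ?thesis using wG unfolding l_def by blast
qed

lemma spectrum_superset:
  assumes "\<And>\<epsilon>. \<epsilon> > 0 \<Longrightarrow> \<exists>x\<in>\<Omega>. \<exists>\<xi>. norm \<xi> = 1 \<and> \<bar>l - (K x *v \<xi>) \<bullet> \<xi>\<bar> < \<epsilon>"
  shows "complex_of_real l \<in> spectrum_V \<Omega> (precond_op \<Omega> K)"
proof (rule in_spectrum_if_approximate_eigenfunctions)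
  fix \<epsilon> :: real assume "\<epsilon> > 0"
  then have \<epsilon>: "\<epsilon> / 2 > 0" by simp
  obtain x \<xi> where x: "x \<in> \<Omega>" "norm \<xi> = 1" "\<bar>l - (K x *v \<xi>) \<bullet> \<xi>\<bar> < \<epsilon> / 2" using assms[OF \<epsilon>] by blast
  define l' where "l' = (K x *v \<xi>) \<bullet> \<xi>"
  obtain w where w: "w \<in> G" "w \<noteq> 0" "\<forall>s\<in>G. inner (l' *\<^sub>R w - mulK w) s \<le> \<epsilon> / 2 * norm w * norm s"
    using approximate_eigenfunction[OF x(1,2) \<epsilon>] unfolding l'_def by blast
  have "inner (l *\<^sub>R w - mulK w) s \<le> \<epsilon> * norm w * norm s" if s: "s \<in> G" for s
  proof -
    have "inner (l *\<^sub>R w - mulK w) s = (l - l') * inner w s + inner (l' *\<^sub>R w - mulK w) s"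
      by (simp add: inner_diff_left left_diff_distrib)
    moreover have "(l - l') * inner w s \<le> \<epsilon> / 2 * (norm w * norm s)"
    proof -
      have "(l - l') * inner w s \<le> \<bar>l - l'\<bar> * \<bar>inner w s\<bar>" by (simp add: abs_mult[symmetric])
      also have "\<dots> \<le> \<epsilon> / 2 * (norm w * norm s)"
        by (rule mult_mono) (use x(3) \<epsilon> Cauchy_Schwarz_ineq2 in \<open>auto simp: l'_def\<close>)
      finally show ?thesis .
    qed
    moreover have "inner (l' *\<^sub>R w - mulK w) s \<le> \<epsilon> / 2 * norm w * norm s" using w(3) s by blast
    moreover have "\<epsilon> / 2 * (norm w * norm s) + \<epsilon> / 2 * norm w * norm s = \<epsilon> * norm w * norm s" by (simp add: field_simps)
    ultimately show ?thesis by linarith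
  qed
  then show "\<exists>w\<in>G. w \<noteq> 0 \<and> (\<forall>s\<in>G. inner (l *\<^sub>R w - mulK w) s \<le> \<epsilon> * norm w * norm s)" using w by blast
qed

end

section \<open>The numerical range of the tensor\<close>

lemma quadratic_form_spectral:
  fixes Q :: "real^2^2"
  assumes Q: "orthogonal_matrix Q"
  shows "((Q ** diag2 a b ** transpose Q) *v v) \<bullet> v = a * ((transpose Q *v v) $ 1)\<^sup>2 + b * ((transpose Q *v v) $ 2)\<^sup>2"
proof -
  define y where "y = transpose Q *v v"
  have "((Q ** diag2 a b ** transpose Q) *v v) \<bullet> v = (Q *v (diag2 a b *v y)) \<bullet> v"
    by (simp add: y_def matrix_vector_mul_assoc[symmetric])
  also have "\<dots> = (diag2 a b *v y) \<bullet> y"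
  proof -
    have "(Q *v z) \<bullet> v = z \<bullet> (transpose Q *v v)" for z
      using dot_lmul_matrix[of v Q z] transpose_matrix_vector[of Q v] by (simp add: inner_commute)
    then show ?thesis by (simp add: y_def)
  qed
  also have "\<dots> = a * (y $ 1)\<^sup>2 + b * (y $ 2)\<^sup>2"
    by (simp add: inner_vec_def sum_2 diag2_def matrix_vector_mult_def power2_eq_square)
  finally show ?thesis by (simp add: y_def)
qed

lemma norm2_components: "(norm (v :: real^2))\<^sup>2 = (v $ 1)\<^sup>2 + (v $ 2)\<^sup>2"
  unfolding power2_norm_eq_inner inner_vec_def sum_2 by (simp add: power2_eq_square)

lemma norm_transpose_orthogonal:
  fixes Q :: "real^2^2"
  assumes "orthogonal_matrix Q" shows "norm (transpose Q *v v) = norm v"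
proof -
  have "orthogonal_matrix (transpose Q)" using assms by (simp add: orthogonal_matrix_transpose)
  then have "orthogonal_transformation ((*v) (transpose Q))" by (simp add: orthogonal_transformation_matrix)
  then show ?thesis by (rule orthogonal_transformation_norm)
qed

text \<open>The values \<open>(K x *v \<xi>) \<bullet> \<xi>\<close> over \<open>x\<close> in the closed domain and unit vectors \<open>\<xi>\<close> lie between the eigenvalues at \<open>x\<close> and attain
  them. They depend continuously on \<open>(x, \<xi>)\<close>, whereas \<open>\<kappa>1\<close> and \<open>\<kappa>2\<close> may exchange their roles from point to point.\<close>

locale spectral_tensor =
  fixes \<Omega> :: "(real^2) set" and K Q :: "real^2 \<Rightarrow> real^2^2" and \<kappa>1 \<kappa>2 :: "real^2 \<Rightarrow> real"
  assumes connected_domain: "connected \<Omega>" and nonempty: "\<Omega> \<noteq> {}" and bounded: "bounded \<Omega>"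
    and K_cont_closure: "continuous_on (closure \<Omega>) K"
    and Q_orth: "\<And>x. x \<in> closure \<Omega> \<Longrightarrow> orthogonal_matrix (Q x)"
    and K_spectral: "\<And>x. x \<in> closure \<Omega> \<Longrightarrow> K x = Q x ** diag2 (\<kappa>1 x) (\<kappa>2 x) ** transpose (Q x)"
begin

definition numerical_range :: "real set" where
  "numerical_range = (\<lambda>(x, \<xi>). (K x *v \<xi>) \<bullet> \<xi>) ` (closure \<Omega> \<times> sphere 0 1)"

lemma continuous_quadratic_form: "continuous_on (closure \<Omega> \<times> UNIV) (\<lambda>(x, \<xi>). (K x *v \<xi>) \<bullet> \<xi>)"
proof -
  have K: "continuous_on (closure \<Omega> \<times> UNIV) (\<lambda>p. K (fst p))"
    by (rule continuous_on_compose2[OF K_cont_closure continuous_on_fst[OF continuous_on_id]]) auto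
  have "continuous_on (closure \<Omega> \<times> UNIV) (\<lambda>p. K (fst p) *v snd p)"
    using continuous_on_compose2[OF continuous_matrix_vector continuous_on_Pair[OF K continuous_on_snd[OF continuous_on_id]]]
    by simp
  then show ?thesis unfolding case_prod_beta by (intro continuous_on_inner continuous_on_snd continuous_on_id)
qed

text \<open>A continuous image of a compact connected set, hence an interval: this is where the two eigenvalue
  ranges get joined.\<close>

lemma numerical_range_interval: "\<exists>a b. numerical_range = {a..b} \<and> a \<le> b"
proof -
  have c: "continuous_on (closure \<Omega> \<times> sphere 0 1) (\<lambda>(x, \<xi>). (K x *v \<xi>) \<bullet> \<xi>)"
    by (rule continuous_on_subset[OF continuous_quadratic_form]) auto
  have "compact (closure \<Omega> \<times> sphere (0 :: real^2) 1)"
    using bounded by (intro compact_Times) simp_all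
  then have "compact numerical_range" unfolding numerical_range_def by (rule compact_continuous_image[OF c])
  moreover have "connected (closure \<Omega> \<times> sphere (0 :: real^2) 1)"
    using connected_domain by (intro connected_Times connected_sphere connected_imp_connected_closure) simp_all
  then have "connected numerical_range" unfolding numerical_range_def by (rule connected_continuous_image[OF c])
  ultimately obtain a b where ab: "numerical_range = {a..b}" using connected_compact_interval_1 by blast
  have "axis 1 1 \<in> sphere (0 :: real^2) 1" by (simp add: norm_axis_1)
  then have "numerical_range \<noteq> {}" using nonempty closure_subset unfolding numerical_range_def by blast
  then show ?thesis using ab by auto
qed

lemma quadratic_form:
  assumes "x \<in> closure \<Omega>"
  shows "\<exists>s t. s \<ge> 0 \<and> t \<ge> 0 \<and> s + t = (norm v)\<^sup>2 \<and> (K x *v v) \<bullet> v = \<kappa>1 x * s + \<kappa>2 x * t"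
proof -
  let ?y = "transpose (Q x) *v v"
  have "(?y $ 1)\<^sup>2 + (?y $ 2)\<^sup>2 = (norm v)\<^sup>2"
    using norm2_components[of ?y] norm_transpose_orthogonal[OF Q_orth[OF assms], of v] by simp
  moreover have "(K x *v v) \<bullet> v = \<kappa>1 x * (?y $ 1)\<^sup>2 + \<kappa>2 x * (?y $ 2)\<^sup>2"
    unfolding K_spectral[OF assms] by (rule quadratic_form_spectral[OF Q_orth[OF assms]])
  ultimately show ?thesis by (intro exI[of _ "(?y $ 1)\<^sup>2"] exI[of _ "(?y $ 2)\<^sup>2"]) simp
qed

lemma eigenvalues_in_numerical_range:
  assumes x: "x \<in> closure \<Omega>" shows "\<kappa>1 x \<in> numerical_range" "\<kappa>2 x \<in> numerical_range"
proof -
  have "\<exists>\<xi>. norm \<xi> = 1 \<and> transpose (Q x) *v \<xi> = axis i 1" for i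
  proof (intro exI conjI)
    have "transpose (Q x) ** Q x = mat 1" using Q_orth[OF x] by (simp add: orthogonal_matrix_def)
    then show e: "transpose (Q x) *v (Q x *v axis i 1) = axis i 1" by (simp add: matrix_vector_mul_assoc)
    show "norm (Q x *v axis i 1) = 1"
      using norm_transpose_orthogonal[OF Q_orth[OF x], of "Q x *v axis i 1"] unfolding e by (simp add: norm_axis_1)
  qed
  then obtain f where f: "\<And>i. norm (f i) = 1" "\<And>i. transpose (Q x) *v f i = axis i 1" by metis
  have "(K x *v f i) \<bullet> f i = \<kappa>1 x * (axis i 1 $ 1)\<^sup>2 + \<kappa>2 x * (axis i 1 $ 2)\<^sup>2" for i
    unfolding K_spectral[OF x] quadratic_form_spectral[OF Q_orth[OF x]] f(2) ..
  from this[of 1] this[of 2] have e: "(K x *v f 1) \<bullet> f 1 = \<kappa>1 x" "(K x *v f 2) \<bullet> f 2 = \<kappa>2 x"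
    by (simp_all add: axis_def)
  have m: "(x, f i) \<in> closure \<Omega> \<times> sphere 0 1" for i using x f(1) by simp
  show "\<kappa>1 x \<in> numerical_range" unfolding numerical_range_def by (rule image_eqI[OF _ m[of 1]]) (simp add: e)
  show "\<kappa>2 x \<in> numerical_range" unfolding numerical_range_def by (rule image_eqI[OF _ m[of 2]]) (simp add: e)
qed

lemma numerical_range_eq_hull: "numerical_range = convex hull (\<kappa>1 ` closure \<Omega> \<union> \<kappa>2 ` closure \<Omega>)"
proof
  show "convex hull (\<kappa>1 ` closure \<Omega> \<union> \<kappa>2 ` closure \<Omega>) \<subseteq> numerical_range"
  proof (rule hull_minimal)
    show "\<kappa>1 ` closure \<Omega> \<union> \<kappa>2 ` closure \<Omega> \<subseteq> numerical_range" using eigenvalues_in_numerical_range by blast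
    show "convex numerical_range" using numerical_range_interval by auto
  qed
  show "numerical_range \<subseteq> convex hull (\<kappa>1 ` closure \<Omega> \<union> \<kappa>2 ` closure \<Omega>)"
  proof
    fix l assume "l \<in> numerical_range"
    then obtain x \<xi> where x: "x \<in> closure \<Omega>" "norm \<xi> = 1" "l = (K x *v \<xi>) \<bullet> \<xi>"
      unfolding numerical_range_def by auto
    obtain s t where st: "s \<ge> 0" "t \<ge> 0" "s + t = 1" "l = \<kappa>1 x * s + \<kappa>2 x * t"
      using quadratic_form[OF x(1), of \<xi>] x(2,3) by auto
    have "s *\<^sub>R \<kappa>1 x + t *\<^sub>R \<kappa>2 x \<in> convex hull (\<kappa>1 ` closure \<Omega> \<union> \<kappa>2 ` closure \<Omega>)"
      by (rule convexD[OF convex_convex_hull]) (use x(1) st in \<open>auto intro: hull_inc\<close>)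
    then show "l \<in> convex hull (\<kappa>1 ` closure \<Omega> \<union> \<kappa>2 ` closure \<Omega>)" using st(4) by (simp add: mult.commute)
  qed
qed

lemma quadratic_form_bounds:
  assumes ab: "numerical_range = {a..b}" and x: "x \<in> closure \<Omega>"
  shows "a * (norm v)\<^sup>2 \<le> (K x *v v) \<bullet> v" "(K x *v v) \<bullet> v \<le> b * (norm v)\<^sup>2"
proof -
  obtain s t where st: "s \<ge> 0" "t \<ge> 0" "s + t = (norm v)\<^sup>2" "(K x *v v) \<bullet> v = \<kappa>1 x * s + \<kappa>2 x * t"
    using quadratic_form[OF x, of v] by blast
  have \<kappa>: "a \<le> \<kappa>1 x" "\<kappa>1 x \<le> b" "a \<le> \<kappa>2 x" "\<kappa>2 x \<le> b" using eigenvalues_in_numerical_range[OF x] ab by auto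
  have "a * s + a * t \<le> \<kappa>1 x * s + \<kappa>2 x * t" "\<kappa>1 x * s + \<kappa>2 x * t \<le> b * s + b * t"
    by (intro add_mono mult_right_mono \<kappa> st)+
  then show "a * (norm v)\<^sup>2 \<le> (K x *v v) \<bullet> v" "(K x *v v) \<bullet> v \<le> b * (norm v)\<^sup>2"
    unfolding st(3)[symmetric] st(4) by (simp_all add: distrib_left)
qed

lemma numerical_range_endpoints:
  assumes ab: "numerical_range = {a..b}" "a \<le> b"
  shows "(INF x\<in>closure \<Omega>. min (\<kappa>1 x) (\<kappa>2 x)) = a" "(SUP x\<in>closure \<Omega>. max (\<kappa>1 x) (\<kappa>2 x)) = b"
proof -
  have \<kappa>: "a \<le> min (\<kappa>1 x) (\<kappa>2 x)" "max (\<kappa>1 x) (\<kappa>2 x) \<le> b" if "x \<in> closure \<Omega>" for x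
    using eigenvalues_in_numerical_range[OF that] ab(1) by auto
  have attained: "\<exists>x\<in>closure \<Omega>. min (\<kappa>1 x) (\<kappa>2 x) \<le> l \<and> l \<le> max (\<kappa>1 x) (\<kappa>2 x)" if "l \<in> numerical_range" for l
  proof -
    obtain x \<xi> where x: "x \<in> closure \<Omega>" "norm \<xi> = 1" "l = (K x *v \<xi>) \<bullet> \<xi>"
      using \<open>l \<in> numerical_range\<close> unfolding numerical_range_def by auto
    obtain s t where st: "s \<ge> 0" "t \<ge> 0" "s + t = 1" "l = \<kappa>1 x * s + \<kappa>2 x * t"
      using quadratic_form[OF x(1), of \<xi>] x(2,3) by auto
    have "min (\<kappa>1 x) (\<kappa>2 x) * s + min (\<kappa>1 x) (\<kappa>2 x) * t \<le> l" "l \<le> max (\<kappa>1 x) (\<kappa>2 x) * s + max (\<kappa>1 x) (\<kappa>2 x) * t"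
      unfolding st(4) by (intro add_mono mult_right_mono st; simp)+
    then show ?thesis using x(1) st(3) unfolding distrib_left[symmetric] by (intro bexI[of _ x]) simp_all
  qed
  obtain x where x: "x \<in> closure \<Omega>" "min (\<kappa>1 x) (\<kappa>2 x) \<le> a" using attained[of a] ab by auto
  have "a \<in> (\<lambda>x. min (\<kappa>1 x) (\<kappa>2 x)) ` closure \<Omega>"
    by (rule image_eqI[OF _ x(1)], rule antisym[OF \<kappa>(1)[OF x(1)] x(2)])
  then show "(INF x\<in>closure \<Omega>. min (\<kappa>1 x) (\<kappa>2 x)) = a"
    by (rule cInf_eq_minimum) (use \<kappa>(1) in blast)
  obtain y where y: "y \<in> closure \<Omega>" "b \<le> max (\<kappa>1 y) (\<kappa>2 y)" using attained[of b] ab by auto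
  have "b \<in> (\<lambda>x. max (\<kappa>1 x) (\<kappa>2 x)) ` closure \<Omega>"
    by (rule image_eqI[OF _ y(1)], rule antisym[OF y(2) \<kappa>(2)[OF y(1)]])
  then show "(SUP x\<in>closure \<Omega>. max (\<kappa>1 x) (\<kappa>2 x)) = b"
    by (rule cSup_eq_maximum) (use \<kappa>(2) in blast)
qed

text \<open>The spectral values come from points of the open domain; values at boundary points are limits of these.\<close>

lemma numerical_range_approximable:
  assumes "l \<in> numerical_range" "\<epsilon> > 0"
  shows "\<exists>x\<in>\<Omega>. \<exists>\<xi>. norm \<xi> = 1 \<and> \<bar>l - (K x *v \<xi>) \<bullet> \<xi>\<bar> < \<epsilon>"
proof -
  obtain x0 \<xi> where x: "x0 \<in> closure \<Omega>" "norm \<xi> = 1" "l = (K x0 *v \<xi>) \<bullet> \<xi>"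
    using assms(1) unfolding numerical_range_def by auto
  have "continuous_on (closure \<Omega>) (\<lambda>x. (\<lambda>(x, \<xi>). (K x *v \<xi>) \<bullet> \<xi>) (x, \<xi>))"
    by (rule continuous_on_compose2[OF continuous_quadratic_form]) (auto intro!: continuous_intros)
  then have "continuous_on (closure \<Omega>) (\<lambda>x. (K x *v \<xi>) \<bullet> \<xi>)" by simp
  then obtain d where d: "d > 0" "\<forall>x\<in>closure \<Omega>. dist x x0 < d \<longrightarrow> dist ((K x *v \<xi>) \<bullet> \<xi>) ((K x0 *v \<xi>) \<bullet> \<xi>) < \<epsilon>"
    using x(1) assms(2) unfolding continuous_on_iff by blast
  obtain y where y: "y \<in> \<Omega>" "dist y x0 < d" using x(1) d(1) closure_approachable by blast
  then have "dist ((K y *v \<xi>) \<bullet> \<xi>) l < \<epsilon>" using d(2) closure_subset x(3) by blast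
  then show ?thesis using y(1) x(2) by (intro bexI[of _ y] exI[of _ \<xi>]) (simp_all add: dist_real_def abs_minus_commute)
qed

lemma tensor_bounded: "\<exists>C\<ge>0. \<forall>x\<in>closure \<Omega>. \<forall>v. norm (K x *v v) \<le> C * norm v"
proof -
  have "compact (K ` closure \<Omega>)" using bounded by (intro compact_continuous_image[OF K_cont_closure]) simp
  then obtain B where B: "B > 0" "\<forall>A\<in>K ` closure \<Omega>. norm A \<le> B" using compact_imp_bounded bounded_pos by blast
  have "norm (K x *v v) \<le> (2 * B) * norm v" if "x \<in> closure \<Omega>" for x v
  proof -
    have "norm (K x *v v) \<le> 2 * norm (K x) * norm v" using norm_matrix_vector_le[of "K x" v] by simp
    also have "\<dots> \<le> (2 * B) * norm v" using B that by (intro mult_right_mono) auto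
    finally show ?thesis .
  qed
  then show ?thesis using B(1) by (intro exI[of _ "2 * B"]) simp
qed

end

theorem mainTheorem2:
  fixes \<Omega> :: "(real^2) set"
    and K Q :: "real^2 \<Rightarrow> real^2^2"
    and \<kappa>1 \<kappa>2 :: "real^2 \<Rightarrow> real"
  assumes "domain_set \<Omega>" and "bounded \<Omega>" and "lipschitz_boundary \<Omega>"
    and "\<And>x. x \<in> closure \<Omega> \<Longrightarrow> transpose (K x) = K x"
    and "continuous_on (closure \<Omega>) K"
    and "\<And>x. x \<in> closure \<Omega> \<Longrightarrow> orthogonal_matrix (Q x)"
    and "\<And>x. x \<in> closure \<Omega> \<Longrightarrow> K x = Q x ** diag2 (\<kappa>1 x) (\<kappa>2 x) ** transpose (Q x)"
  shows "spectrum_V \<Omega> (precond_op \<Omega> K) =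
           complex_of_real ` (convex hull (\<kappa>1 ` closure \<Omega> \<union> \<kappa>2 ` closure \<Omega>)) \<and>
         convex hull (\<kappa>1 ` closure \<Omega> \<union> \<kappa>2 ` closure \<Omega>) =
           {(INF x\<in>closure \<Omega>. min (\<kappa>1 x) (\<kappa>2 x)) .. (SUP x\<in>closure \<Omega>. max (\<kappa>1 x) (\<kappa>2 x))}"
proof -
  interpret S: spectral_tensor \<Omega> K Q \<kappa>1 \<kappa>2
    using assms unfolding domain_set_def by unfold_locales blast+
  obtain a b where ab: "S.numerical_range = {a..b}" "a \<le> b" using S.numerical_range_interval by blast
  obtain C where C: "C \<ge> 0" "\<And>x v. x \<in> closure \<Omega> \<Longrightarrow> norm (K x *v v) \<le> C * norm v"
    using S.tensor_bounded by blast
  have sub: "x \<in> closure \<Omega>" if "x \<in> \<Omega>" for x using that closure_subset by blast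
  interpret T: tensor_domain \<Omega> K a b C
  proof
    show "open \<Omega>" using assms(1) by (simp add: domain_set_def)
    show "bounded \<Omega>" by (rule assms(2))
    show "\<exists>x0 r. r > 0 \<and> ball x0 r \<subseteq> \<Omega> \<and> controlled \<Omega> (ball x0 r) \<Omega>"
      by (rule poincare_inequality[OF assms(1,2,3)])
    show "continuous_on \<Omega> K" by (rule continuous_on_subset[OF assms(5) closure_subset])
    show "transpose (K x) = K x" if "x \<in> \<Omega>" for x by (rule assms(4)[OF sub[OF that]])
    show "a * (norm v)\<^sup>2 \<le> (K x *v v) \<bullet> v" if "x \<in> \<Omega>" for x v
      by (rule S.quadratic_form_bounds(1)[OF ab(1) sub[OF that]])
    show "(K x *v v) \<bullet> v \<le> b * (norm v)\<^sup>2" if "x \<in> \<Omega>" for x v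
      by (rule S.quadratic_form_bounds(2)[OF ab(1) sub[OF that]])
    show "0 \<le> C" by (rule C(1))
    show "norm (K x *v v) \<le> C * norm v" if "x \<in> \<Omega>" for x v by (rule C(2)[OF sub[OF that]])
  qed
  have "complex_of_real l \<in> spectrum_V \<Omega> (precond_op \<Omega> K)" if l: "l \<in> {a..b}" for l
    by (rule T.spectrum_superset, rule S.numerical_range_approximable) (use l ab(1) in simp_all)
  then have "spectrum_V \<Omega> (precond_op \<Omega> K) = complex_of_real ` {a..b}"
    using T.spectrum_subset by blast
  then show ?thesis
    using ab S.numerical_range_eq_hull S.numerical_range_endpoints[OF ab] by simp
qed

end
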